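(* Let $L,T>0$, $\Omega=(0,L)\times(0,T)$, $\alpha>0$, and let $v_c$ be a given finite bound defining $\mathcal{V}_{ad}=\{v\in L^2(0,L):\|v\|_{L^2(0,L)}\le v_c\}$. Let $k\in L^\infty(0,L)$ be positive and finite-valued, $w\in H^2(0,L)$, $F\in L^2(\Omega)$, and $y\in L^2(\Omega)$. For $v\in\mathcal{V}_{ad}$ let $u(x,t;v)$ be the weak solution of the beam problem with data $(w,v,F)$, and let $$J_\alpha(v)=\int_0^T\int_0^L\big[u(x,t;v)-y(x,t)\big]^2\,dx\,dt+\alpha\int_0^L v(x)^2\,dx .$$ Then there exists a unique optimal control, i.e. a unique $v^*\in\mathcal{V}_{ad}$ such that $J_\alpha(v^* )=\inf_{v\in\mathcal{V}_{ad}}J_\alpha(v)$.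
   Context: All functions are real-valued. $H^{2,1}(\Omega)$ is the space of all $f\in L^2(\Omega)$ with weak derivatives $f_t,f_x,f_{xx}\in L^2(\Omega)$, with norm $\|f\|_{H^{2,1}(\Omega)}=\big(\int_0^T\int_0^L[f^2+f_t^2+f_x^2+f_{xx}^2]\,dx\,dt\big)^{1/2}$. $\hat H^{2,1}(\Omega)$ is the subset of those $f\in H^{2,1}(\Omega)$ with $f(0,t)=f(L,t)=0$ for all $t\in[0,T]$, with the same norm. The beam problem with data $(w,v,F)$ is: $u_{tt}+(k(x)u_{xx})_{xx}=F(x,t)$ in $\Omega$; $u(x,0)=w(x)$, $u_t(x,0)=v(x)$ for $x\in(0,L)$; $u(0,t)=u(L,t)=u_{xx}(0,t)=u_{xx}(L,t)=0$ for $t\in(0,T)$. A weak solution is a function $u\in\hat H^{2,1}(\Omega)$ with $u(x,0)=w(x)$ for $x\in(0,L)$ such that $$\int_0^T\int_0^L(-u_t\eta_t+k(x)u_{xx}\eta_{xx})\,dx\,dt=\int_0^T\int_0^L\eta F\,dx\,dt+\int_0^L v(x)\eta(x,0)\,dx$$ for all $\eta\in\hat H^{2,1}(\Omega)$ with $\eta(x,T)=0$ for all $x\in(0,L)$.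
   Formalization: It is assumed explicitly that for every v in V_ad the beam problem with data (w,v,F) has a weak solution; for arbitrary w in H^2(0,L) this may fail (e.g. w = 1, incompatible with u(0,t)=0), leaving J_α undefined. Uniqueness of weak solutions is not assumed. *)

theory Defs
  imports "HOL-Analysis.Analysis"
begin

definition L2 :: "'a::euclidean_space set \<Rightarrow> ('a \<Rightarrow> real) set" where
  "L2 S = {f. f \<in> borel_measurable (lebesgue_on S) \<and>
              integrable (lebesgue_on S) (\<lambda>x. (f x)\<^sup>2)}"

definition L2_norm :: "'a::euclidean_space set \<Rightarrow> ('a \<Rightarrow> real) \<Rightarrow> real" where
  "L2_norm S f = sqrt (LINT x|lebesgue_on S. (f x)\<^sup>2)"

definition Linfty :: "'a::euclidean_space set \<Rightarrow> ('a \<Rightarrow> real) set" where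
  "Linfty S = {f. f \<in> borel_measurable (lebesgue_on S) \<and>
                  (\<exists>C. AE x in lebesgue_on S. \<bar>f x\<bar> \<le> C)}"

definition partial_deriv :: "'a::euclidean_space \<Rightarrow> ('a \<Rightarrow> real) \<Rightarrow> 'a \<Rightarrow> real" where
  "partial_deriv b f x = deriv (\<lambda>s. f (x + s *\<^sub>R b)) 0"

primrec Ck :: "nat \<Rightarrow> ('a::euclidean_space \<Rightarrow> real) \<Rightarrow> bool" where
  "Ck 0 f \<longleftrightarrow> continuous_on UNIV f"
| "Ck (Suc n) f \<longleftrightarrow> continuous_on UNIV f \<and>
     (\<forall>b\<in>Basis. (\<forall>x. (\<lambda>s. f (x + s *\<^sub>R b)) field_differentiable (at 0)) \<and>
                Ck n (partial_deriv b f))"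

definition test_functions :: "'a::euclidean_space set \<Rightarrow> ('a \<Rightarrow> real) set" where
  "test_functions S = {\<phi>. (\<forall>n. Ck n \<phi>) \<and>
     compact (closure {x. \<phi> x \<noteq> 0}) \<and> closure {x. \<phi> x \<noteq> 0} \<subseteq> S}"

text \<open>The list \<open>bs\<close> of directions plays the role of a multi-index. Membership of both functions in
  \<open>L2 S\<close> guarantees that all the integrals below are integrals of integrable functions. The weak
  derivative is determined only up to null sets, hence a relation.\<close>

definition has_weak_deriv ::
    "'a::euclidean_space set \<Rightarrow> 'a list \<Rightarrow> ('a \<Rightarrow> real) \<Rightarrow> ('a \<Rightarrow> real) \<Rightarrow> bool" where
  "has_weak_deriv S bs f g \<longleftrightarrow> f \<in> L2 S \<and> g \<in> L2 S \<and>
     (\<forall>\<phi>\<in>test_functions S.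
        (LINT x|lebesgue_on S. f x * foldr partial_deriv bs \<phi> x) =
        (- 1) ^ length bs * (LINT x|lebesgue_on S. g x * \<phi> x))"

text \<open>Points of the space-time domain are pairs \<open>(x, t)\<close>.\<close>

definition \<Omega> :: "real \<Rightarrow> real \<Rightarrow> (real \<times> real) set" where
  "\<Omega> L T = {0<..<L} \<times> {0<..<T}"

abbreviation e_x :: "real \<times> real" where "e_x \<equiv> (1, 0)"
abbreviation e_t :: "real \<times> real" where "e_t \<equiv> (0, 1)"

text \<open>Every class in \<open>H\<^sup>2(0,L)\<close> and in \<open>H\<^sup>2\<^sup>,\<^sup>1(\<Omega>)\<close> has a unique representative that is continuous up
  to the boundary. The elements of the two spaces below are these representatives, so that the
  values prescribed on the boundary, and at the initial and final times, are values of functions.\<close>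

definition H2 :: "real \<Rightarrow> (real \<Rightarrow> real) set" where
  "H2 L = {w. continuous_on {0..L} w \<and> w \<in> L2 {0<..<L} \<and>
     (\<exists>w_x w_xx. has_weak_deriv {0<..<L} [1] w w_x \<and>
                 has_weak_deriv {0<..<L} [1, 1] w w_xx)}"

definition H21 :: "real \<Rightarrow> real \<Rightarrow> (real \<times> real \<Rightarrow> real) set" where
  "H21 L T = {f. continuous_on ({0..L} \<times> {0..T}) f \<and> f \<in> L2 (\<Omega> L T) \<and>
     (\<exists>f_t f_x f_xx. has_weak_deriv (\<Omega> L T) [e_t] f f_t \<and>
                     has_weak_deriv (\<Omega> L T) [e_x] f f_x \<and>
                     has_weak_deriv (\<Omega> L T) [e_x, e_x] f f_xx)}"

definition H21_hat :: "real \<Rightarrow> real \<Rightarrow> (real \<times> real \<Rightarrow> real) set" where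
  "H21_hat L T = {f \<in> H21 L T. \<forall>t\<in>{0..T}. f (0, t) = 0 \<and> f (L, t) = 0}"

definition weak_solution ::
    "real \<Rightarrow> real \<Rightarrow> (real \<Rightarrow> real) \<Rightarrow> (real \<Rightarrow> real) \<Rightarrow> (real \<Rightarrow> real) \<Rightarrow>
     (real \<times> real \<Rightarrow> real) \<Rightarrow> (real \<times> real \<Rightarrow> real) \<Rightarrow> bool" where
  "weak_solution L T k w v F u \<longleftrightarrow>
     u \<in> H21_hat L T \<and> (\<forall>x\<in>{0<..<L}. u (x, 0) = w x) \<and>
     (\<exists>u_t u_xx. has_weak_deriv (\<Omega> L T) [e_t] u u_t \<and>
                 has_weak_deriv (\<Omega> L T) [e_x, e_x] u u_xx \<and>
       (\<forall>\<eta> \<eta>_t \<eta>_xx. \<eta> \<in> H21_hat L T \<longrightarrow> (\<forall>x\<in>{0<..<L}. \<eta> (x, T) = 0) \<longrightarrow>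
          has_weak_deriv (\<Omega> L T) [e_t] \<eta> \<eta>_t \<longrightarrow>
          has_weak_deriv (\<Omega> L T) [e_x, e_x] \<eta> \<eta>_xx \<longrightarrow>
          (LINT p|lebesgue_on (\<Omega> L T). - u_t p * \<eta>_t p + k (fst p) * u_xx p * \<eta>_xx p) =
          (LINT p|lebesgue_on (\<Omega> L T). \<eta> p * F p) +
          (LINT x|lebesgue_on {0<..<L}. v x * \<eta> (x, 0))))"

definition V_ad :: "real \<Rightarrow> real \<Rightarrow> (real \<Rightarrow> real) set" where
  "V_ad L v_c = {v \<in> L2 {0<..<L}. L2_norm {0<..<L} v \<le> v_c}"

text \<open>The argument \<open>u\<close> is the control-to-state map: \<open>u v\<close> is the state with initial velocity \<open>v\<close>.\<close>

definition J_cost ::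
    "real \<Rightarrow> real \<Rightarrow> real \<Rightarrow> (real \<times> real \<Rightarrow> real) \<Rightarrow> ((real \<Rightarrow> real) \<Rightarrow> real \<times> real \<Rightarrow> real) \<Rightarrow>
     (real \<Rightarrow> real) \<Rightarrow> real" where
  "J_cost L T \<alpha> y u v =
     (LINT p|lebesgue_on (\<Omega> L T). (u v p - y p)\<^sup>2) + \<alpha> * (LINT x|lebesgue_on {0<..<L}. (v x)\<^sup>2)"

end

theory Submission
  imports Defs
begin

text \<open>Let \<open>u\<close> be the difference of two weak solutions with the same \<open>w\<close> and \<open>F\<close>, and let \<open>z\<close> be the
  difference of the initial velocities. Testing the weak formulation with
  \<open>\<eta>(x, t) = - \<integral> exp (- s) u(x, s) ds\<close> (over \<open>s\<close> from \<open>t\<close> to \<open>T\<close>) turns both terms of the energy into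
  derivatives of squares with respect to time, up to the weight \<open>exp (- t)\<close>, which contributes the
  good term \<open>1/2 \<integral>\<integral> exp (- t) u\<^sup>2\<close>. This gives \<open>\<integral>\<integral> u\<^sup>2 \<le> 4 T exp T \<integral> z\<^sup>2\<close> with no lower bound on \<open>k\<close>.
  Applied to affine combinations of solutions, the estimate shows that the control-to-state map is
  affine and Lipschitz in \<open>L\<^sup>2\<close>. Hence \<open>J\<close> is continuous and strongly convex: minimising sequences
  are Cauchy, their limit is a minimiser, and two minimisers agree almost everywhere.\<close>

section \<open>Test functions\<close>

text \<open>The classical multiplier \<open>u_t\<close> is not admissible: a weak solution has
  \<open>u_t\<close> only in \<open>L2\<close>, without second space derivatives, and a test
  function must vanish at t = T. A time primitive of \<open>u\<close> keeps its space regularity and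
  boundary values and vanishes at T by construction. With weight 1 it would leave only squares at
  the two end times, and the norm of \<open>u\<close> over \<Omega> would have to come from varying
  T and a Gronwall argument; the weight gives that norm from a single test function. In 4 T exp T,
  the 4 comes from absorbing a quarter of the weighted norm, T from regarding z as constant in time,
  and exp T from removing the weight. The bulk of the work justifies this choice for weak
  derivatives: the primitive has to be continuous up to the boundary and to possess the required
  weak derivatives, and \<open>u\<close> has to be recovered from \<open>u_t\<close> on almost every
  line in the time direction. Existence of states is a hypothesis, so only their stability is at
  stake.\<close>

lemma partial_derivI:
  "((\<lambda>s. f (x + s *\<^sub>R b)) has_real_derivative D) (at 0) \<Longrightarrow> partial_deriv b f x = D"
  unfolding partial_deriv_def by (rule DERIV_imp_deriv)

lemma Ck_imp_continuous: "Ck n f \<Longrightarrow> continuous_on UNIV f"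
  by (cases n) auto

lemma Ck_has_partial_deriv:
  assumes "Ck (Suc n) f" "b \<in> Basis"
  shows "((\<lambda>s. f (x + s *\<^sub>R b)) has_real_derivative partial_deriv b f x) (at 0)"
  using assms unfolding partial_deriv_def by (auto simp: DERIV_deriv_iff_field_differentiable)

lemma Ck_partial_deriv: "Ck (Suc n) f \<Longrightarrow> b \<in> Basis \<Longrightarrow> Ck n (partial_deriv b f)"
  by simp

text \<open>\<open>Ck\<close> refers to the total function \<open>deriv\<close>; any candidate
  \<open>D\<close> with the right difference quotients is identified with
  \<open>partial_deriv\<close>, so smoothness proofs become inductions over families of explicit
  candidates.\<close>

lemma Ck_SucI:
  assumes "continuous_on UNIV f"
    and "\<And>b x. b \<in> Basis \<Longrightarrow> ((\<lambda>s. f (x + s *\<^sub>R b)) has_real_derivative D b x) (at 0)"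
    and "\<And>b. b \<in> Basis \<Longrightarrow> Ck n (D b)"
  shows "Ck (Suc n) f"
proof -
  have "partial_deriv b f = D b" if "b \<in> Basis" for b
    using assms(2)[OF that] by (intro ext partial_derivI)
  then show ?thesis
    using assms by (auto simp: field_differentiable_def)
qed

lemma Ck_Suc_imp: "Ck (Suc n) f \<Longrightarrow> Ck n f"
  by (induction n arbitrary: f) auto

lemma Ck_const [simp]: "Ck n (\<lambda>x. c)"
proof (induction n arbitrary: c)
  case (Suc n)
  then show ?case by (intro Ck_SucI[where D = "\<lambda>b x. 0"]) auto
qed auto

lemma Ck_add:
  "Ck n f \<Longrightarrow> Ck n g \<Longrightarrow> Ck n (\<lambda>x. f x + g x)"
proof (induction n arbitrary: f g)
  case 0
  then show ?case by (auto intro!: continuous_intros)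
next
  case (Suc n)
  show ?case
  proof (rule Ck_SucI[where D = "\<lambda>b x. partial_deriv b f x + partial_deriv b g x"])
    show "continuous_on UNIV (\<lambda>x. f x + g x)"
      using Ck_imp_continuous[OF Suc.prems(1)] Ck_imp_continuous[OF Suc.prems(2)]
      by (auto intro!: continuous_intros)
    fix b :: 'a assume b: "b \<in> Basis"
    show "((\<lambda>s. f (x + s *\<^sub>R b) + g (x + s *\<^sub>R b)) has_real_derivative
        partial_deriv b f x + partial_deriv b g x) (at 0)" for x
      by (rule DERIV_add[OF Ck_has_partial_deriv[OF Suc.prems(1) b] Ck_has_partial_deriv[OF Suc.prems(2) b]])
    show "Ck n (\<lambda>x. partial_deriv b f x + partial_deriv b g x)"
      by (intro Suc.IH Ck_partial_deriv[OF _ b] Suc.prems)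
  qed
qed

lemma Ck_mult:
  "Ck n f \<Longrightarrow> Ck n g \<Longrightarrow> Ck n (\<lambda>x. f x * g x)"
proof (induction n arbitrary: f g)
  case 0
  then show ?case by (auto intro!: continuous_intros)
next
  case (Suc n)
  show ?case
  proof (rule Ck_SucI[where D = "\<lambda>b x. partial_deriv b f x * g x + partial_deriv b g x * f x"])
    show "continuous_on UNIV (\<lambda>x. f x * g x)"
      using Ck_imp_continuous[OF Suc.prems(1)] Ck_imp_continuous[OF Suc.prems(2)]
      by (auto intro!: continuous_intros)
    fix b :: 'a assume b: "b \<in> Basis"
    show "((\<lambda>s. f (x + s *\<^sub>R b) * g (x + s *\<^sub>R b)) has_real_derivative
        partial_deriv b f x * g x + partial_deriv b g x * f x) (at 0)" for x
      using DERIV_mult[OF Ck_has_partial_deriv[OF Suc.prems(1) b, of x]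
          Ck_has_partial_deriv[OF Suc.prems(2) b, of x]] by simp
    show "Ck n (\<lambda>x. partial_deriv b f x * g x + partial_deriv b g x * f x)"
      by (intro Ck_add Suc.IH Ck_partial_deriv[OF Suc.prems(1) b] Ck_partial_deriv[OF Suc.prems(2) b]
          Ck_Suc_imp[OF Suc.prems(1)] Ck_Suc_imp[OF Suc.prems(2)])
  qed
qed

section \<open>Smoothness on the line, of compositions with projections, and of slices\<close>

lemma has_deriv_partial_deriv_1:
  fixes f :: "real \<Rightarrow> real"
  assumes "Ck (Suc n) f"
  shows "(f has_real_derivative partial_deriv 1 f x) (at x)"
  using Ck_has_partial_deriv[OF assms, of 1 x] DERIV_shift[of f "partial_deriv 1 f x" 0 x]
  by (simp add: add.commute)

lemma Ck_SucI_real: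
  fixes f :: "real \<Rightarrow> real"
  assumes "\<And>x. (f has_real_derivative D x) (at x)" "Ck n D"
  shows "Ck (Suc n) f"
proof (rule Ck_SucI[where D = "\<lambda>_. D"])
  show "continuous_on UNIV f"
    using assms(1) by (meson DERIV_isCont continuous_at_imp_continuous_on)
  show "((\<lambda>s. f (x + s *\<^sub>R b)) has_real_derivative D x) (at 0)" if "b \<in> Basis" for b x
    using that assms(1)[of x] DERIV_shift[of f "D x" 0 x] by (simp add: add.commute)
qed (use assms in auto)

lemma Ck_affine:
  fixes f :: "real \<Rightarrow> real"
  shows "Ck n f \<Longrightarrow> Ck n (\<lambda>x. f (a * x + b))"
proof (induction n arbitrary: f)
  case 0
  then show ?case by (auto intro!: continuous_intros continuous_on_compose2[of UNIV f])
next
  case (Suc n)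
  show ?case
  proof (rule Ck_SucI_real[where D = "\<lambda>x. a * partial_deriv 1 f (a * x + b)"])
    show "Ck n (\<lambda>x. a * partial_deriv 1 f (a * x + b))"
      by (intro Ck_mult Ck_const Suc.IH Ck_partial_deriv Suc.prems) auto
    show "((\<lambda>x. f (a * x + b)) has_real_derivative a * partial_deriv 1 f (a * x + b)) (at x)" for x
      by (rule DERIV_cong, rule DERIV_chain2[OF has_deriv_partial_deriv_1[OF Suc.prems]])
        (auto intro!: derivative_eq_intros)
  qed
qed

lemma Ck_fst:
  fixes f :: "real \<Rightarrow> real"
  shows "Ck n f \<Longrightarrow> Ck n (\<lambda>p::real\<times>real. f (fst p))"
proof (induction n arbitrary: f)
  case 0
  then show ?case by (auto intro!: continuous_intros continuous_on_compose2[of UNIV f])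
next
  case (Suc n)
  show ?case
  \<comment> \<open>The factor \<open>fst b\<close> is 1 for \<open>e_x\<close> and 0 for
    \<open>e_t\<close>, so one formula covers both basis directions.\<close>
  proof (rule Ck_SucI[where D = "\<lambda>b p. fst b * partial_deriv 1 f (fst p)"])
    show "continuous_on UNIV (\<lambda>p::real\<times>real. f (fst p))"
      using Ck_imp_continuous[OF Suc.prems]
      by (auto intro!: continuous_intros continuous_on_compose2[of UNIV f])
    show "Ck n (\<lambda>p::real\<times>real. fst b * partial_deriv 1 f (fst p))" for b :: "real \<times> real"
      by (intro Ck_mult Ck_const Suc.IH Ck_partial_deriv Suc.prems) auto
    show "((\<lambda>s. f (fst (x + s *\<^sub>R b))) has_real_derivative fst b * partial_deriv 1 f (fst x)) (at 0)"
      if "b \<in> Basis" for b x :: "real \<times> real"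
      using that Ck_has_partial_deriv[OF Suc.prems, of 1 "fst x"] by (auto simp: Basis_prod_def)
  qed
qed

lemma Ck_snd:
  fixes f :: "real \<Rightarrow> real"
  shows "Ck n f \<Longrightarrow> Ck n (\<lambda>p::real\<times>real. f (snd p))"
proof (induction n arbitrary: f)
  case 0
  then show ?case by (auto intro!: continuous_intros continuous_on_compose2[of UNIV f])
next
  case (Suc n)
  show ?case
  proof (rule Ck_SucI[where D = "\<lambda>b p. snd b * partial_deriv 1 f (snd p)"])
    show "continuous_on UNIV (\<lambda>p::real\<times>real. f (snd p))"
      using Ck_imp_continuous[OF Suc.prems]
      by (auto intro!: continuous_intros continuous_on_compose2[of UNIV f])
    show "Ck n (\<lambda>p::real\<times>real. snd b * partial_deriv 1 f (snd p))" for b :: "real \<times> real"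
      by (intro Ck_mult Ck_const Suc.IH Ck_partial_deriv Suc.prems) auto
    show "((\<lambda>s. f (snd (x + s *\<^sub>R b))) has_real_derivative snd b * partial_deriv 1 f (snd x)) (at 0)"
      if "b \<in> Basis" for b x :: "real \<times> real"
      using that Ck_has_partial_deriv[OF Suc.prems, of 1 "snd x"] by (auto simp: Basis_prod_def)
  qed
qed

lemma Ck_slice:
  fixes \<phi> :: "real \<times> real \<Rightarrow> real"
  shows "Ck n \<phi> \<Longrightarrow> Ck n (\<lambda>x. \<phi> (x, t))"
proof (induction n arbitrary: \<phi>)
  case 0
  then show ?case by (auto intro!: continuous_intros continuous_on_compose2[of UNIV \<phi>])
next
  case (Suc n)
  have b: "e_x \<in> Basis" by (auto simp: Basis_prod_def)
  show ?case
  proof (rule Ck_SucI_real[where D = "\<lambda>x. partial_deriv e_x \<phi> (x, t)"])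
    show "Ck n (\<lambda>x. partial_deriv e_x \<phi> (x, t))"
      by (intro Suc.IH Ck_partial_deriv Suc.prems b)
    show "((\<lambda>x. \<phi> (x, t)) has_real_derivative partial_deriv e_x \<phi> (x, t)) (at x)" for x
      using Ck_has_partial_deriv[OF Suc.prems b, of "(x, t)"]
        DERIV_shift[of "\<lambda>x. \<phi> (x, t)" "partial_deriv e_x \<phi> (x, t)" 0 x]
      by (simp add: add.commute)
  qed
qed

section \<open>Flat functions and compactly supported bumps\<close>

definition flat_fun :: "nat \<Rightarrow> real \<Rightarrow> real" where
  "flat_fun m x = (if x > 0 then (1 / x) ^ m * exp (- (1 / x)) else 0)"

text \<open>In the variable 1/x this is the decay of a power against the exponential; to the left of
  0 the function vanishes identically.\<close>

lemma flat_fun_tendsto_0: "((\<lambda>x. flat_fun m x) \<longlongrightarrow> 0) (at 0)"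
proof -
  have "((\<lambda>x. x ^ m / exp x) \<longlongrightarrow> (0::real)) at_top"
    by (rule tendsto_power_div_exp_0)
  then have "((\<lambda>x. inverse x ^ m / exp (inverse x)) \<longlongrightarrow> (0::real)) (at_right 0)"
    by (rule filterlim_compose[OF _ filterlim_inverse_at_top_right])
  then have *: "((\<lambda>x. flat_fun m x) \<longlongrightarrow> 0) (at_right 0)"
    by (rule Lim_transform_eventually)
      (auto simp: flat_fun_def eventually_at_filter field_simps exp_minus)
  have "((\<lambda>x. flat_fun m x) \<longlongrightarrow> 0) (at_left 0)"
    by (rule Lim_transform_eventually[of "\<lambda>_. 0"]) (auto simp: flat_fun_def eventually_at_filter)
  with * show ?thesis by (simp add: filterlim_split_at)
qed

text \<open>The functions x^-m exp (-1/x) are closed under differentiation up to linear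
  combinations. This is why the whole family in \<open>m\<close>, and not only the classical case m
  = 0, is carried along: smoothness follows by induction with \<open>m\<close> arbitrary.\<close>

lemma flat_fun_has_deriv:
  "(flat_fun m has_real_derivative - real m * flat_fun (Suc m) x + flat_fun (Suc (Suc m)) x) (at x)"
proof -
  consider "x > 0" | "x = 0" | "x < 0" by linarith
  then show ?thesis
  proof cases
    case 1
    have "((\<lambda>x. (1 / x) ^ m * exp (- (1 / x))) has_real_derivative
        - real m * flat_fun (Suc m) x + flat_fun (Suc (Suc m)) x) (at x)"
    proof (cases m)
      case 0
      then show ?thesis using 1
        by (auto intro!: derivative_eq_intros simp: flat_fun_def field_simps power2_eq_square)
    next
      case (Suc k)
      have *: "((\<lambda>x. (1 / x) ^ Suc k) has_real_derivative real (Suc k) * (1 / x) ^ k * (- 1 / x\<^sup>2)) (at x)"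
        using 1 by (auto intro!: derivative_eq_intros simp: power2_eq_square simp del: power_Suc)
      have **: "((\<lambda>x. exp (- (1 / x))) has_real_derivative exp (- (1 / x)) * (1 / x\<^sup>2)) (at x)"
        using 1 by (auto intro!: derivative_eq_intros simp: power2_eq_square)
      show ?thesis
        unfolding Suc using 1
        by (intro DERIV_cong[OF DERIV_mult[OF * **]])
          (simp add: flat_fun_def power2_eq_square add_divide_distrib diff_divide_distrib algebra_simps)
    qed
    then show ?thesis
      by (rule has_field_derivative_transform_within_open[where S = "{0<..}"])
        (use 1 in \<open>auto simp: flat_fun_def\<close>)
  next
    case 2
    \<comment> \<open>At 0 the difference quotient of \<open>flat_fun m\<close> is the next member
      of the family, whose limit at 0 is already known.\<close>
    have "(\<lambda>h. (flat_fun m (0 + h) - flat_fun m 0) / h) = flat_fun (Suc m)"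
      by (auto simp: flat_fun_def)
    then show ?thesis
      unfolding 2 DERIV_def using flat_fun_tendsto_0[of "Suc m"] by (simp add: flat_fun_def[of _ 0])
  next
    case 3
    have "((\<lambda>x. 0) has_real_derivative 0) (at x)" by simp
    then have "(flat_fun m has_real_derivative 0) (at x)"
      by (rule has_field_derivative_transform_within_open[where S = "{..<0}"])
        (use 3 in \<open>auto simp: flat_fun_def\<close>)
    then show ?thesis using 3 by (simp add: flat_fun_def)
  qed
qed

lemma Ck_flat_fun: "Ck n (flat_fun m)"
proof (induction n arbitrary: m)
  case 0
  then show ?case
    using flat_fun_has_deriv by (auto intro!: continuous_at_imp_continuous_on DERIV_isCont)
next
  case (Suc n)
  show ?case
    by (rule Ck_SucI_real[OF flat_fun_has_deriv]) (intro Ck_add Ck_mult Ck_const Suc.IH)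
qed

text \<open>For N > 0 the shift by 1 keeps the support at distance 1/N from \<open>a\<close> and
  \<open>b\<close>, hence compact in the open interval. As N grows, both arguments tend to infinity
  at each point of (a, b), and exp (-1/x) tends to 1 there.\<close>

definition bump :: "nat \<Rightarrow> real \<Rightarrow> real \<Rightarrow> real \<Rightarrow> real" where
  "bump N a b t = flat_fun 0 (N * (t - a) - 1) * flat_fun 0 (N * (b - t) - 1)"

lemma bump_bounds: "0 \<le> bump N a b t" "bump N a b t \<le> 1"
  by (auto simp: bump_def flat_fun_def intro!: mult_le_one)

lemma bump_nonzero_iff:
  assumes "N > 0"
  shows "bump N a b t \<noteq> 0 \<longleftrightarrow> t \<in> {a + 1 / N<..<b - 1 / N}"
  using assms by (auto simp: bump_def flat_fun_def field_simps)

lemma Ck_bump: "Ck n (bump N a b)"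
proof -
  have "bump N a b = (\<lambda>t. flat_fun 0 (real N * t + (- real N * a - 1)) *
      flat_fun 0 ((- real N) * t + (real N * b - 1)))"
    by (auto simp: bump_def algebra_simps)
  then show ?thesis by (simp only:) (intro Ck_mult Ck_affine Ck_flat_fun)
qed

section \<open>Test functions: supports, derivatives, tensor products and slices\<close>

lemma test_functionsD:
  assumes "\<phi> \<in> test_functions S"
  shows "\<And>n. Ck n \<phi>" "\<And>x. x \<notin> S \<Longrightarrow> \<phi> x = 0" "continuous_on UNIV \<phi>"
  using assms closure_subset[of "{x. \<phi> x \<noteq> 0}"] Ck_imp_continuous
  by (auto simp: test_functions_def)

lemma test_functionsI:
  assumes "\<And>n. Ck n \<phi>" "compact K" "K \<subseteq> S" "\<And>x. x \<notin> K \<Longrightarrow> \<phi> x = 0"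
  shows "\<phi> \<in> test_functions S"
proof -
  have "closure {x. \<phi> x \<noteq> 0} \<subseteq> K"
    using assms by (intro closure_minimal compact_imp_closed) auto
  moreover from this have "compact (closure {x. \<phi> x \<noteq> 0})"
    using assms(2) by (meson closed_closure compact_closure bounded_subset compact_imp_bounded closure_subset subset_trans)
  ultimately show ?thesis using assms by (auto simp: test_functions_def)
qed

lemma test_functions_support:
  assumes "\<phi> \<in> test_functions S"
  obtains K where "compact K" "K \<subseteq> S" "\<And>x. x \<notin> K \<Longrightarrow> \<phi> x = 0"
proof
  show "compact (closure {x. \<phi> x \<noteq> 0})" "closure {x. \<phi> x \<noteq> 0} \<subseteq> S"
    using assms by (auto simp: test_functions_def)
  show "\<phi> x = 0" if "x \<notin> closure {x. \<phi> x \<noteq> 0}" for x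
    using that closure_subset[of "{x. \<phi> x \<noteq> 0}"] by auto
qed

lemma bump_test_function:
  assumes "N > 0"
  shows "bump N a b \<in> test_functions {a<..<b}"
proof (rule test_functionsI[where K = "{a + 1 / N..b - 1 / N}"])
  show "bump N a b x = 0" if "x \<notin> {a + 1 / N..b - 1 / N}" for x
    using that bump_nonzero_iff[OF assms, of a b x] by (meson atLeastAtMost_iff greaterThanLessThan_iff less_imp_le)
  show "{a + 1 / N..b - 1 / N} \<subseteq> {a<..<b}"
  proof -
    have "1 / real N > 0" using assms by simp
    then show ?thesis
      by (intro subsetI, unfold atLeastAtMost_iff greaterThanLessThan_iff) linarith
  qed
qed (simp_all add: Ck_bump)

lemma test_functions_mono: "S \<subseteq> S' \<Longrightarrow> test_functions S \<subseteq> test_functions S'"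
  by (auto simp: test_functions_def)

lemma bump_tendsto_indicator: "(\<lambda>N. bump N a b t) \<longlonglongrightarrow> indicator {a<..<b} t"
proof -
  have flat: "(\<lambda>N. flat_fun 0 (real N * d - 1)) \<longlonglongrightarrow> (if d > 0 then 1 else 0)" for d :: real
  proof (cases "d > 0")
    case True
    have lim: "filterlim (\<lambda>N. real N * d - 1) at_top sequentially"
    proof -
      have "filterlim (\<lambda>N. - 1 + real N * d) at_top sequentially"
        by (intro filterlim_tendsto_add_at_top[OF tendsto_const]
            filterlim_at_top_mult_tendsto_pos[OF tendsto_const True] filterlim_real_sequentially)
      then show ?thesis by (simp add: add.commute)
    qed
    have "(\<lambda>N. exp (- (1 / (real N * d - 1)))) \<longlonglongrightarrow> exp (- 0)"
      by (intro tendsto_intros tendsto_divide_0[OF tendsto_const]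
          filterlim_mono[OF lim at_top_le_at_infinity order_refl])
    moreover have "eventually (\<lambda>N. real N * d - 1 > 0) sequentially"
      using lim unfolding filterlim_at_top_dense by blast
    ultimately have "(\<lambda>N. flat_fun 0 (real N * d - 1)) \<longlonglongrightarrow> exp (- 0)"
      by (rule Lim_transform_eventually[OF _ eventually_mono]) (auto simp: flat_fun_def)
    with True show ?thesis by simp
  next
    case False
    then have "flat_fun 0 (real N * d - 1) = 0" for N
      using mult_nonneg_nonpos[of "real N" d] by (auto simp: flat_fun_def)
    with False show ?thesis by simp
  qed
  show ?thesis
    unfolding bump_def using tendsto_mult[OF flat[of "t - a"] flat[of "b - t"]]
    by (auto simp: indicator_def)
qed

lemma partial_deriv_test_function:
  assumes "\<phi> \<in> test_functions S" "b \<in> Basis"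
  shows "partial_deriv b \<phi> \<in> test_functions S"
proof -
  obtain K where K: "compact K" "K \<subseteq> S" "\<And>x. x \<notin> K \<Longrightarrow> \<phi> x = 0"
    using test_functions_support[OF assms(1)] by metis
  show ?thesis
  proof (rule test_functionsI[OF _ K(1,2)])
    show "Ck n (partial_deriv b \<phi>)" for n
      using test_functionsD(1)[OF assms(1)] assms(2) by (intro Ck_partial_deriv)
    fix x assume x: "x \<notin> K"
    \<comment> \<open>The complement of the compact set \<open>K\<close> is open, so \<phi> vanishes
      on a short segment through x in direction b.\<close>
    have "open ((\<lambda>s. x + s *\<^sub>R b) -` (- K))"
      using K(1) by (intro open_vimage) (auto intro!: continuous_intros compact_imp_closed)
    moreover have "0 \<in> (\<lambda>s. x + s *\<^sub>R b) -` (- K)" using x by simp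
    moreover have "((\<lambda>s. 0) has_real_derivative 0) (at 0)" by simp
    ultimately have "((\<lambda>s. \<phi> (x + s *\<^sub>R b)) has_real_derivative 0) (at 0)"
      by - (rule has_field_derivative_transform_within_open, assumption, assumption, assumption,
        use K(3) in auto)
    then show "partial_deriv b \<phi> x = 0" by (rule partial_derivI)
  qed
qed

lemma tensor_test_function:
  fixes \<psi> c :: "real \<Rightarrow> real"
  assumes \<psi>: "\<psi> \<in> test_functions A" and c: "c \<in> test_functions B"
  shows "(\<lambda>p. \<psi> (fst p) * c (snd p)) \<in> test_functions (A \<times> B)"
proof -
  obtain K where K: "compact K" "K \<subseteq> A" "\<And>x. x \<notin> K \<Longrightarrow> \<psi> x = 0"
    using test_functions_support[OF \<psi>] by metis
  obtain K' where K': "compact K'" "K' \<subseteq> B" "\<And>x. x \<notin> K' \<Longrightarrow> c x = 0"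
    using test_functions_support[OF c] by metis
  show ?thesis
  proof (rule test_functionsI[where K = "K \<times> K'"])
    show "Ck n (\<lambda>p. \<psi> (fst p) * c (snd p))" for n
      by (intro Ck_mult Ck_fst Ck_snd test_functionsD(1)[OF \<psi>] test_functionsD(1)[OF c])
    show "\<psi> (fst p) * c (snd p) = 0" if "p \<notin> K \<times> K'" for p
      using that K(3)[of "fst p"] K'(3)[of "snd p"] by (cases p) auto
  qed (use K K' in \<open>auto intro!: compact_Times\<close>)
qed

lemma slice_test_function:
  assumes "\<phi> \<in> test_functions (A \<times> B)"
  shows "(\<lambda>x::real. \<phi> (x, t::real)) \<in> test_functions A"
proof -
  obtain K where K: "compact K" "K \<subseteq> A \<times> B" "\<And>x. x \<notin> K \<Longrightarrow> \<phi> x = 0"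
    using test_functions_support[OF assms] by metis
  show ?thesis
  \<comment> \<open>The projection of the support of \<phi> is one compact set that serves every
    time \<open>t\<close>.\<close>
  proof (rule test_functionsI[where K = "fst ` K"])
    show "compact (fst ` K)"
      by (intro compact_continuous_image K continuous_intros)
    show "\<phi> (x, t) = 0" if "x \<notin> fst ` K" for x
      using that K(3)[of "(x,t)"] by force
  qed (use K(2) in \<open>auto intro!: Ck_slice test_functionsD(1)[OF assms]\<close>)
qed

lemma partial_deriv_slice: "partial_deriv 1 (\<lambda>x. \<phi> (x, t)) x = partial_deriv e_x \<phi> (x, t)"
  by (simp add: partial_deriv_def)

lemma partial_deriv_tensor_x:
  assumes "\<psi> \<in> test_functions A"
  shows "partial_deriv e_x (\<lambda>p. \<psi> (fst p) * c (snd p)) = (\<lambda>p. partial_deriv 1 \<psi> (fst p) * c (snd p))"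
  using Ck_has_partial_deriv[OF test_functionsD(1)[OF assms], of 1]
  by (intro ext partial_derivI) (auto intro!: derivative_eq_intros)

lemma partial_deriv_tensor_t:
  assumes "c \<in> test_functions A"
  shows "partial_deriv e_t (\<lambda>p. \<psi> (fst p) * c (snd p)) = (\<lambda>p. \<psi> (fst p) * partial_deriv 1 c (snd p))"
  using Ck_has_partial_deriv[OF test_functionsD(1)[OF assms], of 1]
  by (intro ext partial_derivI) (auto intro!: derivative_eq_intros)

lemma foldr_partial_deriv_test_function:
  "\<phi> \<in> test_functions S \<Longrightarrow> set bs \<subseteq> Basis \<Longrightarrow> foldr partial_deriv bs \<phi> \<in> test_functions S"
  by (induction bs) (auto intro: partial_deriv_test_function)

text \<open>Stated for n-fold derivatives so that first and second space derivatives are later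
  handled by one argument.\<close>

lemma foldr_partial_deriv_tensor:
  assumes "\<psi> \<in> test_functions A"
  shows "foldr partial_deriv (replicate n e_x) (\<lambda>p. \<psi> (fst p) * c (snd p)) =
    (\<lambda>p. foldr partial_deriv (replicate n 1) \<psi> (fst p) * c (snd p))"
proof (induction n)
  case (Suc n)
  have "foldr partial_deriv (replicate n 1) \<psi> \<in> test_functions A"
    by (rule foldr_partial_deriv_test_function[OF assms]) auto
  with Suc show ?case by (simp only: replicate_Suc foldr_Cons o_apply partial_deriv_tensor_x)
qed auto

lemma foldr_partial_deriv_slice:
  "foldr partial_deriv (replicate n 1) (\<lambda>x. \<phi> (x, t)) x =
   foldr partial_deriv (replicate n e_x) \<phi> (x, t)"
proof (induction n arbitrary: x)
  case (Suc n)
  then have "foldr partial_deriv (replicate n 1) (\<lambda>x. \<phi> (x, t)) =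
      (\<lambda>x. foldr partial_deriv (replicate n e_x) \<phi> (x, t))" by blast
  then show ?case by (simp add: partial_deriv_slice)
qed auto

section \<open>A smooth step\<close>

lemma Ck_inverse:
  fixes f :: "real \<Rightarrow> real"
  assumes "\<And>x. f x \<noteq> 0"
  shows "Ck n f \<Longrightarrow> Ck n (\<lambda>x. 1 / f x)"
proof (induction n)
  case 0
  then show ?case using assms by (auto intro!: continuous_intros)
next
  case (Suc n)
  have f: "Ck n (\<lambda>x. 1 / f x)" by (rule Suc.IH[OF Ck_Suc_imp[OF Suc.prems]])
  show ?case
  proof (rule Ck_SucI_real[where D = "\<lambda>x. (- 1) * partial_deriv 1 f x * (1 / f x * (1 / f x))"])
    show "((\<lambda>x. 1 / f x) has_real_derivative (- 1) * partial_deriv 1 f x * (1 / f x * (1 / f x))) (at x)" for x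
      using has_deriv_partial_deriv_1[OF Suc.prems, of x] assms[of x]
      by (auto intro!: derivative_eq_intros)
    show "Ck n (\<lambda>x. (- 1) * partial_deriv 1 f x * (1 / f x * (1 / f x)))"
      by (rule Ck_mult[OF Ck_mult[OF Ck_const Ck_partial_deriv[OF Suc.prems]] Ck_mult[OF f f]]) auto
  qed
qed

text \<open>A flat function divided by the sum of itself and its mirror image; the denominator is
  positive because 2 x - 1 and 2 - 2 x are never both nonpositive. The step leaves 0 only after 1/2,
  which will keep the supports of rescaled steps away from time 0.\<close>

lemma smooth_step_exists:
  obtains S :: "real \<Rightarrow> real" where "\<And>n. Ck n S" "\<And>x. 0 \<le> S x" "\<And>x. S x \<le> 1"
    "\<And>x. x \<le> 1 / 2 \<Longrightarrow> S x = 0" "\<And>x. x \<ge> 1 \<Longrightarrow> S x = 1"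
proof -
  define f where "f = (\<lambda>x. flat_fun 0 (2 * x + (- 1)))"
  define g where "g = (\<lambda>x. f x + flat_fun 0 ((- 2) * x + 2))"
  have f: "Ck n f" for n unfolding f_def by (rule Ck_affine[OF Ck_flat_fun])
  have g: "Ck n g" for n unfolding g_def by (rule Ck_add[OF f Ck_affine[OF Ck_flat_fun]])
  have pos: "g x > 0" for x
    by (auto simp: g_def f_def flat_fun_def add_pos_pos add_nonneg_pos add_pos_nonneg)
  have le: "0 \<le> f x" "f x \<le> g x" for x by (auto simp: g_def f_def flat_fun_def)
  show ?thesis
  proof (rule that)
    show "Ck n (\<lambda>x. f x * (1 / g x))" for n
      using pos by (intro Ck_mult[OF f] Ck_inverse g) (metis less_irrefl)
    show "0 \<le> f x * (1 / g x)" "f x * (1 / g x) \<le> 1" for x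
      using pos[of x] le[of x] by (auto simp: divide_le_eq_1)
    show "f x * (1 / g x) = 0" if "x \<le> 1 / 2" for x
      using that by (auto simp: f_def flat_fun_def)
    show "f x * (1 / g x) = 1" if "x \<ge> 1" for x
    proof -
      have "g x = f x" using that by (auto simp: g_def flat_fun_def)
      then show ?thesis using pos[of x] by simp
    qed
  qed
qed

section \<open>One-dimensional tools\<close>

lemma integrable_mult_bounded:
  fixes f g :: "'a \<Rightarrow> real"
  assumes "integrable M f" "g \<in> borel_measurable M" "\<And>x. \<bar>g x\<bar> \<le> C"
  shows "integrable M (\<lambda>x. f x * g x)"
proof (rule Bochner_Integration.integrable_bound[where f = "\<lambda>x. C * f x"])
  show "AE x in M. norm (f x * g x) \<le> norm (C * f x)"
  proof (rule AE_I2)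
    fix x
    have "\<bar>f x\<bar> * \<bar>g x\<bar> \<le> \<bar>f x\<bar> * C" by (intro mult_left_mono assms) auto
    also have "\<dots> \<le> \<bar>f x\<bar> * \<bar>C\<bar>" by (intro mult_left_mono) auto
    finally show "norm (f x * g x) \<le> norm (C * f x)" by (simp add: abs_mult mult.commute)
  qed
qed (use assms in auto)

text \<open>A Dynkin argument: open intervals form an intersection-stable generator of the Borel
  sets. Passing to complements uses that the total integral vanishes, which follows by exhausting
  the line with the intervals (-n, n).\<close>

lemma integral_zero_on_intervals_imp_AE_zero:
  fixes G :: "real \<Rightarrow> real"
  assumes G: "integrable lborel G"
    and zero: "\<And>p q. (LINT t|lborel. G t * indicator {p<..<q} t) = 0"
  shows "AE t in lborel. G t = 0"
proof (rule sigma_finite_measure.density_zero[OF sigma_finite_lborel G])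
  have all: "(LINT t|lborel. G t) = 0"
  proof -
    have "(\<lambda>n. LINT t|lborel. G t * indicator {- real n<..<real n} t) \<longlonglongrightarrow> (LINT t|lborel. G t)"
    proof (rule integral_dominated_convergence[where w = "\<lambda>t. \<bar>G t\<bar>"])
      show "AE t in lborel. (\<lambda>n. G t * indicator {- real n<..<real n} t) \<longlonglongrightarrow> G t"
      proof (rule AE_I2)
        fix t :: real
        obtain m :: nat where m: "real m > \<bar>t\<bar>" using reals_Archimedean2 by blast
        have "eventually (\<lambda>n. G t * indicator {- real n<..<real n} t = G t) sequentially"
          by (rule eventually_sequentiallyI[of m]) (use m in \<open>auto simp: indicator_def\<close>)
        then show "(\<lambda>n. G t * indicator {- real n<..<real n} t) \<longlonglongrightarrow> G t"
          by (rule tendsto_eventually)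
      qed
    qed (use G in \<open>auto simp: indicator_def\<close>)
    then show ?thesis by (simp add: zero LIMSEQ_const_iff)
  qed
  have ind: "integrable lborel (\<lambda>t. indicator A t * G t)" if "A \<in> sets borel" for A
    using that integrable_mult_bounded[OF G, of "indicator A" 1]
    by (auto simp: mult.commute indicator_def)
  have borel_Ioo: "sets borel = sigma_sets UNIV (range (\<lambda>(a, b). {a<..<b::real}))"
    unfolding borel_eq_box box_real by (rule sets_measure_of) simp
  show "set_lebesgue_integral lborel A G = 0" if "A \<in> sets lborel" for A
  proof -
    have "Int_stable (range (\<lambda>(a, b). {a<..<b::real}))"
      by (auto simp: Int_stable_def Int_greaterThanLessThan)
    moreover have "range (\<lambda>(a, b). {a<..<b::real}) \<subseteq> Pow UNIV" by simp
    moreover have "A \<in> sigma_sets UNIV (range (\<lambda>(a, b). {a<..<b::real}))"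
      using that by (simp add: borel_Ioo)
    ultimately show ?thesis
    proof (induction rule: sigma_sets_induct_disjoint)
      case (basic A)
      then show ?case
        using zero by (auto simp: set_lebesgue_integral_def mult.commute)
    next
      case (compl A)
      then have A: "A \<in> sets borel"
        by (simp add: borel_Ioo)
      have "set_lebesgue_integral lborel (UNIV - A) G =
          (LINT t|lborel. G t - indicator A t * G t)"
        unfolding set_lebesgue_integral_def by (intro Bochner_Integration.integral_cong) (auto simp: indicator_def)
      also have "\<dots> = 0"
        using compl.IH ind[OF A] G all by (simp add: set_lebesgue_integral_def)
      finally show ?case .
    next
      case (union A)
      then have A: "A i \<in> sets borel" for i
        by (auto simp: borel_Ioo)
      then have U: "(\<Union>i. A i) \<in> sets borel" by auto
      have "set_lebesgue_integral lborel (\<Union>i. A i) G = (\<Sum>i. set_lebesgue_integral lborel (A i) G)"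
        using A union.hyps(1) ind[OF U]
        by (intro lebesgue_integral_countable_add)
          (auto simp: set_integrable_def disjoint_family_on_def)
      then show ?case using union.IH by simp
    qed (auto simp: set_lebesgue_integral_def)
  qed
qed

text \<open>Bumps converge boundedly to the indicator of a subinterval, so dominated convergence
  carries the hypothesis from test functions to intervals.\<close>

lemma fundamental_lemma:
  fixes G :: "real \<Rightarrow> real"
  assumes G: "integrable lborel G"
    and zero: "\<And>c. c \<in> test_functions {a<..<b} \<Longrightarrow> (LINT t|lborel. G t * c t) = 0"
    and supp: "\<And>t. t \<notin> {a<..<b} \<Longrightarrow> G t = 0"
  shows "AE t in lborel. G t = 0"
proof (rule integral_zero_on_intervals_imp_AE_zero[OF G])
  fix p q :: real
  \<comment> \<open>An arbitrary interval is intersected with (a, b); nothing is lost because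
    \<open>G\<close> vanishes outside.\<close>
  define p' q' where "p' = max a p" "q' = min b q"
  have bump_borel [measurable]: "bump N p' q' \<in> borel_measurable borel" for N
    using Ck_imp_continuous[OF Ck_bump[of 0]] by (intro borel_measurable_continuous_onI)
  have "(\<lambda>N. LINT t|lborel. G t * bump (Suc N) p' q' t) \<longlonglongrightarrow>
      (LINT t|lborel. G t * indicator {p'<..<q'} t)"
  proof (rule integral_dominated_convergence[where w = "\<lambda>t. \<bar>G t\<bar>"])
    show "AE t in lborel. (\<lambda>N. G t * bump (Suc N) p' q' t) \<longlonglongrightarrow> G t * indicator {p'<..<q'} t"
      by (intro AE_I2 tendsto_mult tendsto_const LIMSEQ_Suc bump_tendsto_indicator)
    show "AE t in lborel. norm (G t * bump (Suc N) p' q' t) \<le> \<bar>G t\<bar>" for N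
      using bump_bounds by (auto simp: abs_mult intro!: AE_I2 mult_left_le)
  qed (use G in auto)
  moreover have "(LINT t|lborel. G t * bump (Suc N) p' q' t) = 0" for N
  proof (rule zero)
    have "{p'<..<q'} \<subseteq> {a<..<b}" by (auto simp: p'_q'_def)
    then show "bump (Suc N) p' q' \<in> test_functions {a<..<b}"
      using bump_test_function[of "Suc N" p' q'] test_functions_mono by blast
  qed
  ultimately have "(LINT t|lborel. G t * indicator {p'<..<q'} t) = 0"
    by (simp add: LIMSEQ_const_iff)
  moreover have "G t * indicator {p'<..<q'} t = G t * indicator {p<..<q} t" for t
    using supp[of t] by (auto simp: p'_q'_def indicator_def)
  ultimately show "(LINT t|lborel. G t * indicator {p<..<q} t) = 0" by simp
qed

section \<open>Weak and classical derivatives in one variable\<close>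

lemma test_functions_measurable:
  "\<phi> \<in> test_functions S \<Longrightarrow> \<phi> \<in> borel_measurable borel"
  by (intro borel_measurable_continuous_onI test_functionsD(3))

lemma test_functions_bounded:
  assumes "\<phi> \<in> test_functions S"
  obtains C where "\<And>x. \<bar>\<phi> x\<bar> \<le> C" "C \<ge> 0"
proof -
  obtain K where K: "compact K" "K \<subseteq> S" "\<And>x. x \<notin> K \<Longrightarrow> \<phi> x = 0"
    using test_functions_support[OF assms] by metis
  have "bounded (\<phi> ` K)"
    using K(1) continuous_on_subset[OF test_functionsD(3)[OF assms]]
    by (intro compact_imp_bounded compact_continuous_image) auto
  then obtain C where C: "C > 0" "\<And>x. x \<in> K \<Longrightarrow> \<bar>\<phi> x\<bar> \<le> C"
    by (auto simp: bounded_pos)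
  have "\<bar>\<phi> x\<bar> \<le> C" for x using C K(3)[of x] by (cases "x \<in> K") auto
  with C(1) show ?thesis by (intro that[of C]) auto
qed

lemma partial_deriv_1I:
  "(f has_real_derivative D) (at x) \<Longrightarrow> partial_deriv 1 f x = D"
  using DERIV_shift[of f D 0 x] by (intro partial_derivI) (simp add: add.commute)

text \<open>Test with \<open>c(t) = S(n t) - S(n (t - s))\<close>, where \<open>S\<close> is a smooth step: \<open>c\<close> tends to the indicator of
  \<open>(0, s]\<close> and \<open>c'\<close> is the difference of two approximate Dirac masses, at \<open>0\<close> and \<open>s\<close>.\<close>

lemma weak_deriv_FTC:
  fixes G H :: "real \<Rightarrow> real"
  assumes G: "continuous_on {0..T} G" and H: "integrable lborel H"
    and weak: "\<And>c. c \<in> test_functions {0<..<T} \<Longrightarrow>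
      (LINT t|lborel. indicator {0<..<T} t * G t * partial_deriv 1 c t) = - (LINT t|lborel. H t * c t)"
    and s: "0 < s" "s < T"
  shows "G s - G 0 = (LINT t|lborel. H t * indicator {0<..s} t)"
proof -
  obtain S :: "real \<Rightarrow> real" where S: "\<And>n. Ck n S" "\<And>x. 0 \<le> S x" "\<And>x. S x \<le> 1"
    "\<And>x. x \<le> 1 / 2 \<Longrightarrow> S x = 0" "\<And>x. x \<ge> 1 \<Longrightarrow> S x = 1"
    using smooth_step_exists by blast
  define \<sigma> where "\<sigma> = partial_deriv 1 S"
  have S': "(S has_real_derivative \<sigma> x) (at x)" for x
    unfolding \<sigma>_def by (rule has_deriv_partial_deriv_1[OF S(1)])
  have cont_\<sigma>: "continuous_on UNIV \<sigma>"
    unfolding \<sigma>_def by (rule Ck_imp_continuous[OF Ck_partial_deriv[OF S(1)]]) simp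
  have \<sigma>_meas [measurable]: "\<sigma> \<in> borel_measurable borel"
    by (rule borel_measurable_continuous_onI[OF cont_\<sigma>])
  have S_meas [measurable]: "S \<in> borel_measurable borel"
    by (rule borel_measurable_continuous_onI[OF Ck_imp_continuous[OF S(1)]])
  have \<sigma>_0: "\<sigma> x = 0" if "x \<notin> {0..1}" for x
  proof (cases "x < 0")
    case True
    have "(S has_real_derivative 0) (at x)"
      by (rule has_field_derivative_transform_within_open[of "\<lambda>_. 0" _ _ "{..<0}"])
        (use True S(4) in auto)
    with S'[of x] show ?thesis by (rule DERIV_unique)
  next
    case False
    have "(S has_real_derivative 0) (at x)"
      by (rule has_field_derivative_transform_within_open[of "\<lambda>_. 1" _ _ "{1<..}"])
        (use False that S(5) in auto)
    with S'[of x] show ?thesis by (rule DERIV_unique)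
  qed
  have \<sigma>_int: "(LINT x|lborel. \<sigma> x * indicator {0..1} x) = 1"
    using integral_FTC_Icc_real[of 0 1 S \<sigma>] S' S(4)[of 0] S(5)[of 1] cont_\<sigma>
    by (auto simp: continuous_on_eq_continuous_at)
  obtain C where C: "\<And>x. \<bar>\<sigma> x\<bar> \<le> C" "C \<ge> 0"
  proof -
    have "bounded (\<sigma> ` {0..1})"
      by (intro compact_imp_bounded compact_continuous_image continuous_on_subset[OF cont_\<sigma>]) auto
    then obtain C where C: "C > 0" "\<And>x. x \<in> {0..1} \<Longrightarrow> \<bar>\<sigma> x\<bar> \<le> C"
      by (auto simp: bounded_pos)
    have "\<bar>\<sigma> x\<bar> \<le> C" for x using C \<sigma>_0[of x] by (cases "x \<in> {0..1}") auto
    with C(1) show ?thesis by (intro that[of C]) auto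
  qed
  \<comment> \<open>Cutting \<open>G\<close> off outside (0, T) gives a bounded function on the
    whole line, to which the affine substitution below applies.\<close>
  define G0 where "G0 = (\<lambda>t. indicator {0<..<T} t * G t)"
  have G0_meas [measurable]: "G0 \<in> borel_measurable borel"
    unfolding G0_def
    using borel_measurable_continuous_on_indicator[of "{0<..<T}" G] continuous_on_subset[OF G]
    by (simp add: greaterThanLessThan_subseteq_atLeastAtMost_iff)
  obtain M where M: "\<And>t. \<bar>G0 t\<bar> \<le> M" "M \<ge> 0"
  proof -
    have "bounded (G ` {0..T})"
      by (intro compact_imp_bounded compact_continuous_image G) auto
    then obtain C where C: "C > 0" "\<And>x. x \<in> {0..T} \<Longrightarrow> \<bar>G x\<bar> \<le> C"
      by (auto simp: bounded_pos)
    have "\<bar>G0 x\<bar> \<le> C" for x using C by (auto simp: G0_def indicator_def)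
    with C(1) show ?thesis by (intro that[of C]) auto
  qed
  define n where "n = (\<lambda>N. real (Suc N))"
  have n_pos: "n N > 0" for N by (simp add: n_def)
  have n_lim: "filterlim n at_top sequentially"
    unfolding n_def by (rule filterlim_compose[OF filterlim_real_sequentially filterlim_Suc])
  define c where "c = (\<lambda>N t. S (n N * t) - S (n N * (t - s)))"
  have c_deriv: "(c N has_real_derivative n N * \<sigma> (n N * t) - n N * \<sigma> (n N * (t - s))) (at t)" for N t
  proof -
    have "((\<lambda>t. S (n N * t)) has_real_derivative \<sigma> (n N * t) * n N) (at t)"
      by (rule DERIV_chain2[OF S']) (auto intro!: derivative_eq_intros)
    moreover have "((\<lambda>t. S (n N * (t - s))) has_real_derivative \<sigma> (n N * (t - s)) * n N) (at t)"
      by (rule DERIV_chain2[OF S']) (auto intro!: derivative_eq_intros)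
    ultimately show ?thesis
      unfolding c_def by (auto dest: DERIV_diff simp: mult.commute)
  qed
  have c_pd: "partial_deriv 1 (c N) = (\<lambda>t. n N * \<sigma> (n N * t) - n N * \<sigma> (n N * (t - s)))" for N
    using c_deriv by (intro ext partial_deriv_1I)
  \<comment> \<open>The two rescaled steps both vanish before 1 / (2 n) and both equal 1 from s + 1
    / n on; the lower bound on \<open>n N\<close> puts s + 1 / n before T.\<close>
  have c_test: "c N \<in> test_functions {0<..<T}" if N: "n N > 1 / (T - s)" for N
  proof (rule test_functionsI[where K = "{1 / (2 * n N)..s + 1 / n N}"])
    fix k
    have "c N = (\<lambda>t. S (n N * t + 0) + (- 1) * S (n N * t + (- n N * s)))"
      by (auto simp: c_def algebra_simps)
    then show "Ck k (c N)"
      by (simp only:) (intro Ck_add Ck_mult Ck_const Ck_affine S(1))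
  next
    have "1 / n N < T - s" using N s n_pos[of N] by (simp add: pos_divide_less_eq mult.commute)
    moreover have "0 < 1 / (2 * n N)" using n_pos[of N] by simp
    ultimately show "{1 / (2 * n N)..s + 1 / n N} \<subseteq> {0<..<T}"
      by (intro subsetI, unfold atLeastAtMost_iff greaterThanLessThan_iff) linarith
  next
    fix t assume t: "t \<notin> {1 / (2 * n N)..s + 1 / n N}"
    show "c N t = 0"
    proof (cases "t < 1 / (2 * n N)")
      case True
      then have "n N * t \<le> 1 / 2" using n_pos[of N] by (simp add: field_simps)
      moreover have "n N * (t - s) \<le> n N * t" using n_pos[of N] s by simp
      ultimately show ?thesis by (simp add: c_def S(4))
    next
      case False
      then have "t > s + 1 / n N" using t by simp
      then have "n N * (t - s) \<ge> 1" using n_pos[of N] by (simp add: field_simps)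
      moreover have "n N * (t - s) \<le> n N * t" using n_pos[of N] s by simp
      ultimately show ?thesis by (simp add: c_def S(5))
    qed
  qed simp
  have ev: "eventually (\<lambda>N. n N > 1 / (T - s)) sequentially"
    using n_lim unfolding filterlim_at_top_dense by blast
  have eq: "eventually (\<lambda>N. (LINT t|lborel. G0 t * (n N * \<sigma> (n N * t) - n N * \<sigma> (n N * (t - s)))) =
      - (LINT t|lborel. H t * c N t)) sequentially"
    using ev by eventually_elim (use weak[OF c_test] in \<open>simp add: c_pd G0_def\<close>)
  have int_G\<sigma>: "integrable lborel (\<lambda>t. G0 t * (n N * \<sigma> (n N * (t - r))))" for N r
  proof (rule integrable_mult_bounded[where C = "n N * C"])
    show "integrable lborel G0"
    proof (rule Bochner_Integration.integrable_bound[of _ "\<lambda>x. M * indicator {0<..<T} x"])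
      show "integrable lborel (\<lambda>x. M * indicator {0<..<T} x)"
        by (intro integrable_mult_right integrable_real_indicator) (use s in simp_all)
      show "AE x in lborel. norm (G0 x) \<le> norm (M * indicator {0<..<T} x)"
      proof (rule AE_I2)
        fix x
        show "norm (G0 x) \<le> norm (M * indicator {0<..<T} x)"
          using M(1)[of x] M(2) by (cases "x \<in> {0<..<T}") (auto simp: G0_def)
      qed
    qed simp
    show "\<bar>n N * \<sigma> (n N * (x - r))\<bar> \<le> n N * C" for x
      using n_pos[of N] C by (auto simp: abs_mult intro!: mult_left_mono)
  qed measurable
  \<comment> \<open>Substituting x = n (t - r) replaces the scaled kernel by the fixed
    \<open>\<sigma>\<close>, supported in [0, 1]. Only values of \<open>G\<close> to the right of r
    are sampled, so r = 0 is allowed.\<close>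
  have G\<sigma>_lim: "(\<lambda>N. LINT t|lborel. G0 t * (n N * \<sigma> (n N * (t - r)))) \<longlonglongrightarrow> G r"
    if r: "0 \<le> r" "r < T" for r
  proof -
    have "(LINT t|lborel. G0 t * (n N * \<sigma> (n N * (t - r)))) =
        (LINT x|lborel. G0 (r + x / n N) * \<sigma> x)" for N
    proof -
      have "(LINT t|lborel. G0 t * (n N * \<sigma> (n N * (t - r)))) =
          (LINT x|lborel. n N * (G0 (r + x / n N) * \<sigma> x)) / n N"
        using n_pos[of N]
        by (subst lborel_integral_real_affine[where c = "1 / n N" and t = r]) (auto simp: mult_ac)
      then show ?thesis using n_pos[of N] by simp
    qed
    moreover have "(\<lambda>N. LINT x|lborel. G0 (r + x / n N) * \<sigma> x) \<longlonglongrightarrow>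
        (LINT x|lborel. G r * (\<sigma> x * indicator {0..1} x))"
    proof (rule integral_dominated_convergence[where w = "\<lambda>x. M * C * indicator {0..1} x"])
      show "AE x in lborel. norm (G0 (r + x / n N) * \<sigma> x) \<le> M * C * indicator {0..1} x" for N
        using M C \<sigma>_0 by (auto intro!: AE_I2 mult_mono simp: abs_mult indicator_def)
      \<comment> \<open>x = 0 is left out because for r = 0 it would sample \<open>G0\<close> at 0,
        where the cut-off has replaced \<open>G 0\<close> by 0.\<close>
      have "AE x in lborel. x \<noteq> (0::real)" by (rule AE_lborel_singleton)
      then show "AE x in lborel. (\<lambda>N. G0 (r + x / n N) * \<sigma> x) \<longlonglongrightarrow> G r * (\<sigma> x * indicator {0..1} x)"
      proof eventually_elim
        case (elim x)
        show ?case
        proof (cases "x \<in> {0..1}")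
          case True
          then have x: "0 < x" "x \<le> 1" using elim by auto
          have xn: "(\<lambda>N. r + x / n N) \<longlonglongrightarrow> r + 0"
            by (intro tendsto_add tendsto_const tendsto_divide_0[OF tendsto_const]
                filterlim_mono[OF n_lim at_top_le_at_infinity order_refl])
          have "eventually (\<lambda>N. n N > 1 / (T - r)) sequentially"
            using n_lim unfolding filterlim_at_top_dense by blast
          then have in_T: "eventually (\<lambda>N. r + x / n N \<in> {0<..<T}) sequentially"
          proof eventually_elim
            case (elim N)
            then have "1 / n N < T - r" using r n_pos[of N] by (simp add: pos_divide_less_eq mult.commute)
            moreover have "x / n N \<le> 1 / n N" "0 < x / n N"
              using x n_pos[of N] by (auto simp: divide_right_mono)
            ultimately show ?case using r by auto
          qed
          have "(\<lambda>N. G (r + x / n N)) \<longlonglongrightarrow> G r"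
            using in_T r xn
            by (intro continuous_on_tendsto_compose[OF G]) (auto elim!: eventually_mono)
          then have "(\<lambda>N. G0 (r + x / n N)) \<longlonglongrightarrow> G r"
            by (rule Lim_transform_eventually)
              (use in_T in eventually_elim, auto simp: G0_def)
          then show ?thesis using True by (auto intro!: tendsto_intros)
        qed (use \<sigma>_0 in auto)
      qed
    qed (auto intro!: integrable_real_indicator)
    ultimately show ?thesis
      by (simp only: integral_mult_right_zero \<sigma>_int mult_1_right)
  qed
  have "(\<lambda>N. (LINT t|lborel. G0 t * (n N * \<sigma> (n N * (t - 0)))) -
      (LINT t|lborel. G0 t * (n N * \<sigma> (n N * (t - s))))) \<longlonglongrightarrow> G 0 - G s"
    using s by (intro tendsto_diff G\<sigma>_lim) auto
  moreover have "(LINT t|lborel. G0 t * (n N * \<sigma> (n N * (t - 0)))) -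
      (LINT t|lborel. G0 t * (n N * \<sigma> (n N * (t - s)))) =
      (LINT t|lborel. G0 t * (n N * \<sigma> (n N * t) - n N * \<sigma> (n N * (t - s))))" for N
    by (subst Bochner_Integration.integral_diff[OF int_G\<sigma> int_G\<sigma>, symmetric]) (simp add: algebra_simps)
  ultimately have "(\<lambda>N. LINT t|lborel. G0 t * (n N * \<sigma> (n N * t) - n N * \<sigma> (n N * (t - s))))
      \<longlonglongrightarrow> G 0 - G s" by simp
  from Lim_transform_eventually[OF this eq]
  have "(\<lambda>N. - (LINT t|lborel. H t * c N t)) \<longlonglongrightarrow> G 0 - G s" .
  moreover have "(\<lambda>N. LINT t|lborel. H t * c N t) \<longlonglongrightarrow> (LINT t|lborel. H t * indicator {0<..s} t)"
  proof (rule integral_dominated_convergence[where w = "\<lambda>t. \<bar>H t\<bar>"])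
    have S_lim: "(\<lambda>N. S (n N * d)) \<longlonglongrightarrow> (if d > 0 then 1 else 0)" for d
    proof (cases "d > 0")
      case True
      have "eventually (\<lambda>N. n N > 1 / d) sequentially"
        using n_lim unfolding filterlim_at_top_dense by blast
      then have "eventually (\<lambda>N. S (n N * d) = 1) sequentially"
        by eventually_elim (use True in \<open>auto intro!: S(5) simp: field_simps\<close>)
      then show ?thesis using True by (simp add: tendsto_eventually)
    next
      case False
      then have "n N * d \<le> 1 / 2" for N
        using n_pos[of N] mult_nonneg_nonpos[of "n N" d] by simp
      then show ?thesis using False by (simp add: S(4))
    qed
    show "AE t in lborel. (\<lambda>N. H t * c N t) \<longlonglongrightarrow> H t * indicator {0<..s} t"
    proof (rule AE_I2)
      fix t
      have "(\<lambda>N. H t * c N t) \<longlonglongrightarrow> H t * ((if t > 0 then 1 else 0) - (if t - s > 0 then 1 else 0))"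
        unfolding c_def by (intro tendsto_intros S_lim)
      then show "(\<lambda>N. H t * c N t) \<longlonglongrightarrow> H t * indicator {0<..s} t"
        using s by (auto simp: indicator_def split: if_splits)
    qed
    show "AE t in lborel. norm (H t * c N t) \<le> \<bar>H t\<bar>" for N
    proof (rule AE_I2)
      fix t
      have "\<bar>c N t\<bar> \<le> 1"
        using S(2,3)[of "n N * t"] S(2,3)[of "n N * (t - s)"] by (auto simp: c_def)
      then show "norm (H t * c N t) \<le> \<bar>H t\<bar>" by (simp add: abs_mult mult_left_le)
    qed
  qed (use H in \<open>auto simp: c_def\<close>)
  ultimately have "- (LINT t|lborel. H t * indicator {0<..s} t) = G 0 - G s"
    by (intro LIMSEQ_unique[OF tendsto_minus])
  then show ?thesis by simp
qed

section \<open>Products of an integrable function with its primitive\<close>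

lemma integrable_indicator_Ioo [simp]:
  "integrable lborel (indicator {a<..<b} :: real \<Rightarrow> real)"
proof (rule integrable_real_indicator)
  have "bounded {a<..<b}" by (rule bounded_subset[of "{a..b}"]) auto
  then show "emeasure lborel {a<..<b} < \<infinity>" by (rule emeasure_bounded_finite)
qed simp

text \<open>Provides the integrability behind the exchanges of integrals over triangles;
  \<open>h\<close> is then the indicator of a set such as t < s.\<close>

lemma integrable_pair_mult:
  fixes f g :: "real \<Rightarrow> real"
  assumes f: "integrable lborel f" and g: "integrable lborel g"
    and [measurable]: "h \<in> borel_measurable (lborel \<Otimes>\<^sub>M lborel)" and h: "\<And>p. \<bar>h p\<bar> \<le> C"
  shows "integrable (lborel \<Otimes>\<^sub>M lborel) (\<lambda>(x, y). f x * g y * h (x, y))"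
proof -
  have [measurable]: "f \<in> borel_measurable borel" "g \<in> borel_measurable borel" using f g by auto
  have "integrable (lborel \<Otimes>\<^sub>M lborel) (\<lambda>(x, y). f x * g y)"
    by (rule lborel_pair.Fubini_integrable)
      (use f g in \<open>auto simp: abs_mult intro!: integrable_mult_left integrable_mult_right\<close>)
  from integrable_mult_bounded[OF this, of h C] h show ?thesis
    by (simp add: case_prod_beta')
qed

text \<open>This is the integral of G G' for G' = g merely integrable. The square of the integral of
  g is a double integral over the plane; the diagonal is a null set, and the two half-planes beside
  it contribute equally by Fubini.\<close>

lemma integral_mult_primitive:
  fixes g :: "real \<Rightarrow> real"
  assumes g: "integrable lborel g"
  shows "(LINT t|lborel. g t * (LINT s|lborel. indicator {..<t} s * g s)) = (LINT t|lborel. g t)\<^sup>2 / 2"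
proof -
  have [measurable]: "g \<in> borel_measurable borel" using g by auto
  have ind: "integrable lborel (\<lambda>s. indicator A s * g s)" if "A \<in> sets borel" for A
    using that integrable_mult_bounded[OF g, of "indicator A" 1]
    by (auto simp: mult.commute indicator_def)
  have gh: "integrable lborel (\<lambda>t. g t * (LINT s|lborel. h t s * g s))"
    if "(\<lambda>(t, s). h t s) \<in> borel_measurable (lborel \<Otimes>\<^sub>M lborel)" "\<And>t s. \<bar>h t s\<bar> \<le> 1" for h
    using lborel_pair.integrable_fst[OF integrable_pair_mult[OF g g that(1), of 1]] that(2)
    by (simp add: case_prod_beta' mult_ac)
  have swap: "(LINT t|lborel. g t * (LINT s|lborel. indicator {t<..} s * g s)) =
      (LINT t|lborel. g t * (LINT s|lborel. indicator {..<t} s * g s))"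
  proof -
    let ?f = "\<lambda>t s. g t * g s * indicator {(t, s). t < s} (t, s)"
    have int: "integrable (lborel \<Otimes>\<^sub>M lborel) (\<lambda>(t, s). ?f t s)"
      by (intro integrable_pair_mult[OF g g, where C = 1]) (auto simp: indicator_def)
    have "(LINT t|lborel. g t * (LINT s|lborel. indicator {t<..} s * g s)) =
        (LINT t|lborel. LINT s|lborel. ?f t s)"
      by (intro Bochner_Integration.integral_cong refl, subst integral_mult_right_zero[symmetric],
          intro Bochner_Integration.integral_cong refl) (auto simp: indicator_def)
    also have "\<dots> = (LINT s|lborel. LINT t|lborel. ?f t s)"
      by (rule lborel_pair.Fubini_integral[OF int, symmetric])
    also have "\<dots> = (LINT t|lborel. g t * (LINT s|lborel. indicator {..<t} s * g s))"
      by (intro Bochner_Integration.integral_cong refl, subst integral_mult_right_zero[symmetric],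
          intro Bochner_Integration.integral_cong refl) (auto simp: indicator_def)
    finally show ?thesis .
  qed
  have ind_eq: "(\<lambda>(t, s). indicator {..<t} s :: real) = indicator {(t, s). s < t}"
    "(\<lambda>(t, s). indicator {t<..} s :: real) = indicator {(t, s). t < (s::real)}"
    by (auto simp: indicator_def)
  have int_less: "integrable lborel (\<lambda>t. g t * (LINT s|lborel. indicator {..<t} s * g s))"
    by (rule gh) (auto simp: indicator_def[of _ "_ :: real"] ind_eq)
  have int_greater: "integrable lborel (\<lambda>t. g t * (LINT s|lborel. indicator {t<..} s * g s))"
    by (rule gh) (auto simp: indicator_def[of _ "_ :: real"] ind_eq)
  have "(LINT t|lborel. g t)\<^sup>2 = (LINT t|lborel. g t * (LINT s|lborel. g s))"
    by (simp add: power2_eq_square)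
  also have "\<dots> = (LINT t|lborel. g t * (LINT s|lborel. indicator {..<t} s * g s) +
      g t * (LINT s|lborel. indicator {t<..} s * g s))"
  proof (intro Bochner_Integration.integral_cong refl)
    fix t
    have "(LINT s|lborel. g s) = (LINT s|lborel. indicator {..<t} s * g s + indicator {t<..} s * g s)"
    proof (rule integral_cong_AE)
      show "AE s in lborel. g s = indicator {..<t} s * g s + indicator {t<..} s * g s"
        using AE_lborel_singleton[of t] by eventually_elim (auto simp: indicator_def)
    qed auto
    also have "\<dots> = (LINT s|lborel. indicator {..<t} s * g s) + (LINT s|lborel. indicator {t<..} s * g s)"
      by (intro Bochner_Integration.integral_add ind) auto
    finally show "g t * (LINT s|lborel. g s) = g t * (LINT s|lborel. indicator {..<t} s * g s) +
        g t * (LINT s|lborel. indicator {t<..} s * g s)" by (simp add: distrib_left)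
  qed
  also have "\<dots> = 2 * (LINT t|lborel. g t * (LINT s|lborel. indicator {..<t} s * g s))"
    by (subst Bochner_Integration.integral_add[OF int_less int_greater]) (simp add: swap)
  finally show ?thesis by simp
qed

lemma primitive_measurable [measurable]:
  fixes g :: "real \<Rightarrow> real"
  assumes [measurable]: "g \<in> borel_measurable borel"
  shows "(\<lambda>t. LINT s|lborel. indicator {..<t} s * g s) \<in> borel_measurable borel"
proof -
  have "(\<lambda>t. LINT s|lborel. indicator {(t, s). s < t} (t, s) * g s) \<in> borel_measurable borel"
    by measurable
  then show ?thesis by (simp add: indicator_def)
qed

lemma abs_integral_restrict_le:
  fixes g :: "real \<Rightarrow> real"
  assumes g: "integrable lborel g" and A: "A \<in> sets borel"
  shows "\<bar>LINT s|lborel. indicator A s * g s\<bar> \<le> (LINT s|lborel. \<bar>g s\<bar>)"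
proof -
  have "integrable lborel (\<lambda>s. indicator A s * g s)"
    using A integrable_mult_bounded[OF g, of "indicator A" 1]
    by (auto simp: mult.commute indicator_def)
  then have "(LINT s|lborel. \<bar>indicator A s * g s\<bar>) \<le> (LINT s|lborel. \<bar>g s\<bar>)"
    using g by (intro integral_mono) (auto simp: indicator_def)
  with integral_abs_bound[of lborel "\<lambda>s. indicator A s * g s"] show ?thesis by linarith
qed

text \<open>Writing \<open>exp (- t) = exp (- T) + \<integral> exp (- r)\<close> over \<open>r\<close> from \<open>t\<close> to \<open>T\<close> reduces the weighted
  inequality to the unweighted identity on each interval \<open>(- \<infinity>, r)\<close>.\<close>

lemma exp_weighted_primitive_ge:
  fixes g :: "real \<Rightarrow> real"
  assumes g: "integrable lborel g" and supp: "\<And>t. t \<notin> {0<..<T} \<Longrightarrow> g t = 0"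
  defines "G \<equiv> \<lambda>t. LINT s|lborel. indicator {..<t} s * g s"
  shows "(LINT t|lborel. indicator {0<..<T} t * (exp (- t) * (G t)\<^sup>2)) / 2 \<le> (LINT t|lborel. exp (- t) * g t * G t)"
proof -
  have [measurable]: "g \<in> borel_measurable borel" using g by auto
  have G_meas [measurable]: "G \<in> borel_measurable borel" unfolding G_def by measurable
  have ind: "integrable lborel (\<lambda>s. indicator A s * g s)" if "A \<in> sets borel" for A
    using that integrable_mult_bounded[OF g, of "indicator A" 1]
    by (auto simp: mult.commute indicator_def)
  have G_le: "\<bar>G t\<bar> \<le> (LINT s|lborel. \<bar>g s\<bar>)" for t
    unfolding G_def by (rule abs_integral_restrict_le[OF g]) simp
  have gG: "integrable lborel (\<lambda>t. g t * G t)"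
    by (rule integrable_mult_bounded[OF g _ G_le]) simp
  \<comment> \<open>The unweighted identity is applied to g restricted to times before r; below r
    the restriction leaves the primitive unchanged.\<close>
  have P: "(LINT t|lborel. indicator {..<r} t * (g t * G t)) = (G r)\<^sup>2 / 2" for r
  proof -
    have "(LINT t|lborel. indicator {..<r} t * (g t * G t)) =
        (LINT t|lborel. (indicator {..<r} t * g t) *
          (LINT s|lborel. indicator {..<t} s * (indicator {..<r} s * g s)))"
    proof (intro Bochner_Integration.integral_cong refl)
      fix t
      have "t < r \<Longrightarrow> G t = (LINT s|lborel. indicator {..<t} s * (indicator {..<r} s * g s))"
        unfolding G_def by (intro Bochner_Integration.integral_cong refl) (auto simp: indicator_def)
      then show "indicator {..<r} t * (g t * G t) = (indicator {..<r} t * g t) *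
          (LINT s|lborel. indicator {..<t} s * (indicator {..<r} s * g s))"
        by (cases "t < r") auto
    qed
    also have "\<dots> = (G r)\<^sup>2 / 2"
      unfolding G_def by (rule integral_mult_primitive[OF ind]) simp
    finally show ?thesis .
  qed
  have G_0: "G r = 0" if "r \<le> 0" for r
  proof -
    have "G r = (LINT s::real|lborel. 0)"
      unfolding G_def by (intro Bochner_Integration.integral_cong refl)
        (use that supp in \<open>auto simp: indicator_def\<close>)
    then show ?thesis by simp
  qed
  define w where "w = (\<lambda>r. indicator {0<..<T} r * exp (- r))"
  have [measurable]: "w \<in> borel_measurable borel" unfolding w_def by measurable
  have w: "integrable lborel w"
    by (rule Bochner_Integration.integrable_bound[of _ "indicator {0<..<T} :: real \<Rightarrow> real"])
      (auto simp: w_def indicator_def)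
  have exp_eq: "exp (- t) = exp (- T) + (LINT r|lborel. w r * indicator {t<..} r)" if t: "t \<in> {0<..<T}" for t
  proof -
    have "(LINT r|lborel. w r * indicator {t<..} r) = (LINT r|lborel. exp (- r) * indicator {t..T} r)"
    proof (rule integral_cong_AE)
      show "AE r in lborel. w r * indicator {t<..} r = exp (- r) * indicator {t..T} r"
        using AE_lborel_singleton[of t] AE_lborel_singleton[of T]
        by eventually_elim (use t in \<open>auto simp: w_def indicator_def\<close>)
    qed auto
    also have "\<dots> = - exp (- T) - - exp (- t)"
      using t by (intro integral_FTC_Icc_real) (auto intro!: derivative_eq_intros continuous_intros)
    finally show ?thesis by simp
  qed
  let ?f = "\<lambda>t r. (g t * G t) * w r * indicator {(t, r). t < r} (t, r)"
  have int: "integrable (lborel \<Otimes>\<^sub>M lborel) (\<lambda>(t, r). ?f t r)"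
    by (intro integrable_pair_mult[OF gG w, where C = 1]) (auto simp: indicator_def)
  have "(LINT t|lborel. exp (- t) * g t * G t) =
      (LINT t|lborel. exp (- T) * (g t * G t) + (LINT r|lborel. ?f t r))"
  proof (intro Bochner_Integration.integral_cong refl)
    fix t
    have "(LINT r|lborel. ?f t r) = (LINT r|lborel. (g t * G t) * (w r * indicator {t<..} r))"
      by (intro Bochner_Integration.integral_cong refl) (auto simp: indicator_def)
    also have "\<dots> = (g t * G t) * (LINT r|lborel. w r * indicator {t<..} r)"
      by (rule integral_mult_right_zero)
    finally show "exp (- t) * g t * G t = exp (- T) * (g t * G t) + (LINT r|lborel. ?f t r)"
      using exp_eq[of t] supp[of t] by (cases "t \<in> {0<..<T}") (auto simp: algebra_simps)
  qed
  also have "\<dots> = exp (- T) * (LINT t|lborel. g t * G t) + (LINT t|lborel. LINT r|lborel. ?f t r)"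
    by (subst Bochner_Integration.integral_add)
      (use gG lborel_pair.integrable_fst[OF int] in \<open>auto\<close>)
  also have "(LINT t|lborel. LINT r|lborel. ?f t r) = (LINT r|lborel. LINT t|lborel. ?f t r)"
    by (rule lborel_pair.Fubini_integral[OF int, symmetric])
  also have "\<dots> = (LINT r|lborel. w r * ((G r)\<^sup>2 / 2))"
  proof (intro Bochner_Integration.integral_cong refl)
    fix r
    have "(LINT t|lborel. ?f t r) = (LINT t|lborel. w r * (indicator {..<r} t * (g t * G t)))"
      by (intro Bochner_Integration.integral_cong refl) (auto simp: indicator_def)
    also have "\<dots> = w r * ((G r)\<^sup>2 / 2)"
      unfolding integral_mult_right_zero P ..
    finally show "(LINT t|lborel. ?f t r) = w r * ((G r)\<^sup>2 / 2)" .
  qed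
  also have "\<dots> = (LINT t|lborel. indicator {0<..<T} t * (exp (- t) * (G t)\<^sup>2)) / 2"
    unfolding w_def by (simp add: mult.assoc flip: integral_divide_zero)
  finally have "(LINT t|lborel. exp (- t) * g t * G t) = exp (- T) * (LINT t|lborel. g t * G t) +
      (LINT t|lborel. indicator {0<..<T} t * (exp (- t) * (G t)\<^sup>2)) / 2" .
  \<comment> \<open>So the remaining boundary term is exp (- T) times half a square; being
    nonnegative, it is dropped, and the equality becomes the stated inequality.\<close>
  moreover have "(LINT t|lborel. g t * G t) = (LINT t|lborel. g t)\<^sup>2 / 2"
    unfolding G_def by (rule integral_mult_primitive[OF g])
  ultimately show ?thesis by simp
qed

section \<open>Borel representatives\<close>

text \<open>Iterated integrals are taken with respect to \<open>lborel\<close>, whose planar version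
  is a product measure, whereas members of \<open>L2\<close> are only Lebesgue measurable. Extension
  by zero also turns every integral over \<open>S\<close> into one over the whole space.\<close>

definition borel_rep :: "'a::euclidean_space set \<Rightarrow> ('a \<Rightarrow> real) \<Rightarrow> ('a \<Rightarrow> real) \<Rightarrow> bool" where
  "borel_rep S f g \<longleftrightarrow> f \<in> borel_measurable (lebesgue_on S) \<and> g \<in> borel_measurable borel \<and>
     (\<forall>x. x \<notin> S \<longrightarrow> g x = 0) \<and> (AE x in lebesgue_on S. f x = g x)"

lemma borel_measurable_lebesgue_onI:
  "g \<in> borel_measurable borel \<Longrightarrow> g \<in> borel_measurable (lebesgue_on S)"
  by (intro measurable_restrict_space1 measurable_completion) simp

lemma AE_lebesgue_on_iff:
  assumes "S \<in> sets borel"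
  shows "(AE x in lebesgue_on S. P x) \<longleftrightarrow> (AE x in lborel. x \<in> S \<longrightarrow> P x)"
  using assms by (subst AE_restrict_space_iff) (auto simp: AE_completion_iff)

lemma borel_rep_exists:
  assumes S: "S \<in> sets borel" and f: "f \<in> borel_measurable (lebesgue_on S)"
  obtains g where "borel_rep S f g"
proof -
  have "(\<lambda>x. indicator S x *\<^sub>R f x) \<in> borel_measurable lebesgue"
    using f S by (subst (asm) borel_measurable_restrict_space_iff) auto
  then obtain g where g: "g \<in> borel_measurable lborel" "AE x in lborel. indicator S x *\<^sub>R f x = g x"
    using completion_ex_borel_measurable_real[of _ lborel] by blast
  \<comment> \<open>The Borel function \<open>g\<close> agrees with the zero extension only almost
    everywhere; the second indicator restores exact vanishing outside \<open>S\<close>.\<close>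
  have "borel_rep S f (\<lambda>x. indicator S x * g x)"
    using f g S by (auto simp: borel_rep_def AE_lebesgue_on_iff)
  then show ?thesis by (rule that)
qed

lemma borel_rep_refl:
  "g \<in> borel_measurable borel \<Longrightarrow> (\<And>x. x \<notin> S \<Longrightarrow> g x = 0) \<Longrightarrow> borel_rep S g g"
  by (auto simp: borel_rep_def intro: borel_measurable_lebesgue_onI)

lemma borel_repD:
  assumes "borel_rep S f g"
  shows "f \<in> borel_measurable (lebesgue_on S)" "g \<in> borel_measurable borel"
    "\<And>x. x \<notin> S \<Longrightarrow> g x = 0" "AE x in lebesgue_on S. f x = g x"
  using assms by (auto simp: borel_rep_def)

lemma borel_rep_mult_borel:
  "borel_rep S f g \<Longrightarrow> h \<in> borel_measurable borel \<Longrightarrow> borel_rep S (\<lambda>x. f x * h x) (\<lambda>x. g x * h x)"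
  by (auto simp: borel_rep_def intro!: borel_measurable_times dest: borel_measurable_lebesgue_onI
      elim!: eventually_mono)

lemma borel_rep_mult:
  "borel_rep S f g \<Longrightarrow> borel_rep S f' g' \<Longrightarrow> borel_rep S (\<lambda>x. f x * f' x) (\<lambda>x. g x * g' x)"
  unfolding borel_rep_def
  by (auto intro!: borel_measurable_times elim!: eventually_elim2)

lemma borel_rep_add:
  "borel_rep S f g \<Longrightarrow> borel_rep S f' g' \<Longrightarrow> borel_rep S (\<lambda>x. f x + f' x) (\<lambda>x. g x + g' x)"
  unfolding borel_rep_def
  by (auto intro!: borel_measurable_add elim!: eventually_elim2)

lemma borel_rep_uminus:
  "borel_rep S f g \<Longrightarrow> borel_rep S (\<lambda>x. - f x) (\<lambda>x. - g x)"
  unfolding borel_rep_def by (auto intro!: borel_measurable_uminus elim!: eventually_mono)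

lemma borel_rep_integral:
  assumes S: "S \<in> sets borel" and rep: "borel_rep S f g"
  shows "(LINT x|lebesgue_on S. f x) = (LINT x|lborel. g x)"
    and "integrable (lebesgue_on S) f \<longleftrightarrow> integrable lborel g"
proof -
  note r = borel_repD[OF rep]
  have ind: "(\<lambda>x. indicator S x *\<^sub>R g x) = g" using r(3) by (intro ext) (metis indicator_simps(1,2) scaleR_one scaleR_zero_left)
  have "(LINT x|lebesgue_on S. f x) = (LINT x|lebesgue_on S. g x)"
    by (intro integral_cong_AE borel_measurable_lebesgue_onI r)
  also have "\<dots> = (LINT x|lebesgue. g x)"
    using S ind by (subst integral_restrict_space) auto
  also have "\<dots> = (LINT x|lborel. g x)" using r by (intro integral_completion) simp
  finally show "(LINT x|lebesgue_on S. f x) = (LINT x|lborel. g x)" .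
  have "integrable (lebesgue_on S) f \<longleftrightarrow> integrable (lebesgue_on S) g"
    by (intro integrable_cong_AE borel_measurable_lebesgue_onI r)
  also have "\<dots> \<longleftrightarrow> integrable lebesgue g"
    using S ind by (subst integrable_restrict_space) auto
  also have "\<dots> \<longleftrightarrow> integrable lborel g" using r by (intro integrable_completion) simp
  finally show "integrable (lebesgue_on S) f \<longleftrightarrow> integrable lborel g" .
qed

definition borel_L2 :: "'a::euclidean_space set \<Rightarrow> ('a \<Rightarrow> real) \<Rightarrow> bool" where
  "borel_L2 S g \<longleftrightarrow> g \<in> borel_measurable borel \<and> (\<forall>x. x \<notin> S \<longrightarrow> g x = 0) \<and>
     integrable lborel (\<lambda>x. (g x)\<^sup>2)"

lemma L2_borel_rep:
  assumes "S \<in> sets borel" "f \<in> L2 S" "borel_rep S f g"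
  shows "borel_L2 S g"
  using assms borel_rep_integral(2)[OF assms(1) borel_rep_mult[OF assms(3,3)]] borel_repD[OF assms(3)]
  by (auto simp: borel_L2_def L2_def power2_eq_square)

lemma borel_L2_imp_L2:
  assumes "S \<in> sets borel" "borel_L2 S g"
  shows "g \<in> L2 S"
proof -
  have r: "borel_rep S g g" using assms(2) by (intro borel_rep_refl) (auto simp: borel_L2_def)
  show ?thesis
    using borel_rep_integral(2)[OF assms(1) borel_rep_mult[OF r r]] borel_repD(1)[OF r] assms(2)
    by (auto simp: borel_L2_def L2_def power2_eq_square)
qed

lemma abs_mult_le_sum_squares: "\<bar>a * b\<bar> \<le> a\<^sup>2 + b\<^sup>2" for a b :: real
proof -
  have "0 \<le> (\<bar>a\<bar> - \<bar>b\<bar>)\<^sup>2" by simp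
  then have "2 * \<bar>a * b\<bar> \<le> a\<^sup>2 + b\<^sup>2" by (simp add: power2_diff abs_mult)
  then show ?thesis by simp
qed

lemma borel_L2_mult_integrable:
  assumes "borel_L2 S f" "borel_L2 S g"
  shows "integrable lborel (\<lambda>x. f x * g x)"
proof (rule Bochner_Integration.integrable_bound[where f = "\<lambda>x. (f x)\<^sup>2 + (g x)\<^sup>2"])
  show "AE x in lborel. norm (f x * g x) \<le> norm ((f x)\<^sup>2 + (g x)\<^sup>2)"
    using abs_mult_le_sum_squares by (intro AE_I2) simp
qed (use assms in \<open>auto simp: borel_L2_def\<close>)

lemma borel_L2_integrable:
  assumes "borel_L2 S f" "bounded S" "S \<in> sets borel"
  shows "integrable lborel f"
proof -
  have "integrable lborel (indicator S :: 'a \<Rightarrow> real)"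
    using assms(3) emeasure_bounded_finite[OF assms(2)] by (intro integrable_real_indicator) auto
  moreover have "(\<lambda>x. (indicator S x)\<^sup>2) = (indicator S :: 'a \<Rightarrow> real)"
    by (auto simp: indicator_def)
  ultimately have "borel_L2 S (indicator S)"
    using assms(3) by (auto simp: borel_L2_def)
  then have "integrable lborel (\<lambda>x. f x * indicator S x)"
    by (rule borel_L2_mult_integrable[OF assms(1)])
  moreover have "(\<lambda>x. f x * indicator S x) = f"
    using assms(1) by (auto simp: borel_L2_def indicator_def fun_eq_iff)
  ultimately show ?thesis by simp
qed

lemma borel_L2_mult_bounded:
  assumes f: "borel_L2 S f" and h: "h \<in> borel_measurable borel" "\<And>x. x \<in> S \<Longrightarrow> \<bar>h x\<bar> \<le> C"
  shows "borel_L2 S (\<lambda>x. f x * h x)"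
proof -
  have "integrable lborel (\<lambda>x. (f x * h x)\<^sup>2)"
  proof (rule Bochner_Integration.integrable_bound[where f = "\<lambda>x. C\<^sup>2 * (f x)\<^sup>2"])
    show "AE x in lborel. norm ((f x * h x)\<^sup>2) \<le> norm (C\<^sup>2 * (f x)\<^sup>2)"
    proof (rule AE_I2)
      fix x
      show "norm ((f x * h x)\<^sup>2) \<le> norm (C\<^sup>2 * (f x)\<^sup>2)"
      proof (cases "x \<in> S")
        case True
        then have "(h x)\<^sup>2 \<le> C\<^sup>2" using h(2)[OF True] by (simp add: abs_le_square_iff[symmetric])
        then show ?thesis by (simp add: power_mult_distrib mult.commute[of _ "(h x)\<^sup>2"] mult_right_mono)
      next
        case False
        then show ?thesis using f by (auto simp: borel_L2_def)
      qed
    qed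
  qed (use f h in \<open>auto simp: borel_L2_def\<close>)
  then show ?thesis using f h by (auto simp: borel_L2_def)
qed

definition borel_weak_deriv ::
    "'a::euclidean_space set \<Rightarrow> 'a list \<Rightarrow> ('a \<Rightarrow> real) \<Rightarrow> ('a \<Rightarrow> real) \<Rightarrow> bool" where
  "borel_weak_deriv S bs f g \<longleftrightarrow> borel_L2 S f \<and> borel_L2 S g \<and>
     (\<forall>\<phi>\<in>test_functions S. (LINT x|lborel. f x * foldr partial_deriv bs \<phi> x) =
        (- 1) ^ length bs * (LINT x|lborel. g x * \<phi> x))"

text \<open>Everything paired with \<open>f\<close> and \<open>g\<close> is a test function or a
  derivative of one, hence Borel, and integrals ignore the null set on which a representative
  differs.\<close>

lemma has_weak_deriv_imp_borel:
  assumes S: "S \<in> sets borel" and bs: "set bs \<subseteq> Basis"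
    and f: "borel_rep S f f'" and g: "borel_rep S g g'" and w: "has_weak_deriv S bs f g"
  shows "borel_weak_deriv S bs f' g'"
proof -
  have eq: "(LINT x|lebesgue_on S. f x * h x) = (LINT x|lborel. f' x * h x)"
    if "borel_rep S f f'" "h \<in> borel_measurable borel" for f f' h
    by (rule borel_rep_integral(1)[OF S borel_rep_mult_borel[OF that]])
  have D: "foldr partial_deriv bs \<phi> \<in> borel_measurable borel" "\<phi> \<in> borel_measurable borel"
    if "\<phi> \<in> test_functions S" for \<phi>
    using that foldr_partial_deriv_test_function[OF that bs] by (auto intro: test_functions_measurable)
  show ?thesis
    using L2_borel_rep[OF S _ f] L2_borel_rep[OF S _ g] eq[OF f] eq[OF g] D w
    by (auto simp: borel_weak_deriv_def has_weak_deriv_def)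
qed

lemma has_weak_derivI_borel:
  assumes S: "S \<in> sets borel" and bs: "set bs \<subseteq> Basis" and w: "borel_weak_deriv S bs f g"
  shows "has_weak_deriv S bs f g"
proof -
  have f: "borel_rep S f f" and g: "borel_rep S g g"
    using w by (auto simp: borel_weak_deriv_def borel_L2_def intro!: borel_rep_refl)
  have D: "foldr partial_deriv bs \<phi> \<in> borel_measurable borel" "\<phi> \<in> borel_measurable borel"
    if "\<phi> \<in> test_functions S" for \<phi>
    using that foldr_partial_deriv_test_function[OF that bs] by (auto intro: test_functions_measurable)
  show ?thesis
    using w borel_L2_imp_L2[OF S] D borel_rep_integral(1)[OF S borel_rep_mult_borel[OF f]]
      borel_rep_integral(1)[OF S borel_rep_mult_borel[OF g]]
    by (auto simp: borel_weak_deriv_def has_weak_deriv_def)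
qed

lemma L2_cong:
  assumes "S \<in> sets borel" "\<And>x. x \<in> S \<Longrightarrow> f x = g x"
  shows "f \<in> L2 S \<longleftrightarrow> g \<in> L2 S"
proof -
  have "f \<in> borel_measurable (lebesgue_on S) \<longleftrightarrow> g \<in> borel_measurable (lebesgue_on S)"
    using assms(2) by (intro measurable_cong) auto
  moreover have "integrable (lebesgue_on S) (\<lambda>x. (f x)\<^sup>2) \<longleftrightarrow> integrable (lebesgue_on S) (\<lambda>x. (g x)\<^sup>2)"
    using assms(2) by (intro Bochner_Integration.integrable_cong) auto
  ultimately show ?thesis by (simp add: L2_def)
qed

lemma has_weak_deriv_cong:
  assumes S: "S \<in> sets borel" and eq: "\<And>x. x \<in> S \<Longrightarrow> f x = f' x"
    and w: "has_weak_deriv S bs f g"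
  shows "has_weak_deriv S bs f' g"
proof -
  have "(LINT x|lebesgue_on S. f x * h x) = (LINT x|lebesgue_on S. f' x * h x)" for h
    using eq by (intro Bochner_Integration.integral_cong) auto
  then show ?thesis using w L2_cong[OF S eq] by (auto simp: has_weak_deriv_def)
qed

section \<open>Functions on the space-time domain\<close>

lemma open_Omega: "open (\<Omega> L T)"
  unfolding \<Omega>_def by (intro open_Times) auto

lemma Omega_borel [simp, measurable]: "\<Omega> L T \<in> sets borel"
  by (intro borel_open open_Omega)

lemma bounded_Omega: "bounded (\<Omega> L T)"
  unfolding \<Omega>_def by (intro bounded_Times) (auto intro: bounded_subset[of "{a..b::real}" for a b])

lemma borel_measurable_slice:
  fixes f :: "real \<times> real \<Rightarrow> real"
  assumes "f \<in> borel_measurable borel"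
  shows "(\<lambda>t. f (x, t)) \<in> borel_measurable borel" "(\<lambda>x. f (x, t)) \<in> borel_measurable borel"
  using assms unfolding borel_prod[symmetric] by measurable

lemma lborel_Fubini:
  fixes f :: "real \<times> real \<Rightarrow> real"
  assumes "integrable lborel f"
  shows "(LINT p|lborel. f p) = (LINT x|lborel. LINT t|lborel. f (x, t))"
    and "(LINT p|lborel. f p) = (LINT t|lborel. LINT x|lborel. f (x, t))"
    and "integrable lborel (\<lambda>x. LINT t|lborel. f (x, t))"
    and "integrable lborel (\<lambda>t. LINT x|lborel. f (x, t))"
    and "AE x in lborel. integrable lborel (\<lambda>t. f (x, t))"
    and "AE t in lborel. integrable lborel (\<lambda>x. f (x, t))"
proof -
  have f: "integrable (lborel \<Otimes>\<^sub>M lborel) (\<lambda>(x, t). f (x, t))"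
    using assms by (simp add: lborel_prod)
  show "(LINT p|lborel. f p) = (LINT x|lborel. LINT t|lborel. f (x, t))"
    using lborel_pair.integral_fst[OF f] by (simp add: lborel_prod)
  show "(LINT p|lborel. f p) = (LINT t|lborel. LINT x|lborel. f (x, t))"
    using lborel_pair.integral_snd[OF f] by (simp add: lborel_prod)
  show "integrable lborel (\<lambda>x. LINT t|lborel. f (x, t))"
    by (rule lborel_pair.integrable_fst[OF f])
  show "integrable lborel (\<lambda>t. LINT x|lborel. f (x, t))"
    by (rule lborel_pair.integrable_snd[OF f])
  show "AE x in lborel. integrable lborel (\<lambda>t. f (x, t))"
    using lborel_pair.AE_integrable_fst[OF f] by simp
  show "AE t in lborel. integrable lborel (\<lambda>x. f (x, t))"
    using lborel_pair.AE_integrable_snd[OF f] by simp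
qed

text \<open>A null set of positions times the whole time line is a null strip in the plane.\<close>

lemma AE_lborel_fst:
  assumes "AE x in lborel. P x"
  shows "AE p in lborel :: (real \<times> real) measure. P (fst p)"
proof -
  obtain N where N: "{x. \<not> P x} \<subseteq> N" "emeasure lborel N = 0" "N \<in> sets lborel"
    using AE_E[OF assms] by auto
  have "emeasure (lborel \<Otimes>\<^sub>M lborel) (N \<times> (UNIV :: real set)) = 0"
    using N by (subst lborel.emeasure_pair_measure_Times) auto
  then have "emeasure lborel (N \<times> (UNIV :: real set)) = 0" by (simp add: lborel_prod)
  moreover have "N \<times> (UNIV :: real set) \<in> sets (lborel \<Otimes>\<^sub>M lborel)" using N(3) by simp
  ultimately show ?thesis
    unfolding lborel_prod using N(1) by (intro AE_I[of _ _ "N \<times> UNIV"]) auto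
qed

lemma borel_L2_OmegaD:
  assumes "borel_L2 (\<Omega> L T) f"
  shows "f \<in> borel_measurable borel" "integrable lborel f" "integrable lborel (\<lambda>p. (f p)\<^sup>2)"
    "\<And>x t. x \<notin> {0<..<L} \<or> t \<notin> {0<..<T} \<Longrightarrow> f (x, t) = 0"
  using assms borel_L2_integrable[OF assms bounded_Omega Omega_borel]
  by (simp_all add: borel_L2_def \<Omega>_def)

text \<open>For the zero extension of \<open>u\<close> this is the test function of the energy
  argument. The upper limit T is implicit, since the functions it is applied to vanish beyond T; the
  sign makes the time derivative exp (- t) f.\<close>

definition time_prim :: "(real \<times> real \<Rightarrow> real) \<Rightarrow> real \<times> real \<Rightarrow> real" where
  "time_prim f p = - (LINT s|lborel. indicator {snd p<..} s * (exp (- s) * f (fst p, s)))"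

text \<open>Before time 0 the primitive is constant in time and in general nonzero. The cut-off
  makes it vanish outside the domain, as \<open>borel_L2\<close> demands, while
  \<open>time_prim\<close> remains the version with values on the boundary.\<close>

definition cut_prim :: "real \<Rightarrow> (real \<times> real \<Rightarrow> real) \<Rightarrow> real \<times> real \<Rightarrow> real" where
  "cut_prim T f p = indicator {0<..<T} (snd p) * time_prim f p"

lemma time_prim_measurable:
  assumes "f \<in> borel_measurable borel"
  shows "time_prim f \<in> borel_measurable borel"
proof -
  have [measurable]: "f \<in> borel_measurable (borel \<Otimes>\<^sub>M borel)" using assms by (simp add: borel_prod)
  have "(\<lambda>p. - (LINT s|lborel. indicator {(t, s). t < s} (snd p, s) * (exp (- s) * f (fst p, s))))
      \<in> borel_measurable (borel \<Otimes>\<^sub>M borel)"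
    by measurable
  then show ?thesis
    unfolding time_prim_def[abs_def] by (simp add: borel_prod indicator_def)
qed

lemma cut_prim_measurable:
  assumes "f \<in> borel_measurable borel"
  shows "cut_prim T f \<in> borel_measurable borel"
proof -
  have [measurable]: "time_prim f \<in> borel_measurable (borel \<Otimes>\<^sub>M borel)"
    using time_prim_measurable[OF assms] by (simp add: borel_prod)
  have "cut_prim T f \<in> borel_measurable (borel \<Otimes>\<^sub>M borel)"
    unfolding cut_prim_def[abs_def] by measurable
  then show ?thesis by (simp add: borel_prod)
qed

text \<open>Cauchy-Schwarz against the constant 1 on (0, T), obtained by expanding the square of the
  deviation of \<open>h\<close> from its mean \<open>c\<close>.\<close>

lemma integral_squared_le:
  fixes h :: "real \<Rightarrow> real"
  assumes T: "T > 0" and h: "integrable lborel h" "integrable lborel (\<lambda>s. (h s)\<^sup>2)"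
    and supp: "\<And>s. s \<notin> {0<..<T} \<Longrightarrow> h s = 0"
  shows "(LINT s|lborel. h s)\<^sup>2 \<le> T * (LINT s|lborel. (h s)\<^sup>2)"
proof -
  define c where "c = (LINT s|lborel. h s) / T"
  have "0 \<le> (LINT s|lborel. (h s - c * indicator {0<..<T} s)\<^sup>2)" by simp
  also have "\<dots> = (LINT s|lborel. (h s)\<^sup>2 - 2 * c * h s + c\<^sup>2 * indicator {0<..<T} s)"
    by (intro Bochner_Integration.integral_cong refl)
      (use supp in \<open>auto simp: power2_eq_square algebra_simps indicator_def\<close>)
  also have "\<dots> = (LINT s|lborel. (h s)\<^sup>2) - 2 * c * (LINT s|lborel. h s) + c\<^sup>2 * T"
    using h T by simp
  also have "\<dots> = (LINT s|lborel. (h s)\<^sup>2) - (LINT s|lborel. h s)\<^sup>2 / T"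
    using T by (simp add: c_def power2_eq_square field_simps)
  finally show ?thesis using T by (simp add: field_simps)
qed

lemma cut_prim_L2:
  assumes T: "T > 0" and f: "borel_L2 (\<Omega> L T) f"
  shows "borel_L2 (\<Omega> L T) (cut_prim T f)"
proof -
  note fD = borel_L2_OmegaD[OF f]
  have K [measurable]: "cut_prim T f \<in> borel_measurable borel" by (rule cut_prim_measurable[OF fD(1)])
  define \<Phi> where "\<Phi> = (\<lambda>x. LINT s|lborel. (f (x, s))\<^sup>2)"
  have \<Phi>: "integrable lborel \<Phi>" unfolding \<Phi>_def by (rule lborel_Fubini(3)[OF fD(3)])
  \<comment> \<open>For almost every x a single bound serves all t: restricting the square integral
    to times after t, with the weight exp (- s) at most 1, only makes it smaller. This gives an
    integrable majorant in both variables.\<close>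
  have "AE x in lborel. \<forall>t. (time_prim f (x, t))\<^sup>2 \<le> T * \<Phi> x"
    using lborel_Fubini(5)[OF fD(2)] lborel_Fubini(5)[OF fD(3)]
  proof eventually_elim
    case (elim x)
    have [measurable]: "(\<lambda>s. f (x, s)) \<in> borel_measurable borel" by (rule borel_measurable_slice[OF fD(1)])
    show ?case
    proof
      fix t
      define h where "h = (\<lambda>s. indicator {t<..} s * (exp (- s) * f (x, s)))"
      have h_le: "\<bar>h s\<bar> \<le> \<bar>f (x, s)\<bar>" for s
        using fD(4)[of x s] by (cases "s > 0") (auto simp: h_def indicator_def abs_mult mult_left_le_one_le)
      have [measurable]: "h \<in> borel_measurable borel" unfolding h_def by measurable
      have h: "integrable lborel h"
        by (rule Bochner_Integration.integrable_bound[OF elim(1)]) (use h_le in auto)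
      have h2_le: "(h s)\<^sup>2 \<le> (f (x, s))\<^sup>2" for s using h_le[of s] by (simp add: abs_le_square_iff)
      have h2: "integrable lborel (\<lambda>s. (h s)\<^sup>2)"
        by (rule Bochner_Integration.integrable_bound[OF elim(2)]) (use h2_le in auto)
      have "(time_prim f (x, t))\<^sup>2 = (LINT s|lborel. h s)\<^sup>2"
        by (simp add: time_prim_def h_def)
      also have "\<dots> \<le> T * (LINT s|lborel. (h s)\<^sup>2)"
        by (rule integral_squared_le[OF T h h2]) (use fD(4) in \<open>auto simp: h_def\<close>)
      also have "\<dots> \<le> T * \<Phi> x"
        unfolding \<Phi>_def using T h2 elim(2) h2_le by (intro mult_left_mono integral_mono) auto
      finally show "(time_prim f (x, t))\<^sup>2 \<le> T * \<Phi> x" .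
    qed
  qed
  from AE_lborel_fst[OF this]
  have bound: "AE p in lborel. (cut_prim T f p)\<^sup>2 \<le> \<Phi> (fst p) * (T * indicator {0<..<T} (snd p))"
    by eventually_elim (auto simp: cut_prim_def indicator_def mult.commute)
  have "integrable lborel (\<lambda>p. \<Phi> (fst p) * (T * indicator {0<..<T} (snd p)))"
    using integrable_pair_mult[OF \<Phi>, of "\<lambda>t. T * indicator {0<..<T} t" "\<lambda>_. 1" 1]
    by (simp add: lborel_prod case_prod_beta')
  then have "integrable lborel (\<lambda>p. (cut_prim T f p)\<^sup>2)"
    by (rule Bochner_Integration.integrable_bound) (use bound in auto)
  moreover have "cut_prim T f p = 0" if "p \<notin> \<Omega> L T" for p
    using that fD(4) by (cases p) (auto simp: cut_prim_def time_prim_def \<Omega>_def indicator_def)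
  ultimately show ?thesis using K by (auto simp: borel_L2_def)
qed

lemma test_functions_slice_integrable:
  fixes \<phi> :: "real \<times> real \<Rightarrow> real"
  assumes "\<phi> \<in> test_functions (\<Omega> L T)"
  shows "integrable lborel (\<lambda>t. \<phi> (x, t))" "integrable lborel (\<lambda>x. \<phi> (x, t))"
proof -
  obtain C where C: "\<And>p. \<bar>\<phi> p\<bar> \<le> C" "C \<ge> 0" using test_functions_bounded[OF assms] by blast
  note [measurable] = borel_measurable_slice[OF test_functions_measurable[OF assms]]
  have supp: "\<phi> (x, t) = 0" if "x \<notin> {0<..<L} \<or> t \<notin> {0<..<T}" for x t
    using test_functionsD(2)[OF assms, of "(x, t)"] that by (auto simp: \<Omega>_def)
  show "integrable lborel (\<lambda>t. \<phi> (x, t))"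
  proof (rule Bochner_Integration.integrable_bound[of _ "\<lambda>t. C * indicator {0<..<T} t"])
    show "AE t in lborel. norm (\<phi> (x, t)) \<le> norm (C * indicator {0<..<T} t)"
    proof (rule AE_I2)
      fix t show "norm (\<phi> (x, t)) \<le> norm (C * indicator {0<..<T} t)"
        using C(1)[of "(x, t)"] C(2) supp[of x t] by (cases "t \<in> {0<..<T}") auto
    qed
  qed auto
  show "integrable lborel (\<lambda>x. \<phi> (x, t))"
  proof (rule Bochner_Integration.integrable_bound[of _ "\<lambda>t. C * indicator {0<..<L} t"])
    show "AE x in lborel. norm (\<phi> (x, t)) \<le> norm (C * indicator {0<..<L} x)"
    proof (rule AE_I2)
      fix x show "norm (\<phi> (x, t)) \<le> norm (C * indicator {0<..<L} x)"
        using C(1)[of "(x, t)"] C(2) supp[of x t] by (cases "x \<in> {0<..<L}") auto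
    qed
  qed auto
qed

lemma borel_L2_times_test_integrable:
  fixes \<phi> :: "real \<times> real \<Rightarrow> real"
  assumes "borel_L2 (\<Omega> L T) f" "\<phi> \<in> test_functions S"
  shows "integrable lborel (\<lambda>p. f p * \<phi> p)"
proof -
  obtain C where C: "\<And>p. \<bar>\<phi> p\<bar> \<le> C" using test_functions_bounded[OF assms(2)] by blast
  show ?thesis
    by (rule integrable_mult_bounded[OF borel_L2_OmegaD(2)[OF assms(1)] _ C])
      (simp add: test_functions_measurable[OF assms(2)])
qed

text \<open>Fubini over the triangle t < s moves the integration from \<open>f\<close> to the time
  derivative of the test function, whose integral up to s is the test function at s. No boundary
  term survives because \<phi> has compact support in the domain.\<close>

lemma time_prim_weak_deriv_t:
  assumes T: "T > 0" and f: "borel_L2 (\<Omega> L T) f"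
  shows "borel_weak_deriv (\<Omega> L T) [e_t] (cut_prim T f) (\<lambda>p. f p * exp (- snd p))"
proof -
  note fD = borel_L2_OmegaD[OF f]
  have exp_meas: "(\<lambda>p::real\<times>real. exp (- snd p)) \<in> borel_measurable borel"
    by (intro borel_measurable_continuous_onI continuous_intros)
  have fe: "borel_L2 (\<Omega> L T) (\<lambda>p. f p * exp (- snd p))"
    by (rule borel_L2_mult_bounded[OF f exp_meas, of 1]) (auto simp: \<Omega>_def)
  note feD = borel_L2_OmegaD[OF fe]
  have e_t: "e_t \<in> Basis" by (auto simp: Basis_prod_def)
  have "(LINT p|lborel. cut_prim T f p * partial_deriv e_t \<phi> p) =
      - (LINT p|lborel. f p * exp (- snd p) * \<phi> p)" if \<phi>: "\<phi> \<in> test_functions (\<Omega> L T)" for \<phi>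
  proof -
    let ?d = "partial_deriv e_t \<phi>"
    have d: "?d \<in> test_functions (\<Omega> L T)" by (rule partial_deriv_test_function[OF \<phi> e_t])
    have d_supp: "?d (x, t) = 0" if "t \<notin> {0<..<T}" for x t
      using test_functionsD(2)[OF d, of "(x, t)"] that by (auto simp: \<Omega>_def)
    have \<phi>_supp: "\<phi> (x, t) = 0" if "t \<notin> {0<..<T}" for x t
      using test_functionsD(2)[OF \<phi>, of "(x, t)"] that by (auto simp: \<Omega>_def)
    have FTC: "(LINT t|lborel. ?d (x, t) * indicator {..<s} t) = \<phi> (x, s)" if s: "s \<in> {0<..<T}" for x s
    proof -
      have deriv: "((\<lambda>t. \<phi> (x, t)) has_real_derivative ?d (x, t)) (at t)" for t
        using Ck_has_partial_deriv[OF test_functionsD(1)[OF \<phi>] e_t, of "(x, t)"]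
          DERIV_shift[of "\<lambda>t. \<phi> (x, t)" "?d (x, t)" 0 t] by (simp add: add.commute)
      have [measurable]: "(\<lambda>t. ?d (x, t)) \<in> borel_measurable borel"
        by (rule borel_measurable_slice[OF test_functions_measurable[OF d]])
      have "(LINT t|lborel. ?d (x, t) * indicator {..<s} t) = (LINT t|lborel. ?d (x, t) * indicator {0..s} t)"
      proof (rule integral_cong_AE)
        show "AE t in lborel. ?d (x, t) * indicator {..<s} t = ?d (x, t) * indicator {0..s} t"
          using AE_lborel_singleton[of s]
        proof eventually_elim
          case (elim t)
          then show ?case using d_supp[of t x] by (cases "t > 0") (auto simp: indicator_def)
        qed
      qed auto
      also have "\<dots> = \<phi> (x, s) - \<phi> (x, 0)"
      proof (rule integral_FTC_Icc_real)
        show "isCont (\<lambda>t. ?d (x, t)) t" for t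
          using continuous_on_compose2[OF test_functionsD(3)[OF d], of UNIV "\<lambda>t. (x, t)"]
          by (auto simp: continuous_on_eq_continuous_at intro!: continuous_intros)
      qed (use s deriv in auto)
      finally show ?thesis using \<phi>_supp[of 0 x] by simp
    qed
    have "(LINT p|lborel. cut_prim T f p * ?d p) = (LINT x|lborel. LINT t|lborel. cut_prim T f (x, t) * ?d (x, t))"
      by (rule lborel_Fubini(1)[OF borel_L2_times_test_integrable[OF cut_prim_L2[OF T f] d]])
    also have "\<dots> = (LINT x|lborel. - (LINT t|lborel. f (x, t) * exp (- t) * \<phi> (x, t)))"
    proof (rule integral_cong_AE)
      show "(\<lambda>x. LINT t|lborel. cut_prim T f (x, t) * ?d (x, t)) \<in> borel_measurable lborel"
        using lborel_Fubini(3)[OF borel_L2_times_test_integrable[OF cut_prim_L2[OF T f] d]] by simp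
      show "(\<lambda>x. - (LINT t|lborel. f (x, t) * exp (- t) * \<phi> (x, t))) \<in> borel_measurable lborel"
        using lborel_Fubini(3)[OF borel_L2_times_test_integrable[OF fe \<phi>]] by simp
      show "AE x in lborel. (LINT t|lborel. cut_prim T f (x, t) * ?d (x, t)) =
          - (LINT t|lborel. f (x, t) * exp (- t) * \<phi> (x, t))"
        using lborel_Fubini(5)[OF feD(2)]
      proof eventually_elim
        case (elim x)
        let ?g = "\<lambda>t s. ?d (x, t) * (f (x, s) * exp (- s)) * indicator {(t, s). t < s} (t, s)"
        have int: "integrable (lborel \<Otimes>\<^sub>M lborel) (\<lambda>(t, s). ?g t s)"
          using elim by (intro integrable_pair_mult[OF test_functions_slice_integrable(1)[OF d], where C = 1])
            (auto simp: indicator_def)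
        have "(LINT t|lborel. cut_prim T f (x, t) * ?d (x, t)) = (LINT t|lborel. - (LINT s|lborel. ?g t s))"
        proof (intro Bochner_Integration.integral_cong refl)
          fix t
          have "(LINT s|lborel. ?g t s) =
              (LINT s|lborel. ?d (x, t) * (indicator {t<..} s * (exp (- s) * f (x, s))))"
            by (intro Bochner_Integration.integral_cong refl) (auto simp: indicator_def)
          also have "\<dots> = - (?d (x, t) * time_prim f (x, t))"
            by (simp add: time_prim_def)
          finally show "cut_prim T f (x, t) * ?d (x, t) = - (LINT s|lborel. ?g t s)"
            using d_supp[of t x] by (auto simp: cut_prim_def indicator_def)
        qed
        also have "\<dots> = - (LINT t|lborel. LINT s|lborel. ?g t s)" by simp
        also have "(LINT t|lborel. LINT s|lborel. ?g t s) = (LINT s|lborel. LINT t|lborel. ?g t s)"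
          by (rule lborel_pair.Fubini_integral[OF int, symmetric])
        also have "\<dots> = (LINT s|lborel. f (x, s) * exp (- s) * \<phi> (x, s))"
        proof (intro Bochner_Integration.integral_cong refl)
          fix s
          have "(LINT t|lborel. ?g t s) =
              (LINT t|lborel. (f (x, s) * exp (- s)) * (?d (x, t) * indicator {..<s} t))"
            by (intro Bochner_Integration.integral_cong refl) (auto simp: indicator_def)
          also have "\<dots> = f (x, s) * exp (- s) * (LINT t|lborel. ?d (x, t) * indicator {..<s} t)"
            by (rule integral_mult_right_zero)
          finally show "(LINT t|lborel. ?g t s) = f (x, s) * exp (- s) * \<phi> (x, s)"
            using FTC[of s x] fD(4)[of x s] by (cases "s \<in> {0<..<T}") auto
        qed
        finally show ?case .
      qed
    qed
    also have "\<dots> = - (LINT p|lborel. f p * exp (- snd p) * \<phi> p)"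
      using lborel_Fubini(1)[OF borel_L2_times_test_integrable[OF fe \<phi>]] by simp
    finally show ?thesis .
  qed
  then show ?thesis
    using fe cut_prim_L2[OF T f] by (simp add: borel_weak_deriv_def)
qed

text \<open>The time primitive of a test function is not compactly supported, so duality is not directly
  available. Instead, products \<open>\<psi>(x) c(t)\<close> show that almost every time slice of \<open>g\<close> is a weak
  derivative of the slice of \<open>f\<close>, and a general \<open>\<phi>\<close> is treated at each fixed time.\<close>

lemma time_prim_weak_deriv_x:
  assumes T: "T > 0" and w: "borel_weak_deriv (\<Omega> L T) (replicate n e_x) f g"
  shows "borel_weak_deriv (\<Omega> L T) (replicate n e_x) (cut_prim T f) (cut_prim T g)"
proof -
  have f: "borel_L2 (\<Omega> L T) f" and g: "borel_L2 (\<Omega> L T) g"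
    using w by (auto simp: borel_weak_deriv_def)
  note fD = borel_L2_OmegaD[OF f] and gD = borel_L2_OmegaD[OF g]
  have Kf: "borel_L2 (\<Omega> L T) (cut_prim T f)" and Kg: "borel_L2 (\<Omega> L T) (cut_prim T g)"
    by (rule cut_prim_L2[OF T f] cut_prim_L2[OF T g])+
  let ?dx = "foldr partial_deriv (replicate n e_x)" and ?d1 = "foldr partial_deriv (replicate n (1::real))"
  have dx: "?dx \<phi> \<in> test_functions (\<Omega> L T)" if "\<phi> \<in> test_functions (\<Omega> L T)" for \<phi>
    by (rule foldr_partial_deriv_test_function[OF that]) (auto simp: Basis_prod_def)
  \<comment> \<open>The exceptional set of times depends on \<psi>. This is harmless because each
    later use involves a single \<psi>, the slice of \<phi> at one fixed time.\<close>
  have slice: "AE s in lborel. (LINT x|lborel. f (x, s) * ?d1 \<psi> x - (- 1) ^ n * (g (x, s) * \<psi> x)) = 0"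
    and slice_int: "integrable lborel (\<lambda>p. f p * ?d1 \<psi> (fst p) - (- 1) ^ n * (g p * \<psi> (fst p)))"
    if \<psi>: "\<psi> \<in> test_functions {0<..<L}" for \<psi>
  proof -
    have d\<psi>: "?d1 \<psi> \<in> test_functions {0<..<L}"
      by (rule foldr_partial_deriv_test_function[OF \<psi>]) auto
    have bm: "(\<lambda>p::real\<times>real. \<psi> (fst p)) \<in> borel_measurable borel" if "\<psi> \<in> test_functions {0<..<L}" for \<psi>
      using test_functionsD(3)[OF that]
      by (intro borel_measurable_continuous_onI) (auto intro!: continuous_intros continuous_on_compose2[of UNIV \<psi>])
    obtain C where C: "\<And>p. \<bar>\<psi> p\<bar> \<le> C" using test_functions_bounded[OF \<psi>] by blast
    obtain C' where C': "\<And>p. \<bar>?d1 \<psi> p\<bar> \<le> C'" using test_functions_bounded[OF d\<psi>] by blast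
    have i1: "integrable lborel (\<lambda>p. f p * ?d1 \<psi> (fst p))"
      using integrable_mult_bounded[OF fD(2), of "\<lambda>p. ?d1 \<psi> (fst p)" C'] C' bm[OF d\<psi>] by simp
    have i2: "integrable lborel (\<lambda>p. g p * \<psi> (fst p))"
      using integrable_mult_bounded[OF gD(2), of "\<lambda>p. \<psi> (fst p)" C] C bm[OF \<psi>] by simp
    let ?h = "\<lambda>p. f p * ?d1 \<psi> (fst p) - (- 1) ^ n * (g p * \<psi> (fst p))"
    show int: "integrable lborel ?h" using i1 i2 by simp
    have "AE s in lborel. (LINT x|lborel. ?h (x, s)) = 0"
    proof (rule fundamental_lemma[where a = 0 and b = T])
      show "integrable lborel (\<lambda>s. LINT x|lborel. ?h (x, s))" by (rule lborel_Fubini(4)[OF int])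
      show "(LINT x|lborel. ?h (x, t)) = 0" if "t \<notin> {0<..<T}" for t
        using fD(4)[of _ t] gD(4)[of _ t] that by simp
      fix c assume c: "c \<in> test_functions {0<..<T}"
      obtain B where B: "\<And>p. \<bar>c p\<bar> \<le> B" using test_functions_bounded[OF c] by blast
      have c_meas: "(\<lambda>p::real\<times>real. c (snd p)) \<in> borel_measurable borel"
        using test_functionsD(3)[OF c]
        by (intro borel_measurable_continuous_onI) (auto intro!: continuous_intros continuous_on_compose2[of UNIV c])
      have hc: "integrable lborel (\<lambda>p. ?h p * c (snd p))"
        using integrable_mult_bounded[OF int, of "\<lambda>p. c (snd p)" B] B c_meas by simp
      have fc: "integrable lborel (\<lambda>p. f p * (?d1 \<psi> (fst p) * c (snd p)))"
        using integrable_mult_bounded[OF i1, of "\<lambda>p. c (snd p)" B] B c_meas by (simp add: mult.assoc)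
      have gc: "integrable lborel (\<lambda>p. g p * (\<psi> (fst p) * c (snd p)))"
        using integrable_mult_bounded[OF i2, of "\<lambda>p. c (snd p)" B] B c_meas by (simp add: mult.assoc)
      have test: "(\<lambda>p. \<psi> (fst p) * c (snd p)) \<in> test_functions (\<Omega> L T)"
        unfolding \<Omega>_def by (rule tensor_test_function[OF \<psi> c])
      have "(LINT s|lborel. (LINT x|lborel. ?h (x, s)) * c s) = (LINT s|lborel. LINT x|lborel. ?h (x, s) * c s)"
        by simp
      also have "\<dots> = (LINT p|lborel. ?h p * c (snd p))"
        using lborel_Fubini(2)[OF hc] by simp
      also have "\<dots> = (LINT p|lborel. f p * (?d1 \<psi> (fst p) * c (snd p)) -
          (- 1) ^ n * (g p * (\<psi> (fst p) * c (snd p))))"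
        by (intro Bochner_Integration.integral_cong refl) (simp add: algebra_simps)
      also have "\<dots> = (LINT p|lborel. f p * (?d1 \<psi> (fst p) * c (snd p))) -
          (- 1) ^ n * (LINT p|lborel. g p * (\<psi> (fst p) * c (snd p)))"
        using fc gc by simp
      also have "\<dots> = 0"
        using w test foldr_partial_deriv_tensor[OF \<psi>, of n c] by (auto simp: borel_weak_deriv_def)
      finally show "(LINT s|lborel. (LINT x|lborel. ?h (x, s)) * c s) = 0" .
    qed
    then show "AE s in lborel. (LINT x|lborel. f (x, s) * ?d1 \<psi> x - (- 1) ^ n * (g (x, s) * \<psi> x)) = 0"
      by simp
  qed
  have "(LINT p|lborel. cut_prim T f p * ?dx \<phi> p) = (- 1) ^ n * (LINT p|lborel. cut_prim T g p * \<phi> p)"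
    if \<phi>: "\<phi> \<in> test_functions (\<Omega> L T)" for \<phi>
  proof -
    note i1 = borel_L2_times_test_integrable[OF Kf dx[OF \<phi>]] and i2 = borel_L2_times_test_integrable[OF Kg \<phi>]
    let ?h = "\<lambda>p. cut_prim T f p * ?dx \<phi> p - (- 1) ^ n * (cut_prim T g p * \<phi> p)"
    have int: "integrable lborel ?h" using i1 i2 by simp
    have inner: "(LINT x|lborel. ?h (x, t)) = 0" for t
    proof (cases "t \<in> {0<..<T}")
      case False
      then show ?thesis by (simp add: cut_prim_def)
    next
      case True
      define \<psi> where "\<psi> = (\<lambda>x. \<phi> (x, t))"
      have \<psi>: "\<psi> \<in> test_functions {0<..<L}"
        unfolding \<psi>_def using \<phi> by (intro slice_test_function) (simp add: \<Omega>_def)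
      let ?k = "\<lambda>p. f p * ?d1 \<psi> (fst p) - (- 1) ^ n * (g p * \<psi> (fst p))"
      \<comment> \<open>Restricting to positive times bounds the weight by 1 and changes nothing,
        since t > 0 in this case.\<close>
      let ?e = "\<lambda>p::real\<times>real. indicator {p. t < snd p \<and> 0 < snd p} p * exp (- snd p)"
      have e_meas: "?e \<in> borel_measurable borel"
        unfolding borel_prod[symmetric] by measurable
      have ke: "integrable lborel (\<lambda>p. ?k p * ?e p)"
        using integrable_mult_bounded[OF slice_int[OF \<psi>], of ?e 1] e_meas by (auto simp: indicator_def)
      have d1\<psi>: "?d1 \<psi> x = ?dx \<phi> (x, t)" for x
        unfolding \<psi>_def by (rule foldr_partial_deriv_slice)
      have "(LINT x|lborel. ?h (x, t)) = (LINT x|lborel. - (LINT s|lborel. ?k (x, s) * ?e (x, s)))"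
      proof (rule integral_cong_AE)
        show "(\<lambda>x. ?h (x, t)) \<in> borel_measurable lborel"
          using borel_measurable_slice(2)[OF borel_measurable_integrable[OF int, simplified]] by simp
        show "(\<lambda>x. - (LINT s|lborel. ?k (x, s) * ?e (x, s))) \<in> borel_measurable lborel"
          using lborel_Fubini(3)[OF ke] by simp
        show "AE x in lborel. ?h (x, t) = - (LINT s|lborel. ?k (x, s) * ?e (x, s))"
          using lborel_Fubini(5)[OF fD(2)] lborel_Fubini(5)[OF gD(2)]
        proof eventually_elim
          case (elim x)
          let ?e' = "\<lambda>s. indicator {t<..} s * (indicator {0<..} s * exp (- s))"
          have fe: "integrable lborel (\<lambda>s. f (x, s) * ?e' s)" and ge: "integrable lborel (\<lambda>s. g (x, s) * ?e' s)"
            by (rule integrable_mult_bounded[OF elim(1), where C = 1] integrable_mult_bounded[OF elim(2), where C = 1];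
              auto simp: indicator_def)+
          have "(LINT s|lborel. ?k (x, s) * ?e (x, s)) =
              (LINT s|lborel. ?d1 \<psi> x * (f (x, s) * ?e' s) - (- 1) ^ n * \<psi> x * (g (x, s) * ?e' s))"
            by (intro Bochner_Integration.integral_cong refl) (auto simp: algebra_simps indicator_def)
          also have "\<dots> = ?d1 \<psi> x * (LINT s|lborel. f (x, s) * ?e' s) - (- 1) ^ n * \<psi> x * (LINT s|lborel. g (x, s) * ?e' s)"
            using fe ge by simp
          also have "(LINT s|lborel. f (x, s) * ?e' s) = - time_prim f (x, t)"
            unfolding time_prim_def minus_minus
            by (intro Bochner_Integration.integral_cong refl) (use True in \<open>auto simp: indicator_def\<close>)
          also have "(LINT s|lborel. g (x, s) * ?e' s) = - time_prim g (x, t)"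
            unfolding time_prim_def minus_minus
            by (intro Bochner_Integration.integral_cong refl) (use True in \<open>auto simp: indicator_def\<close>)
          finally have "- (LINT s|lborel. ?k (x, s) * ?e (x, s)) =
              ?d1 \<psi> x * time_prim f (x, t) - (- 1) ^ n * \<psi> x * time_prim g (x, t)" by simp
          also have "\<dots> = ?h (x, t)"
            unfolding d1\<psi> using True by (simp add: cut_prim_def \<psi>_def)
          finally show ?case by (rule sym)
        qed
      qed
      also have "\<dots> = - (LINT s|lborel. LINT x|lborel. ?k (x, s) * ?e (x, s))"
        using lborel_Fubini(1,2)[OF ke] by simp
      also have "(LINT s|lborel. LINT x|lborel. ?k (x, s) * ?e (x, s)) = (LINT s::real|lborel. 0)"
      proof (rule integral_cong_AE)
        show "(\<lambda>s. LINT x|lborel. ?k (x, s) * ?e (x, s)) \<in> borel_measurable lborel"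
          using lborel_Fubini(4)[OF ke] by simp
        show "AE s in lborel. (LINT x|lborel. ?k (x, s) * ?e (x, s)) = 0"
          using slice[OF \<psi>]
        proof eventually_elim
          case (elim s)
          \<comment> \<open>\<open>?e\<close> depends on time only; it is evaluated at position 0 in
            order to leave the space integral.\<close>
          have "(LINT x|lborel. ?k (x, s) * ?e (x, s)) = (LINT x|lborel. ?k (x, s)) * ?e (0, s)"
            unfolding integral_mult_left_zero[symmetric]
            by (intro Bochner_Integration.integral_cong refl) (auto simp: indicator_def)
          then show ?case using elim by simp
        qed
      qed simp
      finally show ?thesis by simp
    qed
    have "(LINT p|lborel. ?h p) = 0"
      using lborel_Fubini(2)[OF int] inner by simp
    moreover have "(LINT p|lborel. ?h p) =
        (LINT p|lborel. cut_prim T f p * ?dx \<phi> p) - (- 1) ^ n * (LINT p|lborel. cut_prim T g p * \<phi> p)"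
      using i1 i2 by simp
    ultimately show ?thesis by simp
  qed
  then show ?thesis using Kf Kg by (simp add: borel_weak_deriv_def)
qed

section \<open>The energy estimate\<close>

text \<open>Reversing time, t to T - t, reduces this to the forward inequality, because exp (T - t)
  = exp T exp (- t). Applied with g = exp (- t) \<open>Uxx\<close> at fixed x, it gives the bending
  term a sign for each x separately, before the stiffness enters as a factor.\<close>

lemma exp_weighted_reversed_primitive_nonneg:
  fixes g :: "real \<Rightarrow> real"
  assumes g: "integrable lborel g" and supp: "\<And>t. t \<notin> {0<..<T} \<Longrightarrow> g t = 0"
  shows "0 \<le> (LINT t|lborel. exp t * g t * (LINT s|lborel. indicator {t<..} s * g s))"
proof -
  define h where "h = (\<lambda>t. g (T - t))"
  have h: "integrable lborel h"
    unfolding h_def using lborel_integrable_real_affine[OF g, of "- 1" T] by simp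
  have "(LINT s|lborel. indicator {T - t<..} s * g s) = (LINT s|lborel. indicator {..<t} s * h s)" for t
    by (subst lborel_integral_real_affine[where c = "- 1" and t = T])
      (auto simp: h_def indicator_def intro!: Bochner_Integration.integral_cong)
  then have "(LINT t|lborel. exp t * g t * (LINT s|lborel. indicator {t<..} s * g s)) =
      (LINT t|lborel. exp T * (exp (- t) * h t * (LINT s|lborel. indicator {..<t} s * h s)))"
    by (subst lborel_integral_real_affine[where c = "- 1" and t = T])
      (auto simp: h_def exp_diff exp_minus field_simps intro!: Bochner_Integration.integral_cong)
  also have "\<dots> = exp T * (LINT t|lborel. exp (- t) * h t * (LINT s|lborel. indicator {..<t} s * h s))"
    by (rule integral_mult_right_zero)
  moreover have "0 \<le> (LINT t|lborel. exp (- t) * h t * (LINT s|lborel. indicator {..<t} s * h s))"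
  proof (rule order_trans)
    show "(LINT t|lborel. indicator {0<..<T} t *
        (exp (- t) * (LINT s|lborel. indicator {..<t} s * h s)\<^sup>2)) / 2 \<le>
        (LINT t|lborel. exp (- t) * h t * (LINT s|lborel. indicator {..<t} s * h s))"
      by (rule exp_weighted_primitive_ge[OF h]) (auto simp: h_def intro!: supp)
    show "0 \<le> (LINT t|lborel. indicator {0<..<T} t *
        (exp (- t) * (LINT s|lborel. indicator {..<t} s * h s)\<^sup>2)) / 2"
      by (intro divide_nonneg_pos integral_nonneg) (auto simp: indicator_def)
  qed
  ultimately show ?thesis by simp
qed

section \<open>Functions continuous up to the boundary and their zero extensions\<close>

lemma continuous_compact_bounded:
  fixes f :: "'a::topological_space \<Rightarrow> real"
  assumes "continuous_on K f" "compact K"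
  obtains C where "C \<ge> 0" "\<And>x. x \<in> K \<Longrightarrow> \<bar>f x\<bar> \<le> C"
proof -
  have "bounded (f ` K)" by (intro compact_imp_bounded compact_continuous_image assms)
  then obtain C where "C > 0" "\<And>x. x \<in> K \<Longrightarrow> \<bar>f x\<bar> \<le> C" by (auto simp: bounded_pos)
  then show ?thesis by (intro that[of C]) auto
qed

locale space_time_function =
  fixes L T :: real and u :: "real \<times> real \<Rightarrow> real"
  assumes L: "L > 0" and T: "T > 0"
    and cont: "continuous_on ({0..L} \<times> {0..T}) u"
begin

definition U :: "real \<times> real \<Rightarrow> real" where
  "U p = indicator (\<Omega> L T) p * u p"

lemma Omega_subset: "\<Omega> L T \<subseteq> {0..L} \<times> {0..T}"
  by (auto simp: \<Omega>_def)

lemma U_measurable: "U \<in> borel_measurable borel"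
  unfolding U_def[abs_def]
  using borel_measurable_continuous_on_indicator[OF Omega_borel continuous_on_subset[OF cont Omega_subset]]
  by simp

lemma u_bounded: obtains M where "M \<ge> 0" "\<And>p. p \<in> {0..L} \<times> {0..T} \<Longrightarrow> \<bar>u p\<bar> \<le> M"
  using continuous_compact_bounded[OF cont compact_Times[OF compact_Icc compact_Icc]] by metis

lemma U_bounded: obtains M where "M \<ge> 0" "\<And>p. \<bar>U p\<bar> \<le> M"
proof -
  obtain M where M: "M \<ge> 0" "\<And>p. p \<in> {0..L} \<times> {0..T} \<Longrightarrow> \<bar>u p\<bar> \<le> M"
    using u_bounded by blast
  have "\<bar>U p\<bar> \<le> M" for p
    using M(1) M(2)[of p] Omega_subset by (cases "p \<in> \<Omega> L T") (auto simp: U_def)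
  with M(1) show ?thesis by (rule that)
qed

lemma U_rep: "borel_rep (\<Omega> L T) u U"
proof -
  have "u \<in> borel_measurable (lebesgue_on (\<Omega> L T)) \<longleftrightarrow> U \<in> borel_measurable (lebesgue_on (\<Omega> L T))"
    by (intro measurable_cong) (simp add: U_def)
  then have "u \<in> borel_measurable (lebesgue_on (\<Omega> L T))"
    using borel_measurable_lebesgue_onI[OF U_measurable] by simp
  then show ?thesis
    by (auto simp: borel_rep_def U_measurable AE_lebesgue_on_iff) (auto simp: U_def)
qed

lemma U_L2: "borel_L2 (\<Omega> L T) U"
proof -
  obtain M where M: "M \<ge> 0" "\<And>p. \<bar>U p\<bar> \<le> M" using U_bounded by blast
  have "integrable lborel (\<lambda>p. (U p)\<^sup>2)"
  proof (rule Bochner_Integration.integrable_bound[of _ "\<lambda>p. M\<^sup>2 * indicator (\<Omega> L T) p"])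
    show "integrable lborel (\<lambda>p. M\<^sup>2 * indicator (\<Omega> L T) p)"
      using emeasure_bounded_finite[OF bounded_Omega]
      by (intro integrable_mult_right integrable_real_indicator) auto
    show "AE p in lborel. norm ((U p)\<^sup>2) \<le> norm (M\<^sup>2 * indicator (\<Omega> L T) p)"
    proof (rule AE_I2)
      fix p show "norm ((U p)\<^sup>2) \<le> norm (M\<^sup>2 * indicator (\<Omega> L T) p)"
        using M(1) M(2)[of p] by (cases "p \<in> \<Omega> L T") (auto simp: U_def abs_le_square_iff[symmetric])
    qed
  qed (use U_measurable in auto)
  then show ?thesis using U_measurable by (auto simp: borel_L2_def U_def)
qed

text \<open>Testing with \<psi> in the space variable reduces the planar weak derivative to a
  one-dimensional one, of G(t) = integral of u(x, t) \<psi>(x) dx; the one-dimensional theorem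
  applies there, and the fundamental lemma in x removes \<psi>. Continuity of \<open>u\<close> down
  to t = 0 is what lets the initial values enter.\<close>

lemma time_FTC:
  assumes w: "borel_weak_deriv (\<Omega> L T) [e_t] U Ut"
    and init: "\<And>x. x \<in> {0<..<L} \<Longrightarrow> u (x, 0) = 0"
    and s: "s \<in> {0<..<T}"
  shows "AE x in lborel. U (x, s) = (LINT t|lborel. indicator {..<s} t * Ut (x, t))"
proof -
  have Ut: "borel_L2 (\<Omega> L T) Ut" using w by (simp add: borel_weak_deriv_def)
  note UtD = borel_L2_OmegaD[OF Ut] and UD = borel_L2_OmegaD[OF U_L2]
  obtain M where M: "M \<ge> 0" "\<And>p. p \<in> {0..L} \<times> {0..T} \<Longrightarrow> \<bar>u p\<bar> \<le> M"
    using u_bounded by blast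
  define P where "P = (\<lambda>p. Ut p * indicator {p. snd p < s} p)"
  have P: "integrable lborel P"
  proof -
    have "(indicator {p::real\<times>real. snd p < s} :: _ \<Rightarrow> real) \<in> borel_measurable borel"
      unfolding borel_prod[symmetric] by measurable
    then show ?thesis
      unfolding P_def by (intro integrable_mult_bounded[OF UtD(2), where C = 1]) (simp, simp add: indicator_def)
  qed
  have V: "(LINT t|lborel. indicator {..<s} t * Ut (x, t)) = (LINT t|lborel. P (x, t))" for x
    by (intro Bochner_Integration.integral_cong refl) (auto simp: P_def indicator_def)
  have Us: "integrable lborel (\<lambda>x. U (x, s))"
  proof -
    obtain M where M: "M \<ge> 0" "\<And>p. \<bar>U p\<bar> \<le> M" using U_bounded by blast
    show ?thesis
    proof (rule Bochner_Integration.integrable_bound[of _ "\<lambda>x. M * indicator {0<..<L} x"])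
      show "AE x in lborel. norm (U (x, s)) \<le> norm (M * indicator {0<..<L} x)"
      proof (rule AE_I2)
        fix x show "norm (U (x, s)) \<le> norm (M * indicator {0<..<L} x)"
          using M UD(4)[of x s] by (cases "x \<in> {0<..<L}") auto
      qed
    qed (use borel_measurable_slice[OF UD(1)] in auto)
  qed
  let ?D = "\<lambda>x. U (x, s) - (LINT t|lborel. P (x, t))"
  have "AE x in lborel. ?D x = 0"
  proof (rule fundamental_lemma[where a = 0 and b = L])
    show "integrable lborel ?D" using Us lborel_Fubini(3)[OF P] by simp
    show "?D x = 0" if "x \<notin> {0<..<L}" for x
      using that UD(4)[of x] UtD(4)[of x] by (simp add: P_def)
    fix \<psi> :: "real \<Rightarrow> real" assume \<psi>: "\<psi> \<in> test_functions {0<..<L}"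
    obtain C where C: "\<And>p. \<bar>\<psi> p\<bar> \<le> C" "C \<ge> 0" using test_functions_bounded[OF \<psi>] by blast
    note [measurable] = test_functions_measurable[OF \<psi>]
    have \<psi>_fst: "(\<lambda>p::real\<times>real. \<psi> (fst p)) \<in> borel_measurable borel"
      unfolding borel_prod[symmetric] by measurable
    have Ut\<psi>: "integrable lborel (\<lambda>p. Ut p * \<psi> (fst p))"
      using integrable_mult_bounded[OF UtD(2) _ C(1)[of "fst _"]] \<psi>_fst by simp
    have P\<psi>: "integrable lborel (\<lambda>p. P p * \<psi> (fst p))"
      using integrable_mult_bounded[OF P _ C(1)[of "fst _"]] \<psi>_fst by simp
    \<comment> \<open>\<open>u\<close> is used here, not \<open>U\<close>: the zero extension drops
      to 0 at t = T, while \<open>G\<close> has to be continuous on the closed time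
      interval.\<close>
    define G where "G = (\<lambda>t. LINT x|lborel. indicator {0<..<L} x * u (x, t) * \<psi> x)"
    define H where "H = (\<lambda>t. LINT x|lborel. Ut (x, t) * \<psi> x)"
    have u_slice: "(\<lambda>x. indicator {0<..<L} x * u (x, t)) \<in> borel_measurable borel" if "t \<in> {0..T}" for t
    proof -
      have "continuous_on {0<..<L} (\<lambda>x. u (x, t))"
        using that by (intro continuous_on_compose2[OF cont]) (auto intro!: continuous_intros)
      then show ?thesis
        using borel_measurable_continuous_on_indicator[of "{0<..<L}" "\<lambda>x. u (x, t)"] by simp
    qed
    have u_\<psi>_le: "\<bar>indicator {0<..<L} x * u (x, t) * \<psi> x\<bar> \<le> M * C * indicator {0<..<L} x"
      if "t \<in> {0..T}" for x t
      using M(1) M(2)[of "(x, t)"] C that by (auto simp: indicator_def abs_mult intro!: mult_mono)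
    have G_cont: "continuous_on {0..T} G"
    proof (rule continuous_on_sequentiallyI)
      fix r a assume r: "\<forall>n. r n \<in> {0..T}" and a: "a \<in> {0..T}" and ra: "r \<longlonglongrightarrow> a"
      show "(\<lambda>n. G (r n)) \<longlonglongrightarrow> G a"
        unfolding G_def
      proof (rule integral_dominated_convergence[where w = "\<lambda>x. M * C * indicator {0<..<L} x"])
        show "AE x in lborel. (\<lambda>n. indicator {0<..<L} x * u (x, r n) * \<psi> x)
            \<longlonglongrightarrow> indicator {0<..<L} x * u (x, a) * \<psi> x"
        proof (rule AE_I2)
          fix x
          show "(\<lambda>n. indicator {0<..<L} x * u (x, r n) * \<psi> x)
            \<longlonglongrightarrow> indicator {0<..<L} x * u (x, a) * \<psi> x"
          proof (cases "x \<in> {0<..<L}")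
            case True
            have "(\<lambda>n. u (x, r n)) \<longlonglongrightarrow> u (x, a)"
              using True r a
              by (intro continuous_on_tendsto_compose[OF cont] tendsto_intros ra) (auto intro!: always_eventually)
            then show ?thesis by (intro tendsto_intros)
          qed simp
        qed
        show "AE x in lborel. norm (indicator {0<..<L} x * u (x, r n) * \<psi> x) \<le> M * C * indicator {0<..<L} x" for n
          using u_\<psi>_le[of "r n"] r by (intro AE_I2) simp
        show "(\<lambda>x. indicator {0<..<L} x * u (x, r n) * \<psi> x) \<in> borel_measurable lborel" for n
          using u_slice[of "r n"] r by (simp add: borel_measurable_times)
        show "(\<lambda>x. indicator {0<..<L} x * u (x, a) * \<psi> x) \<in> borel_measurable lborel"
          using u_slice[OF a] by (simp add: borel_measurable_times)
      qed simp
    qed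
    have G_eq: "indicator {0<..<T} t * G t = (LINT x|lborel. U (x, t) * \<psi> x)" for t
      by (cases "t \<in> {0<..<T}")
        (auto simp: G_def U_def \<Omega>_def indicator_def intro!: Bochner_Integration.integral_cong)
    have weak: "(LINT t|lborel. indicator {0<..<T} t * G t * partial_deriv 1 c t) = - (LINT t|lborel. H t * c t)"
      if c: "c \<in> test_functions {0<..<T}" for c
    proof -
      have test: "(\<lambda>p. \<psi> (fst p) * c (snd p)) \<in> test_functions (\<Omega> L T)"
        unfolding \<Omega>_def by (rule tensor_test_function[OF \<psi> c])
      have e_t: "e_t \<in> Basis" by (auto simp: Basis_prod_def)
      note pd = partial_deriv_tensor_t[OF c, of \<psi>]
      have "(LINT t|lborel. indicator {0<..<T} t * G t * partial_deriv 1 c t) =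
          (LINT t|lborel. LINT x|lborel. U (x, t) * partial_deriv e_t (\<lambda>p. \<psi> (fst p) * c (snd p)) (x, t))"
        unfolding G_eq pd by (simp add: mult.assoc flip: integral_mult_left_zero)
      also have "\<dots> = (LINT p|lborel. U p * partial_deriv e_t (\<lambda>p. \<psi> (fst p) * c (snd p)) p)"
        by (rule lborel_Fubini(2)[OF borel_L2_times_test_integrable[OF U_L2 partial_deriv_test_function[OF test e_t]], symmetric])
      also have "\<dots> = - (LINT p|lborel. Ut p * (\<psi> (fst p) * c (snd p)))"
        using w test by (simp add: borel_weak_deriv_def)
      also have "(LINT p|lborel. Ut p * (\<psi> (fst p) * c (snd p))) =
          (LINT t|lborel. LINT x|lborel. Ut (x, t) * (\<psi> x * c t))"
        using lborel_Fubini(2)[OF borel_L2_times_test_integrable[OF Ut test]] by simp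
      also have "\<dots> = (LINT t|lborel. H t * c t)"
        unfolding H_def by (simp add: mult.assoc flip: integral_mult_left_zero)
      finally show ?thesis .
    qed
    have H: "integrable lborel H" unfolding H_def using lborel_Fubini(4)[OF Ut\<psi>] by simp
    have "G s - G 0 = (LINT t|lborel. H t * indicator {0<..s} t)"
      by (rule weak_deriv_FTC[OF G_cont H weak]) (use s in auto)
    moreover have "G 0 = 0"
      unfolding G_def by (rule integral_eq_zero_AE, intro AE_I2) (simp add: init indicator_def)
    moreover have "G s = (LINT x|lborel. U (x, s) * \<psi> x)"
      using G_eq[of s] s by simp
    moreover have "(LINT t|lborel. H t * indicator {0<..s} t) = (LINT t|lborel. LINT x|lborel. P (x, t) * \<psi> x)"
    proof (rule integral_cong_AE)
      show "(\<lambda>t. LINT x|lborel. P (x, t) * \<psi> x) \<in> borel_measurable lborel"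
        using lborel_Fubini(4)[OF P\<psi>] by simp
      show "AE t in lborel. H t * indicator {0<..s} t = (LINT x|lborel. P (x, t) * \<psi> x)"
        using AE_lborel_singleton[of s]
      proof eventually_elim
        case (elim t)
        have "H t * indicator {0<..s} t = (LINT x|lborel. Ut (x, t) * \<psi> x * indicator {0<..s} t)"
          unfolding H_def by simp
        also have "\<dots> = (LINT x|lborel. P (x, t) * \<psi> x)"
          by (intro Bochner_Integration.integral_cong refl)
            (use elim UtD(4)[of _ t] in \<open>auto simp: P_def indicator_def\<close>)
        finally show ?case .
      qed
    qed (use H in auto)
    moreover have "(LINT t|lborel. LINT x|lborel. P (x, t) * \<psi> x) = (LINT x|lborel. (LINT t|lborel. P (x, t)) * \<psi> x)"
      using lborel_Fubini(1,2)[OF P\<psi>] by simp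
    ultimately have "(LINT x|lborel. U (x, s) * \<psi> x) = (LINT x|lborel. (LINT t|lborel. P (x, t)) * \<psi> x)"
      by simp
    moreover have "integrable lborel (\<lambda>x. U (x, s) * \<psi> x)"
      by (rule integrable_mult_bounded[OF Us _ C(1)]) simp
    moreover have "integrable lborel (\<lambda>x. (LINT t|lborel. P (x, t)) * \<psi> x)"
      by (rule integrable_mult_bounded[OF lborel_Fubini(3)[OF P] _ C(1)]) simp
    ultimately show "(LINT x|lborel. ?D x * \<psi> x) = 0"
      by (simp add: left_diff_distrib)
  qed
  then show ?thesis by eventually_elim (simp add: V)
qed

text \<open>The null set of positions at a fixed time depends on that time. Fubini for null sets
  exchanges the quantifiers, so that on almost every line x = const the identity holds for almost
  all t, which is the form usable in one-dimensional inequalities. Writing the indicator as that of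
  a planar set makes the predicate jointly measurable.\<close>

lemma time_FTC_AE:
  assumes w: "borel_weak_deriv (\<Omega> L T) [e_t] U Ut"
    and init: "\<And>x. x \<in> {0<..<L} \<Longrightarrow> u (x, 0) = 0"
  shows "AE x in lborel. AE t in lborel. t \<in> {0<..<T} \<longrightarrow>
    U (x, t) = (LINT s|lborel. indicator {..<t} s * Ut (x, s))"
proof -
  have [measurable]: "U \<in> borel_measurable (borel \<Otimes>\<^sub>M borel)" "Ut \<in> borel_measurable (borel \<Otimes>\<^sub>M borel)"
    using U_measurable w by (auto simp: borel_prod borel_weak_deriv_def borel_L2_def)
  have "AE t in lborel. AE x in lborel. t \<in> {0<..<T} \<longrightarrow>
      U (x, t) = (LINT s|lborel. indicator {(s, t). s < t} (s, t) * Ut (x, s))"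
  proof (rule AE_I2)
    fix t
    show "AE x in lborel. t \<in> {0<..<T} \<longrightarrow>
        U (x, t) = (LINT s|lborel. indicator {(s, t). s < t} (s, t) * Ut (x, s))"
    proof (cases "t \<in> {0<..<T}")
      case True
      from time_FTC[OF w init this] show ?thesis by (simp add: indicator_def)
    qed auto
  qed
  then have "AE x in lborel. AE t in lborel. t \<in> {0<..<T} \<longrightarrow>
      U (x, t) = (LINT s|lborel. indicator {(s, t). s < t} (s, t) * Ut (x, s))"
    by (subst lborel_pair.AE_commute) measurable
  then show ?thesis by (simp add: indicator_def)
qed

text \<open>Membership in \<open>H21_hat\<close> demands continuity up to the boundary.
  \<open>U\<close> may jump at t = 0 and t = T, but integration in time smooths this out; in the
  space direction it is the zero boundary values that make \<open>U\<close> continuous up to 0 and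
  L.\<close>

lemma time_prim_U_continuous:
  assumes bd: "\<And>t. t \<in> {0..T} \<Longrightarrow> u (0, t) = 0 \<and> u (L, t) = 0"
  shows "continuous_on ({0..L} \<times> {0..T}) (time_prim U)"
proof (rule continuous_on_sequentiallyI)
  fix p a assume p: "\<forall>n. p n \<in> {0..L} \<times> {0..T}" and a: "a \<in> {0..L} \<times> {0..T}" and pa: "p \<longlonglongrightarrow> a"
  obtain M where M: "M \<ge> 0" "\<And>p. \<bar>U p\<bar> \<le> M" using U_bounded by blast
  have x: "(\<lambda>n. fst (p n)) \<longlonglongrightarrow> fst a" and t: "(\<lambda>n. snd (p n)) \<longlonglongrightarrow> snd a"
    using pa by (auto intro: tendsto_intros)
  have U_closed: "U (x, s) = indicator {0<..<T} s * u (x, s)" if "x \<in> {0..L}" for x s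
    using that bd[of s] by (cases "x = 0 \<or> x = L") (auto simp: U_def \<Omega>_def indicator_def)
  have [measurable]: "(\<lambda>s. U (x, s)) \<in> borel_measurable borel" for x
    by (rule borel_measurable_slice[OF U_measurable])
  have "(\<lambda>n. LINT s|lborel. indicator {snd (p n)<..} s * (exp (- s) * U (fst (p n), s))) \<longlonglongrightarrow>
      (LINT s|lborel. indicator {snd a<..} s * (exp (- s) * U (fst a, s)))"
  proof (rule integral_dominated_convergence[where w = "\<lambda>s. M * indicator {0<..<T} s"])
    show "AE s in lborel. (\<lambda>n. indicator {snd (p n)<..} s * (exp (- s) * U (fst (p n), s))) \<longlonglongrightarrow>
        indicator {snd a<..} s * (exp (- s) * U (fst a, s))"
      using AE_lborel_singleton[of "snd a"]
    proof eventually_elim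
      case (elim s)
      have "(\<lambda>n. indicator {snd (p n)<..} s :: real) \<longlonglongrightarrow> indicator {snd a<..} s"
      proof (cases "s > snd a")
        case True
        then have "eventually (\<lambda>n. snd (p n) < s) sequentially" using t by (simp add: order_tendsto_iff)
        then have "eventually (\<lambda>n. indicator {snd (p n)<..} s = (indicator {snd a<..} s :: real)) sequentially"
          by eventually_elim (use True in simp)
        then show ?thesis by (rule tendsto_eventually)
      next
        case False
        then have "eventually (\<lambda>n. snd (p n) > s) sequentially" using t elim by (simp add: order_tendsto_iff)
        then have "eventually (\<lambda>n. indicator {snd (p n)<..} s = (indicator {snd a<..} s :: real)) sequentially"
          by eventually_elim (use False in simp)
        then show ?thesis by (rule tendsto_eventually)
      qed
      moreover have "(\<lambda>n. U (fst (p n), s)) \<longlonglongrightarrow> U (fst a, s)"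
      proof (cases "s \<in> {0<..<T}")
        case True
        have "(\<lambda>n. u (fst (p n), s)) \<longlonglongrightarrow> u (fst a, s)"
          using True p a
          by (intro continuous_on_tendsto_compose[OF cont] tendsto_intros x)
            (auto intro!: always_eventually simp: mem_Times_iff)
        moreover have "fst (p n) \<in> {0..L}" "fst a \<in> {0..L}" for n
          using p a by (auto simp: mem_Times_iff)
        ultimately show ?thesis using True by (simp add: U_closed)
      qed (auto simp: U_def \<Omega>_def)
      ultimately show ?case by (intro tendsto_intros)
    qed
    show "AE s in lborel. norm (indicator {snd (p n)<..} s * (exp (- s) * U (fst (p n), s))) \<le> M * indicator {0<..<T} s" for n
    proof (rule AE_I2)
      fix s
      show "norm (indicator {snd (p n)<..} s * (exp (- s) * U (fst (p n), s))) \<le> M * indicator {0<..<T} s"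
      proof (cases "s \<in> {0<..<T}")
        case True
        then have "\<bar>exp (- s) * U (fst (p n), s)\<bar> \<le> 1 * M"
          unfolding abs_mult by (intro mult_mono M) auto
        then show ?thesis using True M(1) by (auto simp: indicator_def)
      qed (auto simp: U_def \<Omega>_def)
    qed
  qed auto
  then show "(\<lambda>n. time_prim U (p n)) \<longlonglongrightarrow> time_prim U a"
    unfolding time_prim_def by (rule tendsto_minus)
qed

text \<open>The identity in the hypothesis is the weak formulation tested with \<open>time_prim U\<close>, whose time
  derivative is \<open>exp (- t) * U\<close>. Both terms on its left-hand side have a sign.\<close>

lemma energy_estimate:
  assumes Ut: "borel_weak_deriv (\<Omega> L T) [e_t] U Ut" and Uxx: "borel_L2 (\<Omega> L T) Uxx"
    and init: "\<And>x. x \<in> {0<..<L} \<Longrightarrow> u (x, 0) = 0"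
    and \<kappa>: "\<kappa> \<in> borel_measurable borel" "\<And>x. 0 \<le> \<kappa> x" "\<And>x. \<kappa> x \<le> C"
    and z: "borel_L2 {0<..<L} z"
    and id: "(LINT p|lborel. - Ut p * (U p * exp (- snd p)) + \<kappa> (fst p) * Uxx p * cut_prim T Uxx p) =
      (LINT x|lborel. z x * time_prim U (x, 0))"
  shows "(LINT p|lborel. (U p)\<^sup>2) \<le> 4 * T * exp T * (LINT x|lborel. (z x)\<^sup>2)"
proof -
  have Ut_L2: "borel_L2 (\<Omega> L T) Ut" using Ut by (simp add: borel_weak_deriv_def)
  note UtD = borel_L2_OmegaD[OF Ut_L2] and UD = borel_L2_OmegaD[OF U_L2] and UxxD = borel_L2_OmegaD[OF Uxx]
  have exp_meas: "(\<lambda>p::real\<times>real. exp (- snd p)) \<in> borel_measurable borel"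
    by (intro borel_measurable_continuous_onI continuous_intros)
  have e_le: "\<bar>exp (- snd p)\<bar> \<le> 1" if "p \<in> \<Omega> L T" for p using that by (auto simp: \<Omega>_def)
  have Ue: "borel_L2 (\<Omega> L T) (\<lambda>p. U p * exp (- snd p))"
    by (rule borel_L2_mult_bounded[OF U_L2 exp_meas e_le])
  have \<kappa>_fst: "(\<lambda>p::real\<times>real. \<kappa> (fst p)) \<in> borel_measurable borel"
    unfolding borel_prod[symmetric] using \<kappa>(1) by measurable
  have \<kappa>Uxx: "borel_L2 (\<Omega> L T) (\<lambda>p. Uxx p * \<kappa> (fst p))"
    using \<kappa>(2,3) by (intro borel_L2_mult_bounded[OF Uxx \<kappa>_fst, of C]) auto
  have iA: "integrable lborel (\<lambda>p. Ut p * (U p * exp (- snd p)))"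
    by (rule borel_L2_mult_integrable[OF Ut_L2 Ue])
  have iB: "integrable lborel (\<lambda>p. Uxx p * \<kappa> (fst p) * cut_prim T Uxx p)"
    by (rule borel_L2_mult_integrable[OF \<kappa>Uxx cut_prim_L2[OF T Uxx]])
  have iU: "integrable lborel (\<lambda>p. U p * (U p * exp (- snd p)))"
    by (rule borel_L2_mult_integrable[OF U_L2 Ue])

  have FTC: "AE x in lborel. AE t in lborel. t \<in> {0<..<T} \<longrightarrow>
      U (x, t) = (LINT s|lborel. indicator {..<t} s * Ut (x, s))"
    by (rule time_FTC_AE[OF Ut init])
  \<comment> \<open>On almost every line x = const, \<open>U\<close> is the primitive of
    \<open>Ut\<close>, so the weighted one-dimensional inequality applies and is then integrated in
    x.\<close>
  have A: "(LINT p|lborel. U p * (U p * exp (- snd p))) / 2 \<le> (LINT p|lborel. Ut p * (U p * exp (- snd p)))"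
  proof -
    have "(LINT p|lborel. U p * (U p * exp (- snd p))) / 2 =
        (LINT x|lborel. (LINT t|lborel. U (x, t) * (U (x, t) * exp (- t))) / 2)"
      using lborel_Fubini(1)[OF iU] by simp
    also have "\<dots> \<le> (LINT x|lborel. LINT t|lborel. Ut (x, t) * (U (x, t) * exp (- t)))"
    proof (rule integral_mono_AE)
      show "integrable lborel (\<lambda>x. (LINT t|lborel. U (x, t) * (U (x, t) * exp (- t))) / 2)"
        using lborel_Fubini(3)[OF iU] by simp
      show "integrable lborel (\<lambda>x. LINT t|lborel. Ut (x, t) * (U (x, t) * exp (- t)))"
        using lborel_Fubini(3)[OF iA] by simp
      show "AE x in lborel. (LINT t|lborel. U (x, t) * (U (x, t) * exp (- t))) / 2 \<le>
          (LINT t|lborel. Ut (x, t) * (U (x, t) * exp (- t)))"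
        using lborel_Fubini(5)[OF UtD(2)] FTC
      proof eventually_elim
        case (elim x)
        define G where "G = (\<lambda>t. LINT s|lborel. indicator {..<t} s * Ut (x, s))"
        have eq: "AE t in lborel. t \<in> {0<..<T} \<longrightarrow> U (x, t) = G t"
          using elim(2) by (simp add: G_def)
        note [measurable] = borel_measurable_slice[OF UtD(1), of x] borel_measurable_slice[OF UD(1), of x]
        have [measurable]: "G \<in> borel_measurable borel" unfolding G_def by measurable
        have "(LINT t|lborel. U (x, t) * (U (x, t) * exp (- t))) =
            (LINT t|lborel. indicator {0<..<T} t * (exp (- t) * (G t)\<^sup>2))"
        proof (rule integral_cong_AE)
          show "AE t in lborel. U (x, t) * (U (x, t) * exp (- t)) = indicator {0<..<T} t * (exp (- t) * (G t)\<^sup>2)"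
            using eq
          proof eventually_elim
            case (elim t)
            then show ?case
              using UD(4)[of x t] by (cases "t \<in> {0<..<T}") (auto simp: power2_eq_square)
          qed
        qed auto
        moreover have "(LINT t|lborel. Ut (x, t) * (U (x, t) * exp (- t))) =
            (LINT t|lborel. exp (- t) * Ut (x, t) * G t)"
        proof (rule integral_cong_AE)
          show "AE t in lborel. Ut (x, t) * (U (x, t) * exp (- t)) = exp (- t) * Ut (x, t) * G t"
            using eq
          proof eventually_elim
            case (elim t)
            then show ?case
              using UtD(4)[of x t] by (cases "t \<in> {0<..<T}") auto
          qed
        qed auto
        moreover have "(LINT t|lborel. indicator {0<..<T} t * (exp (- t) * (G t)\<^sup>2)) / 2 \<le>
            (LINT t|lborel. exp (- t) * Ut (x, t) * G t)"
          unfolding G_def by (rule exp_weighted_primitive_ge[OF elim(1)]) (use UtD(4) in auto)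
        ultimately show ?case by simp
      qed
    qed
    also have "\<dots> = (LINT p|lborel. Ut p * (U p * exp (- snd p)))"
      using lborel_Fubini(1)[OF iA] by simp
    finally show ?thesis .
  qed

  \<comment> \<open>\<open>\<kappa>\<close> is nonnegative and independent of time, so it leaves the
    time integral; the sign comes from the minus in \<open>time_prim\<close>.\<close>
  have B: "(LINT p|lborel. Uxx p * \<kappa> (fst p) * cut_prim T Uxx p) \<le> 0"
  proof -
    have "(LINT x|lborel. LINT t|lborel. Uxx (x, t) * \<kappa> x * cut_prim T Uxx (x, t)) \<le> (LINT x::real|lborel. 0)"
    proof (rule integral_mono_AE)
      show "integrable lborel (\<lambda>x. LINT t|lborel. Uxx (x, t) * \<kappa> x * cut_prim T Uxx (x, t))"
        using lborel_Fubini(3)[OF iB] by simp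
      have "borel_L2 (\<Omega> L T) (\<lambda>p. Uxx p * exp (- snd p))"
        by (rule borel_L2_mult_bounded[OF Uxx exp_meas e_le])
      from lborel_Fubini(5)[OF borel_L2_OmegaD(2)[OF this]]
      show "AE x in lborel. (LINT t|lborel. Uxx (x, t) * \<kappa> x * cut_prim T Uxx (x, t)) \<le> 0"
      proof eventually_elim
        case (elim x)
        define g where "g = (\<lambda>t. exp (- t) * Uxx (x, t))"
        have "(LINT t|lborel. Uxx (x, t) * \<kappa> x * cut_prim T Uxx (x, t)) =
            (LINT t|lborel. - \<kappa> x * (exp t * g t * (LINT s|lborel. indicator {t<..} s * g s)))"
        proof (intro Bochner_Integration.integral_cong refl)
          fix t
          have "exp t * g t = Uxx (x, t)" by (simp add: g_def exp_minus)
          then show "Uxx (x, t) * \<kappa> x * cut_prim T Uxx (x, t) =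
              - \<kappa> x * (exp t * g t * (LINT s|lborel. indicator {t<..} s * g s))"
            using UxxD(4)[of x t]
            by (cases "t \<in> {0<..<T}") (auto simp: cut_prim_def time_prim_def g_def)
        qed
        also have "\<dots> = - \<kappa> x * (LINT t|lborel. exp t * g t * (LINT s|lborel. indicator {t<..} s * g s))"
          by (rule integral_mult_right_zero)
        also have "\<dots> \<le> 0"
        proof -
          have "0 \<le> (LINT t|lborel. exp t * g t * (LINT s|lborel. indicator {t<..} s * g s))"
            by (rule exp_weighted_reversed_primitive_nonneg[where T = T])
              (use elim UxxD(4) in \<open>auto simp: g_def mult.commute\<close>)
          then show ?thesis using \<kappa>(2)[of x] by (simp add: mult_nonneg_nonneg)
        qed
        finally show ?case .
      qed
    qed simp
    then show ?thesis using lborel_Fubini(1)[OF iB] by simp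
  qed

  have z_int: "integrable lborel z"
    by (rule borel_L2_integrable[OF z]) (auto intro: bounded_subset[of "{0..L}"])
  have z_sq: "integrable lborel (\<lambda>x. (z x)\<^sup>2)" and z_meas [measurable]: "z \<in> borel_measurable borel"
    and z_supp: "\<And>x. x \<notin> {0<..<L} \<Longrightarrow> z x = 0"
    using z by (auto simp: borel_L2_def)
  have z_fst: "(\<lambda>p::real\<times>real. z (fst p)) \<in> borel_measurable borel"
    unfolding borel_prod[symmetric] by measurable
  \<comment> \<open>\<open>z\<close> is extended constantly in time, which turns the initial term
    into a space-time product with \<open>U\<close>. This extension is the origin of the factor
    \<open>T\<close>.\<close>
  have zz: "borel_L2 (\<Omega> L T) (\<lambda>p. z (fst p) * indicator {0<..<T} (snd p))"
    and zz_int: "(LINT p|lborel. (z (fst p) * indicator {0<..<T} (snd p))\<^sup>2) = T * (LINT x|lborel. (z x)\<^sup>2)"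
  proof -
    have sq: "(\<lambda>p. (z (fst p) * indicator {0<..<T} (snd p))\<^sup>2) =
        (\<lambda>p. (z (fst p))\<^sup>2 * indicator {0<..<T} (snd p))"
      by (auto simp: power_mult_distrib indicator_def)
    have int: "integrable lborel (\<lambda>p. (z (fst p))\<^sup>2 * indicator {0<..<T} (snd p))"
      using integrable_pair_mult[OF z_sq, of "indicator {0<..<T}" "\<lambda>_. 1" 1]
      by (simp add: lborel_prod case_prod_beta')
    have "(\<lambda>p::real\<times>real. z (fst p) * indicator {0<..<T} (snd p)) \<in> borel_measurable borel"
      unfolding borel_prod[symmetric] by measurable
    then show "borel_L2 (\<Omega> L T) (\<lambda>p. z (fst p) * indicator {0<..<T} (snd p))"
      using int z_supp unfolding borel_L2_def sq by (auto simp: \<Omega>_def indicator_def)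
    have "(LINT p|lborel. (z (fst p))\<^sup>2 * indicator {0<..<T} (snd p)) =
        (LINT x|lborel. LINT t|lborel. (z x)\<^sup>2 * indicator {0<..<T} t)"
      using lborel_Fubini(1)[OF int] by simp
    also have "\<dots> = T * (LINT x|lborel. (z x)\<^sup>2)"
      using T by (simp add: mult.commute)
    finally show "(LINT p|lborel. (z (fst p) * indicator {0<..<T} (snd p))\<^sup>2) = T * (LINT x|lborel. (z x)\<^sup>2)"
      unfolding sq .
  qed
  let ?R = "\<lambda>p. z (fst p) * indicator {0<..<T} (snd p) * (U p * exp (- snd p))"
  have iR: "integrable lborel ?R"
    by (rule borel_L2_mult_integrable[OF zz Ue])
  have R: "(LINT x|lborel. z x * time_prim U (x, 0)) = - (LINT p|lborel. ?R p)"
  proof -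
    have "(LINT x|lborel. z x * time_prim U (x, 0)) = (LINT x|lborel. - (LINT t|lborel. ?R (x, t)))"
    proof (intro Bochner_Integration.integral_cong refl)
      fix x
      have "(LINT t|lborel. ?R (x, t)) = (LINT t|lborel. z x * (indicator {0<..} t * (exp (- t) * U (x, t))))"
        by (intro Bochner_Integration.integral_cong refl) (use UD(4)[of x] in \<open>auto simp: indicator_def\<close>)
      also have "\<dots> = z x * (LINT t|lborel. indicator {0<..} t * (exp (- t) * U (x, t)))"
        by (rule integral_mult_right_zero)
      finally show "z x * time_prim U (x, 0) = - (LINT t|lborel. ?R (x, t))"
        by (simp add: time_prim_def)
    qed
    then show ?thesis using lborel_Fubini(1)[OF iR] by simp
  qed
  have "(LINT p|lborel. - Ut p * (U p * exp (- snd p)) + \<kappa> (fst p) * Uxx p * cut_prim T Uxx p) =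
      - (LINT p|lborel. Ut p * (U p * exp (- snd p))) + (LINT p|lborel. Uxx p * \<kappa> (fst p) * cut_prim T Uxx p)"
    using iA iB by (simp add: mult_ac)
  \<comment> \<open>With the three integrals called A, B and R, the hypothesis reads - A + B = - R.
    As B is nonpositive, A is at most R, and A dominates half of the weighted norm.\<close>
  with id R B A have half: "(LINT p|lborel. U p * (U p * exp (- snd p))) / 2 \<le> (LINT p|lborel. ?R p)"
    by linarith
  also have "(LINT p|lborel. ?R p) \<le> (LINT p|lborel. U p * (U p * exp (- snd p)) / 4 +
      (z (fst p) * indicator {0<..<T} (snd p))\<^sup>2)"
  proof (rule integral_mono[OF iR])
    show "integrable lborel (\<lambda>p. U p * (U p * exp (- snd p)) / 4 + (z (fst p) * indicator {0<..<T} (snd p))\<^sup>2)"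
      using iU zz by (auto simp: borel_L2_def)
    fix p :: "real \<times> real"
    show "?R p \<le> U p * (U p * exp (- snd p)) / 4 + (z (fst p) * indicator {0<..<T} (snd p))\<^sup>2"
    proof (cases "p \<in> \<Omega> L T")
      case True
      define a b e where "a = z (fst p) * indicator {0<..<T} (snd p)" "b = U p" "e = exp (- snd p)"
      have e: "0 \<le> e" "e \<le> 1" using e_le[OF True] by (auto simp: a_b_e_def)
      \<comment> \<open>Young's inequality, balanced so that a quarter of the weighted norm appears
        on the right. Subtracting it from the half on the left leaves a quarter, hence the constant
        4.\<close>
      have "0 \<le> e * (a - b / 2)\<^sup>2" using e by simp
      then have "a * (b * e) \<le> b * (b * e) / 4 + e * a\<^sup>2"
        by (simp add: power2_diff power2_eq_square algebra_simps)
      also have "e * a\<^sup>2 \<le> a\<^sup>2" using e by (simp add: mult_left_le_one_le)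
      finally show ?thesis by (simp add: a_b_e_def)
    qed (simp add: U_def)
  qed
  also have "\<dots> = (LINT p|lborel. U p * (U p * exp (- snd p))) / 4 + T * (LINT x|lborel. (z x)\<^sup>2)"
    using iU zz zz_int by (subst Bochner_Integration.integral_add) (auto simp: borel_L2_def)
  finally have le: "(LINT p|lborel. U p * (U p * exp (- snd p))) \<le> 4 * T * (LINT x|lborel. (z x)\<^sup>2)" by simp
  have "(LINT p|lborel. (U p)\<^sup>2) \<le> (LINT p|lborel. exp T * (U p * (U p * exp (- snd p))))"
  proof (rule integral_mono)
    show "integrable lborel (\<lambda>p. (U p)\<^sup>2)" by (rule UD(3))
    show "integrable lborel (\<lambda>p. exp T * (U p * (U p * exp (- snd p))))" using iU by simp
    fix p :: "real \<times> real"
    show "(U p)\<^sup>2 \<le> exp T * (U p * (U p * exp (- snd p)))"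
    proof (cases "p \<in> \<Omega> L T")
      case True
      \<comment> \<open>The weight is removed by exp (- t) \<ge> exp (- T) on the domain.\<close>
      then have "1 \<le> exp (T - snd p)" by (auto simp: \<Omega>_def)
      then have "(U p)\<^sup>2 * 1 \<le> (U p)\<^sup>2 * exp (T - snd p)" by (intro mult_left_mono) auto
      then show ?thesis by (simp add: exp_diff exp_minus power2_eq_square field_simps)
    qed (simp add: U_def)
  qed
  also have "\<dots> = exp T * (LINT p|lborel. U p * (U p * exp (- snd p)))" by simp
  also have "\<dots> \<le> exp T * (4 * T * (LINT x|lborel. (z x)\<^sup>2))" using le by (intro mult_left_mono) auto
  finally show ?thesis by (simp add: mult_ac)
qed

end

section \<open>Weak solutions\<close>

text \<open>The coefficient \<open>k\<close> is only Lebesgue measurable. Composition with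
  \<open>fst\<close> preserves this because the preimage of a null set of the line is a null strip
  in the plane.\<close>

lemma fst_measurable_lebesgue: "fst \<in> (lebesgue :: (real \<times> real) measure) \<rightarrow>\<^sub>M (lebesgue :: real measure)"
proof (rule completion.measurable_completion2)
  have fst_m: "fst \<in> (lborel :: (real \<times> real) measure) \<rightarrow>\<^sub>M (lborel :: real measure)"
    by (simp add: measurable_lborel1 flip: borel_prod)
  then show m: "fst \<in> (lebesgue :: (real \<times> real) measure) \<rightarrow>\<^sub>M (lborel :: real measure)"
    by (rule measurable_completion)
  show "null_sets (lborel :: real measure) \<subseteq> null_sets (distr (lebesgue :: (real \<times> real) measure) lborel fst)"
  proof
    fix N :: "real set" assume N: "N \<in> null_sets lborel"
    then have "AE x in lborel. x \<notin> N" by (rule AE_not_in)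
    from AE_completion[OF AE_lborel_fst[OF this]]
    have "AE x in distr (lebesgue :: (real \<times> real) measure) lborel fst. x \<notin> N"
      using N by (subst AE_distr_iff[OF m]) (auto dest: null_setsD2)
    moreover have "N \<in> sets (distr (lebesgue :: (real \<times> real) measure) lborel fst)"
      using null_setsD2[OF N] by simp
    ultimately show "N \<in> null_sets (distr (lebesgue :: (real \<times> real) measure) lborel fst)"
      by (simp add: AE_iff_null_sets del: sets_distr)
  qed
qed

lemma borel_measurable_fst_Omega:
  fixes g :: "real \<Rightarrow> real"
  assumes "g \<in> borel_measurable (lebesgue_on {0<..<L})"
  shows "(\<lambda>p. g (fst p)) \<in> borel_measurable (lebesgue_on (\<Omega> L T))"
proof -
  have "(\<lambda>x. indicator {0<..<L} x *\<^sub>R g x) \<in> borel_measurable lebesgue"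
    using assms by (subst (asm) borel_measurable_restrict_space_iff) auto
  from measurable_restrict_space1[OF measurable_compose[OF fst_measurable_lebesgue this], of "\<Omega> L T"]
  show ?thesis
    by (rule measurable_cong[THEN iffD1, rotated]) (auto simp: \<Omega>_def)
qed

lemma AE_fst_Omega:
  assumes "AE x in lebesgue_on {0<..<L}. P x"
  shows "AE p in lebesgue_on (\<Omega> L T). P (fst p)"
proof -
  have "AE x in lborel. x \<in> {0<..<L} \<longrightarrow> P x"
    using assms by (subst (asm) AE_lebesgue_on_iff) auto
  from AE_lborel_fst[OF this] show ?thesis
    by (subst AE_lebesgue_on_iff[OF Omega_borel]) (auto simp: \<Omega>_def elim!: eventually_mono)
qed

text \<open>The identity assumed in \<open>energy_estimate\<close> is an instance of the weak
  formulation once the time primitive is known to be admissible; what remains is the passage to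
  Borel representatives of all functions involved.\<close>

lemma weak_energy_estimate:
  assumes L: "L > 0" and T: "T > 0"
    and k: "k \<in> Linfty {0<..<L}" and k_pos: "AE x in lebesgue_on {0<..<L}. k x > 0"
    and d: "d \<in> H21_hat L T" and init: "\<And>x. x \<in> {0<..<L} \<Longrightarrow> d (x, 0) = 0"
    and dt: "has_weak_deriv (\<Omega> L T) [e_t] d d_t" and dxx: "has_weak_deriv (\<Omega> L T) [e_x, e_x] d d_xx"
    and z: "z \<in> L2 {0<..<L}"
    and weak: "\<And>\<eta> \<eta>_t \<eta>_xx. \<eta> \<in> H21_hat L T \<Longrightarrow> (\<And>x. x \<in> {0<..<L} \<Longrightarrow> \<eta> (x, T) = 0) \<Longrightarrow>
      has_weak_deriv (\<Omega> L T) [e_t] \<eta> \<eta>_t \<Longrightarrow> has_weak_deriv (\<Omega> L T) [e_x, e_x] \<eta> \<eta>_xx \<Longrightarrow>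
      (LINT p|lebesgue_on (\<Omega> L T). - d_t p * \<eta>_t p + k (fst p) * d_xx p * \<eta>_xx p) =
      (LINT x|lebesgue_on {0<..<L}. z x * \<eta> (x, 0))"
  shows "(LINT p|lebesgue_on (\<Omega> L T). (d p)\<^sup>2) \<le> 4 * T * exp T * (LINT x|lebesgue_on {0<..<L}. (z x)\<^sup>2)"
proof -
  have cont: "continuous_on ({0..L} \<times> {0..T}) d"
    and bd: "\<And>t. t \<in> {0..T} \<Longrightarrow> d (0, t) = 0 \<and> d (L, t) = 0"
    using d by (auto simp: H21_hat_def H21_def)
  obtain d_x where dx: "has_weak_deriv (\<Omega> L T) [e_x] d d_x"
    using d by (auto simp: H21_hat_def H21_def)
  interpret space_time_function L T d
    using L T cont by unfold_locales
  have e: "set [e_t] \<subseteq> Basis" "set [e_x] \<subseteq> Basis" "set [e_x, e_x] \<subseteq> Basis"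
    by (auto simp: Basis_prod_def)
  have meas: "g \<in> borel_measurable (lebesgue_on (\<Omega> L T))" if "has_weak_deriv (\<Omega> L T) bs f g" for bs f g
    using that by (auto simp: has_weak_deriv_def L2_def)
  obtain Ut where Ut: "borel_rep (\<Omega> L T) d_t Ut" using borel_rep_exists[OF Omega_borel meas[OF dt]] by blast
  obtain Ux where Ux: "borel_rep (\<Omega> L T) d_x Ux" using borel_rep_exists[OF Omega_borel meas[OF dx]] by blast
  obtain Uxx where Uxx: "borel_rep (\<Omega> L T) d_xx Uxx" using borel_rep_exists[OF Omega_borel meas[OF dxx]] by blast
  have wt: "borel_weak_deriv (\<Omega> L T) [e_t] U Ut"
    by (rule has_weak_deriv_imp_borel[OF Omega_borel e(1) U_rep Ut dt])
  have wx: "borel_weak_deriv (\<Omega> L T) [e_x] U Ux"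
    by (rule has_weak_deriv_imp_borel[OF Omega_borel e(2) U_rep Ux dx])
  have wxx: "borel_weak_deriv (\<Omega> L T) [e_x, e_x] U Uxx"
    by (rule has_weak_deriv_imp_borel[OF Omega_borel e(3) U_rep Uxx dxx])
  have Uxx_L2: "borel_L2 (\<Omega> L T) Uxx" using wxx by (simp add: borel_weak_deriv_def)

  let ?\<eta> = "time_prim U" and ?\<eta>_t = "\<lambda>p. U p * exp (- snd p)"
  \<comment> \<open>Weak derivatives are known for \<open>cut_prim\<close>, continuity up to the
    boundary for \<open>time_prim\<close>. The two agree on the open domain, and weak derivatives
    see nothing else.\<close>
  have \<eta>_eq: "cut_prim T f p = time_prim f p" if "p \<in> \<Omega> L T" for f p
    using that by (auto simp: cut_prim_def \<Omega>_def indicator_def)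
  have \<eta>_t: "has_weak_deriv (\<Omega> L T) [e_t] ?\<eta> ?\<eta>_t"
    by (rule has_weak_deriv_cong[OF Omega_borel \<eta>_eq has_weak_derivI_borel[OF Omega_borel e(1)
          time_prim_weak_deriv_t[OF T U_L2]]])
  have \<eta>_x: "has_weak_deriv (\<Omega> L T) [e_x] ?\<eta> (cut_prim T Ux)"
    using time_prim_weak_deriv_x[OF T, of L 1 U Ux] wx
    by (intro has_weak_deriv_cong[OF Omega_borel \<eta>_eq has_weak_derivI_borel[OF Omega_borel e(2)]]) simp_all
  have \<eta>_xx: "has_weak_deriv (\<Omega> L T) [e_x, e_x] ?\<eta> (cut_prim T Uxx)"
    using time_prim_weak_deriv_x[OF T, of L 2 U Uxx] wxx
    by (intro has_weak_deriv_cong[OF Omega_borel \<eta>_eq has_weak_derivI_borel[OF Omega_borel e(3)]])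
      (simp_all add: numeral_2_eq_2)
  have U_0: "U (x, s) = 0" if "x \<notin> {0<..<L} \<or> s \<notin> {0<..<T}" for x s
    using that by (auto simp: U_def \<Omega>_def)
  have \<eta>_hat: "?\<eta> \<in> H21_hat L T"
    unfolding H21_hat_def H21_def
    using time_prim_U_continuous[OF bd] \<eta>_t \<eta>_x \<eta>_xx U_0
    by (auto simp: has_weak_deriv_def[of _ "[e_t]"] time_prim_def)
  have \<eta>_T: "?\<eta> (x, T) = 0" for x
  proof -
    have "(LINT s|lborel. indicator {T<..} s * (exp (- s) * U (x, s))) = (LINT s::real|lborel. 0)"
      by (intro Bochner_Integration.integral_cong refl) (use U_0 in \<open>auto simp: indicator_def\<close>)
    then show ?thesis by (simp add: time_prim_def)
  qed

  obtain C where k_meas: "k \<in> borel_measurable (lebesgue_on {0<..<L})"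
    and k_le: "AE x in lebesgue_on {0<..<L}. \<bar>k x\<bar> \<le> C"
    using k by (auto simp: Linfty_def)
  obtain \<kappa>0 where \<kappa>0: "borel_rep {0<..<L} k \<kappa>0" using borel_rep_exists[OF _ k_meas] by auto
  \<comment> \<open>Clipping turns the almost everywhere bounds on \<open>k\<close> into bounds at
    every point; \<open>max C 0\<close> keeps the upper bound compatible with 0 whatever the sign of
    \<open>C\<close>.\<close>
  define \<kappa> where "\<kappa> = (\<lambda>x. max 0 (min (max C 0) (\<kappa>0 x)))"
  have \<kappa>: "\<kappa> \<in> borel_measurable borel" "\<And>x. 0 \<le> \<kappa> x" "\<And>x. \<kappa> x \<le> max C 0"
    using borel_repD(2)[OF \<kappa>0] by (auto simp: \<kappa>_def)
  have "AE x in lebesgue_on {0<..<L}. k x = \<kappa> x"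
    using borel_repD(4)[OF \<kappa>0] k_le k_pos by eventually_elim (auto simp: \<kappa>_def)
  from AE_fst_Omega[OF this] have k_eq: "AE p in lebesgue_on (\<Omega> L T). k (fst p) = \<kappa> (fst p)" .
  have k_rep: "borel_rep (\<Omega> L T) (\<lambda>p. k (fst p)) (\<lambda>p. indicator (\<Omega> L T) p * \<kappa> (fst p))"
  proof -
    have "(\<lambda>p::real\<times>real. \<kappa> (fst p)) \<in> borel_measurable borel"
      unfolding borel_prod[symmetric] using \<kappa>(1) by measurable
    moreover have "AE p in lebesgue_on (\<Omega> L T). p \<in> \<Omega> L T" by (rule AE_I2) simp
    ultimately show ?thesis
      using borel_measurable_fst_Omega[OF k_meas] k_eq
      by (auto simp: borel_rep_def elim!: eventually_elim2)
  qed

  obtain Z where Z: "borel_rep {0<..<L} z Z"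
    using borel_rep_exists[of "{0<..<L}" z] z by (auto simp: L2_def)
  have Z_L2: "borel_L2 {0<..<L} Z" by (rule L2_borel_rep[OF _ z Z]) simp

  have \<eta>t_rep: "borel_rep (\<Omega> L T) ?\<eta>_t ?\<eta>_t" and \<eta>xx_rep: "borel_rep (\<Omega> L T) (cut_prim T Uxx) (cut_prim T Uxx)"
    using time_prim_weak_deriv_t[OF T U_L2] cut_prim_L2[OF T Uxx_L2]
    by (auto simp: borel_weak_deriv_def borel_L2_def intro!: borel_rep_refl)
  have "(LINT p|lborel. - Ut p * ?\<eta>_t p + indicator (\<Omega> L T) p * \<kappa> (fst p) * Uxx p * cut_prim T Uxx p) =
      (LINT p|lebesgue_on (\<Omega> L T). - d_t p * ?\<eta>_t p + k (fst p) * d_xx p * cut_prim T Uxx p)"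
    by (intro borel_rep_integral(1)[OF Omega_borel, symmetric] borel_rep_add borel_rep_mult borel_rep_uminus
        Ut \<eta>t_rep k_rep Uxx \<eta>xx_rep)
  also have "\<dots> = (LINT x|lebesgue_on {0<..<L}. z x * ?\<eta> (x, 0))"
    by (rule weak[OF \<eta>_hat \<eta>_T \<eta>_t \<eta>_xx])
  also have "\<dots> = (LINT x|lborel. Z x * ?\<eta> (x, 0))"
    using borel_measurable_slice(2)[OF time_prim_measurable[OF U_measurable]]
    by (intro borel_rep_integral(1) borel_rep_mult_borel[OF Z]) auto
  \<comment> \<open>The indicator disappears because \<open>Uxx\<close> vanishes outside the
    domain.\<close>
  also have "(\<lambda>p. - Ut p * ?\<eta>_t p + indicator (\<Omega> L T) p * \<kappa> (fst p) * Uxx p * cut_prim T Uxx p) =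
      (\<lambda>p. - Ut p * ?\<eta>_t p + \<kappa> (fst p) * Uxx p * cut_prim T Uxx p)"
    using borel_repD(3)[OF Uxx] by (auto simp: indicator_def fun_eq_iff)
  finally have "(LINT p|lborel. (U p)\<^sup>2) \<le> 4 * T * exp T * (LINT x|lborel. (Z x)\<^sup>2)"
    by (intro energy_estimate[OF wt Uxx_L2 init \<kappa> Z_L2])
  then show ?thesis
    using borel_rep_integral(1)[OF Omega_borel borel_rep_mult[OF U_rep U_rep]]
      borel_rep_integral(1)[OF _ borel_rep_mult[OF Z Z]]
    by (simp add: power2_eq_square)
qed

section \<open>Linear structure of \<open>L2\<close>, weak derivatives and
  \<open>H21_hat\<close>\<close>

lemma L2_cmult: "f \<in> L2 S \<Longrightarrow> (\<lambda>x. c * f x) \<in> L2 S"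
  by (auto simp: L2_def power_mult_distrib)

lemma L2_mult_integrable:
  assumes "f \<in> L2 S" "g \<in> L2 S"
  shows "integrable (lebesgue_on S) (\<lambda>x. f x * g x)"
proof (rule Bochner_Integration.integrable_bound[where f = "\<lambda>x. (f x)\<^sup>2 + (g x)\<^sup>2"])
  show "AE x in lebesgue_on S. norm (f x * g x) \<le> norm ((f x)\<^sup>2 + (g x)\<^sup>2)"
    using abs_mult_le_sum_squares by (intro AE_I2) simp
qed (use assms in \<open>auto simp: L2_def\<close>)

lemma L2_add:
  assumes "f \<in> L2 S" "g \<in> L2 S"
  shows "(\<lambda>x. f x + g x) \<in> L2 S"
proof -
  have "(\<lambda>x. (f x + g x)\<^sup>2) = (\<lambda>x. (f x)\<^sup>2 + (g x)\<^sup>2 + 2 * (f x * g x))"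
    by (auto simp: power2_sum)
  then have "integrable (lebesgue_on S) (\<lambda>x. (f x + g x)\<^sup>2)"
    using L2_mult_integrable[OF assms] assms by (simp add: L2_def)
  then show ?thesis using assms by (auto simp: L2_def)
qed

lemma L2_diff: "f \<in> L2 S \<Longrightarrow> g \<in> L2 S \<Longrightarrow> (\<lambda>x. f x - g x) \<in> L2 S"
  using L2_add[of f S "\<lambda>x. - 1 * g x"] L2_cmult[of g S "- 1"] by simp

lemma L2_mult_Linfty:
  assumes f: "f \<in> L2 S" and h: "h \<in> borel_measurable (lebesgue_on S)" "AE x in lebesgue_on S. \<bar>h x\<bar> \<le> C"
  shows "(\<lambda>x. h x * f x) \<in> L2 S"
proof -
  have "integrable (lebesgue_on S) (\<lambda>x. (h x * f x)\<^sup>2)"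
  proof (rule Bochner_Integration.integrable_bound[where f = "\<lambda>x. C\<^sup>2 * (f x)\<^sup>2"])
    show "AE x in lebesgue_on S. norm ((h x * f x)\<^sup>2) \<le> norm (C\<^sup>2 * (f x)\<^sup>2)"
      using h(2)
    proof eventually_elim
      case (elim x)
      then have "(h x)\<^sup>2 \<le> C\<^sup>2" by (simp add: abs_le_square_iff[symmetric])
      then show ?case by (simp add: power_mult_distrib mult_right_mono)
    qed
  qed (use f h in \<open>auto simp: L2_def\<close>)
  then show ?thesis using f h by (auto simp: L2_def)
qed

lemma test_functions_L2:
  assumes S: "S \<in> sets borel" and \<phi>: "\<phi> \<in> test_functions S"
  shows "\<phi> \<in> L2 S"
proof (rule borel_L2_imp_L2[OF S])
  obtain K where K: "compact K" "K \<subseteq> S" "\<And>x. x \<notin> K \<Longrightarrow> \<phi> x = 0"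
    using test_functions_support[OF \<phi>] by metis
  obtain C where C: "\<And>x. \<bar>\<phi> x\<bar> \<le> C" "C \<ge> 0" using test_functions_bounded[OF \<phi>] by blast
  have "integrable lborel (\<lambda>x. (\<phi> x)\<^sup>2)"
  proof (rule Bochner_Integration.integrable_bound[of _ "\<lambda>x. C\<^sup>2 * indicator K x"])
    show "integrable lborel (\<lambda>x. C\<^sup>2 * indicator K x)"
      using K(1) emeasure_bounded_finite[OF compact_imp_bounded[OF K(1)]]
      by (intro integrable_mult_right integrable_real_indicator) (auto intro: borel_compact)
    show "AE x in lborel. norm ((\<phi> x)\<^sup>2) \<le> norm (C\<^sup>2 * indicator K x)"
    proof (rule AE_I2)
      fix x show "norm ((\<phi> x)\<^sup>2) \<le> norm (C\<^sup>2 * indicator K x)"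
        using C(1)[of x] C(2) K(3)[of x] by (cases "x \<in> K") (auto simp: abs_le_square_iff[symmetric])
    qed
  qed (use test_functions_measurable[OF \<phi>] in auto)
  then show "borel_L2 S \<phi>"
    using test_functions_measurable[OF \<phi>] test_functionsD(2)[OF \<phi>] by (auto simp: borel_L2_def)
qed

lemma has_weak_deriv_cmult:
  "has_weak_deriv S bs f g \<Longrightarrow> has_weak_deriv S bs (\<lambda>x. c * f x) (\<lambda>x. c * g x)"
  by (auto simp: has_weak_deriv_def mult.assoc intro: L2_cmult)

text \<open>Splitting the integrals requires each product to be integrable, which holds because test
  functions and their derivatives lie in \<open>L2\<close>.\<close>

lemma has_weak_deriv_add:
  assumes S: "S \<in> sets borel" and bs: "set bs \<subseteq> Basis"
    and w: "has_weak_deriv S bs f g" and w': "has_weak_deriv S bs f' g'"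
  shows "has_weak_deriv S bs (\<lambda>x. f x + f' x) (\<lambda>x. g x + g' x)"
proof -
  have L2: "f \<in> L2 S" "f' \<in> L2 S" "g \<in> L2 S" "g' \<in> L2 S" using w w' by (auto simp: has_weak_deriv_def)
  have *: "(LINT x|lebesgue_on S. (h x + h' x) * \<phi> x) =
      (LINT x|lebesgue_on S. h x * \<phi> x) + (LINT x|lebesgue_on S. h' x * \<phi> x)"
    if "\<phi> \<in> test_functions S" "h \<in> L2 S" "h' \<in> L2 S" for \<phi> h h'
    unfolding distrib_right
    by (intro Bochner_Integration.integral_add L2_mult_integrable test_functions_L2[OF S] that)
  show ?thesis
    using w w' L2 *[OF foldr_partial_deriv_test_function[OF _ bs] L2(1,2)] *[OF _ L2(3,4)]
    by (auto simp: has_weak_deriv_def distrib_left intro: L2_add)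
qed

lemma H21_hat_add:
  assumes f: "f \<in> H21_hat L T" and g: "g \<in> H21_hat L T"
  shows "(\<lambda>p. f p + g p) \<in> H21_hat L T"
proof -
  obtain f_t f_x f_xx where wf: "has_weak_deriv (\<Omega> L T) [e_t] f f_t"
    "has_weak_deriv (\<Omega> L T) [e_x] f f_x" "has_weak_deriv (\<Omega> L T) [e_x, e_x] f f_xx"
    using f by (auto simp: H21_hat_def H21_def)
  obtain g_t g_x g_xx where wg: "has_weak_deriv (\<Omega> L T) [e_t] g g_t"
    "has_weak_deriv (\<Omega> L T) [e_x] g g_x" "has_weak_deriv (\<Omega> L T) [e_x, e_x] g g_xx"
    using g by (auto simp: H21_hat_def H21_def)
  have "\<exists>h. has_weak_deriv (\<Omega> L T) [e_t] (\<lambda>p. f p + g p) h" "\<exists>h. has_weak_deriv (\<Omega> L T) [e_x] (\<lambda>p. f p + g p) h"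
    "\<exists>h. has_weak_deriv (\<Omega> L T) [e_x, e_x] (\<lambda>p. f p + g p) h"
    using has_weak_deriv_add[OF Omega_borel _ wf(1) wg(1)] has_weak_deriv_add[OF Omega_borel _ wf(2) wg(2)]
      has_weak_deriv_add[OF Omega_borel _ wf(3) wg(3)]
    by (auto simp: Basis_prod_def)
  then show ?thesis
    using f g by (auto simp: H21_hat_def H21_def intro!: continuous_intros L2_add)
qed

lemma H21_hat_cmult:
  assumes f: "f \<in> H21_hat L T"
  shows "(\<lambda>p. c * f p) \<in> H21_hat L T"
proof -
  obtain f_t f_x f_xx where wf: "has_weak_deriv (\<Omega> L T) [e_t] f f_t"
    "has_weak_deriv (\<Omega> L T) [e_x] f f_x" "has_weak_deriv (\<Omega> L T) [e_x, e_x] f f_xx"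
    using f by (auto simp: H21_hat_def H21_def)
  then have "\<exists>h. has_weak_deriv (\<Omega> L T) [e_t] (\<lambda>p. c * f p) h" "\<exists>h. has_weak_deriv (\<Omega> L T) [e_x] (\<lambda>p. c * f p) h"
    "\<exists>h. has_weak_deriv (\<Omega> L T) [e_x, e_x] (\<lambda>p. c * f p) h"
    using has_weak_deriv_cmult by blast+
  then show ?thesis
    using f by (auto simp: H21_hat_def H21_def intro!: continuous_intros L2_cmult)
qed

text \<open>Because a + b = 1, initial position and load cancel in the difference, which thus solves
  the homogeneous problem with the corresponding difference of velocities. One statement covers the
  Lipschitz bound (a = 1, b = 0) and affinity (\<open>v0\<close> equal to the combination, so that
  the right side is 0).\<close>

lemma weak_solution_affine_estimate:
  assumes L: "L > 0" and T: "T > 0"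
    and k: "k \<in> Linfty {0<..<L}" and k_pos: "AE x in lebesgue_on {0<..<L}. k x > 0"
    and F: "F \<in> L2 (\<Omega> L T)" and ab: "a + b = (1::real)"
    and v: "v0 \<in> L2 {0<..<L}" "v1 \<in> L2 {0<..<L}" "v2 \<in> L2 {0<..<L}"
    and s0: "weak_solution L T k w v0 F u0" and s1: "weak_solution L T k w v1 F u1"
    and s2: "weak_solution L T k w v2 F u2"
  shows "(LINT p|lebesgue_on (\<Omega> L T). (u0 p - (a * u1 p + b * u2 p))\<^sup>2) \<le>
    4 * T * exp T * (LINT x|lebesgue_on {0<..<L}. (v0 x - (a * v1 x + b * v2 x))\<^sup>2)"
proof -
  \<comment> \<open>Subtraction is written with negative scalars so that closure under sums and
    multiples applies directly.\<close>
  define d where "d = (\<lambda>p. u0 p + (- a * u1 p + - b * u2 p))"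
  define z where "z = (\<lambda>x. v0 x + (- a * v1 x + - b * v2 x))"
  note s = s0[unfolded weak_solution_def] s1[unfolded weak_solution_def] s2[unfolded weak_solution_def]
  have u: "u0 \<in> H21_hat L T" "u1 \<in> H21_hat L T" "u2 \<in> H21_hat L T" using s by auto
  obtain t0 x0 where D0: "has_weak_deriv (\<Omega> L T) [e_t] u0 t0" "has_weak_deriv (\<Omega> L T) [e_x, e_x] u0 x0"
    and E0: "\<And>\<eta> \<eta>_t \<eta>_xx. \<eta> \<in> H21_hat L T \<Longrightarrow> (\<forall>x\<in>{0<..<L}. \<eta> (x, T) = 0) \<Longrightarrow>
          has_weak_deriv (\<Omega> L T) [e_t] \<eta> \<eta>_t \<Longrightarrow> has_weak_deriv (\<Omega> L T) [e_x, e_x] \<eta> \<eta>_xx \<Longrightarrow>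
          (LINT p|lebesgue_on (\<Omega> L T). - t0 p * \<eta>_t p + k (fst p) * x0 p * \<eta>_xx p) =
          (LINT p|lebesgue_on (\<Omega> L T). \<eta> p * F p) + (LINT x|lebesgue_on {0<..<L}. v0 x * \<eta> (x, 0))"
    using s(1) by blast
  obtain t1 x1 where D1: "has_weak_deriv (\<Omega> L T) [e_t] u1 t1" "has_weak_deriv (\<Omega> L T) [e_x, e_x] u1 x1"
    and E1: "\<And>\<eta> \<eta>_t \<eta>_xx. \<eta> \<in> H21_hat L T \<Longrightarrow> (\<forall>x\<in>{0<..<L}. \<eta> (x, T) = 0) \<Longrightarrow>
          has_weak_deriv (\<Omega> L T) [e_t] \<eta> \<eta>_t \<Longrightarrow> has_weak_deriv (\<Omega> L T) [e_x, e_x] \<eta> \<eta>_xx \<Longrightarrow>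
          (LINT p|lebesgue_on (\<Omega> L T). - t1 p * \<eta>_t p + k (fst p) * x1 p * \<eta>_xx p) =
          (LINT p|lebesgue_on (\<Omega> L T). \<eta> p * F p) + (LINT x|lebesgue_on {0<..<L}. v1 x * \<eta> (x, 0))"
    using s(2) by blast
  obtain t2 x2 where D2: "has_weak_deriv (\<Omega> L T) [e_t] u2 t2" "has_weak_deriv (\<Omega> L T) [e_x, e_x] u2 x2"
    and E2: "\<And>\<eta> \<eta>_t \<eta>_xx. \<eta> \<in> H21_hat L T \<Longrightarrow> (\<forall>x\<in>{0<..<L}. \<eta> (x, T) = 0) \<Longrightarrow>
          has_weak_deriv (\<Omega> L T) [e_t] \<eta> \<eta>_t \<Longrightarrow> has_weak_deriv (\<Omega> L T) [e_x, e_x] \<eta> \<eta>_xx \<Longrightarrow>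
          (LINT p|lebesgue_on (\<Omega> L T). - t2 p * \<eta>_t p + k (fst p) * x2 p * \<eta>_xx p) =
          (LINT p|lebesgue_on (\<Omega> L T). \<eta> p * F p) + (LINT x|lebesgue_on {0<..<L}. v2 x * \<eta> (x, 0))"
    using s(3) by blast
  define d_t where "d_t = (\<lambda>p. t0 p + (- a * t1 p + - b * t2 p))"
  define d_xx where "d_xx = (\<lambda>p. x0 p + (- a * x1 p + - b * x2 p))"
  obtain C where k_meas: "k \<in> borel_measurable (lebesgue_on {0<..<L})"
    and k_le: "AE x in lebesgue_on {0<..<L}. \<bar>k x\<bar> \<le> C"
    using k by (auto simp: Linfty_def)
  have kL2: "(\<lambda>p. k (fst p) * f p) \<in> L2 (\<Omega> L T)" if "f \<in> L2 (\<Omega> L T)" for f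
    by (rule L2_mult_Linfty[OF that borel_measurable_fst_Omega[OF k_meas] AE_fst_Omega[OF k_le]])
  have "(LINT p|lebesgue_on (\<Omega> L T). (d p)\<^sup>2) \<le> 4 * T * exp T * (LINT x|lebesgue_on {0<..<L}. (z x)\<^sup>2)"
  proof (rule weak_energy_estimate[OF L T k k_pos])
    show "d \<in> H21_hat L T" unfolding d_def by (intro H21_hat_add H21_hat_cmult u)
    show "z \<in> L2 {0<..<L}" unfolding z_def by (intro L2_add L2_cmult v)
    show "has_weak_deriv (\<Omega> L T) [e_t] d d_t"
      unfolding d_def d_t_def
      by (intro has_weak_deriv_add has_weak_deriv_cmult D0 D1 D2 Omega_borel) (auto simp: Basis_prod_def)
    show "has_weak_deriv (\<Omega> L T) [e_x, e_x] d d_xx"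
      unfolding d_def d_xx_def
      by (intro has_weak_deriv_add has_weak_deriv_cmult D0 D1 D2 Omega_borel) (auto simp: Basis_prod_def)
    show "d (x, 0) = 0" if "x \<in> {0<..<L}" for x
    proof -
      have "d (x, 0) = (1 - (a + b)) * w x" using s that by (auto simp: d_def algebra_simps)
      then show ?thesis using ab by simp
    qed
    fix \<eta> \<eta>_t \<eta>_xx
    assume \<eta>: "\<eta> \<in> H21_hat L T" "\<And>x. x \<in> {0<..<L} \<Longrightarrow> \<eta> (x, T) = 0"
      "has_weak_deriv (\<Omega> L T) [e_t] \<eta> \<eta>_t" "has_weak_deriv (\<Omega> L T) [e_x, e_x] \<eta> \<eta>_xx"
    then have \<eta>T: "\<forall>x\<in>{0<..<L}. \<eta> (x, T) = 0" by blast
    have L2s: "t0 \<in> L2 (\<Omega> L T)" "t1 \<in> L2 (\<Omega> L T)" "t2 \<in> L2 (\<Omega> L T)"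
      "x0 \<in> L2 (\<Omega> L T)" "x1 \<in> L2 (\<Omega> L T)" "x2 \<in> L2 (\<Omega> L T)" "\<eta>_t \<in> L2 (\<Omega> L T)" "\<eta>_xx \<in> L2 (\<Omega> L T)"
      using D0 D1 D2 \<eta>(3,4) by (auto simp: has_weak_deriv_def)
    have int: "integrable (lebesgue_on (\<Omega> L T)) (\<lambda>p. - t p * \<eta>_t p + k (fst p) * x p * \<eta>_xx p)"
      if "t \<in> L2 (\<Omega> L T)" "x \<in> L2 (\<Omega> L T)" for t x
      using L2_mult_integrable[OF that(1) L2s(7)] L2_mult_integrable[OF kL2[OF that(2)] L2s(8)] by simp
    \<comment> \<open>The trace of the test function at t = 0 is continuous, hence bounded, which
      makes the three velocity integrals finite so that they can be combined.\<close>
    have \<eta>0: "(\<lambda>x. \<eta> (x, 0)) \<in> L2 {0<..<L}"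
    proof -
      have cont: "continuous_on ({0..L} \<times> {0..T}) \<eta>" using \<eta>(1) by (auto simp: H21_hat_def H21_def)
      have c0: "continuous_on {0..L} (\<lambda>x. \<eta> (x, 0))"
        using T by (intro continuous_on_compose2[OF cont]) (auto intro!: continuous_intros)
      obtain M where M: "M \<ge> 0" "\<And>x. x \<in> {0..L} \<Longrightarrow> \<bar>\<eta> (x, 0)\<bar> \<le> M"
        using continuous_compact_bounded[OF c0] by auto
      have m: "(\<lambda>x. indicator {0<..<L} x * \<eta> (x, 0)) \<in> borel_measurable borel"
        using borel_measurable_continuous_on_indicator[of "{0<..<L}" "\<lambda>x. \<eta> (x, 0)"]
          continuous_on_subset[OF c0, of "{0<..<L}"] by (simp add: greaterThanLessThan_subseteq_atLeastAtMost_iff)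
      have "integrable lborel (\<lambda>x. (indicator {0<..<L} x * \<eta> (x, 0))\<^sup>2)"
      proof (rule Bochner_Integration.integrable_bound[of _ "\<lambda>x. M\<^sup>2 * indicator {0<..<L} x"])
        show "AE x in lborel. norm ((indicator {0<..<L} x * \<eta> (x, 0))\<^sup>2) \<le> norm (M\<^sup>2 * indicator {0<..<L} x)"
        proof (rule AE_I2)
          fix x show "norm ((indicator {0<..<L} x * \<eta> (x, 0))\<^sup>2) \<le> norm (M\<^sup>2 * indicator {0<..<L} x)"
            using M(1) M(2)[of x] by (cases "x \<in> {0<..<L}") (auto simp: abs_le_square_iff[symmetric])
        qed
      qed (use m in auto)
      then have "borel_L2 {0<..<L} (\<lambda>x. indicator {0<..<L} x * \<eta> (x, 0))"
        using m by (auto simp: borel_L2_def)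
      from borel_L2_imp_L2[OF _ this] show ?thesis
        by (subst L2_cong[where g = "\<lambda>x. indicator {0<..<L} x * \<eta> (x, 0)"]) auto
    qed
    note iv = L2_mult_integrable[OF v(1) \<eta>0] L2_mult_integrable[OF v(2) \<eta>0] L2_mult_integrable[OF v(3) \<eta>0]
    let ?I = "\<lambda>t x. LINT p|lebesgue_on (\<Omega> L T). - t p * \<eta>_t p + k (fst p) * x p * \<eta>_xx p"
    have "?I d_t d_xx = (LINT p|lebesgue_on (\<Omega> L T). (- t0 p * \<eta>_t p + k (fst p) * x0 p * \<eta>_xx p) -
        (a * (- t1 p * \<eta>_t p + k (fst p) * x1 p * \<eta>_xx p) + b * (- t2 p * \<eta>_t p + k (fst p) * x2 p * \<eta>_xx p)))"
      by (intro Bochner_Integration.integral_cong refl) (simp add: d_t_def d_xx_def algebra_simps)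
    also have "\<dots> = ?I t0 x0 - (a * ?I t1 x1 + b * ?I t2 x2)"
      using int[OF L2s(1,4)] int[OF L2s(2,5)] int[OF L2s(3,6)] by simp
    also have "\<dots> = (1 - (a + b)) * (LINT p|lebesgue_on (\<Omega> L T). \<eta> p * F p) +
        ((LINT x|lebesgue_on {0<..<L}. v0 x * \<eta> (x, 0)) - (a * (LINT x|lebesgue_on {0<..<L}. v1 x * \<eta> (x, 0)) +
          b * (LINT x|lebesgue_on {0<..<L}. v2 x * \<eta> (x, 0))))"
      unfolding E0[OF \<eta>(1) \<eta>T \<eta>(3,4)] E1[OF \<eta>(1) \<eta>T \<eta>(3,4)] E2[OF \<eta>(1) \<eta>T \<eta>(3,4)]
      by (simp add: algebra_simps)
    also have "\<dots> = (LINT x|lebesgue_on {0<..<L}. v0 x * \<eta> (x, 0) - (a * (v1 x * \<eta> (x, 0)) + b * (v2 x * \<eta> (x, 0))))"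
      using iv ab by simp
    also have "\<dots> = (LINT x|lebesgue_on {0<..<L}. z x * \<eta> (x, 0))"
      by (intro Bochner_Integration.integral_cong refl) (simp add: z_def algebra_simps)
    finally show "?I d_t d_xx = (LINT x|lebesgue_on {0<..<L}. z x * \<eta> (x, 0))" .
  qed
  then show ?thesis by (simp add: d_def z_def algebra_simps)
qed

section \<open>Existence and uniqueness of the minimiser\<close>

text \<open>Fatou's lemma for the squares. It serves twice: to let m tend to infinity in the Cauchy
  bounds, and to keep the norm constraint for the limit control.\<close>

lemma L2_Fatou:
  assumes f: "\<And>n. f n \<in> L2 S" and le: "\<And>n. (LINT x|lebesgue_on S. (f n x)\<^sup>2) \<le> c"
    and g: "g \<in> borel_measurable (lebesgue_on S)"
    and lim: "AE x in lebesgue_on S. (\<lambda>n. f n x) \<longlonglongrightarrow> g x"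
  shows "g \<in> L2 S" "(LINT x|lebesgue_on S. (g x)\<^sup>2) \<le> c"
proof -
  have fm [measurable]: "f n \<in> borel_measurable (lebesgue_on S)" for n using f by (auto simp: L2_def)
  note [measurable] = g
  have c: "0 \<le> c"
    by (rule order_trans[OF _ le[of 0]]) (intro Bochner_Integration.integral_nonneg zero_le_power2)
  have "(\<integral>\<^sup>+x. ennreal ((g x)\<^sup>2) \<partial>lebesgue_on S) = (\<integral>\<^sup>+x. liminf (\<lambda>n. ennreal ((f n x)\<^sup>2)) \<partial>lebesgue_on S)"
  proof (rule nn_integral_cong_AE)
    show "AE x in lebesgue_on S. ennreal ((g x)\<^sup>2) = liminf (\<lambda>n. ennreal ((f n x)\<^sup>2))"
      using lim
    proof eventually_elim
      case (elim x)
      then have "(\<lambda>n. ennreal ((f n x)\<^sup>2)) \<longlonglongrightarrow> ennreal ((g x)\<^sup>2)"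
        by (intro tendsto_ennrealI tendsto_intros)
      then show ?case by (intro lim_imp_Liminf[symmetric]) auto
    qed
  qed
  also have "\<dots> \<le> liminf (\<lambda>n. \<integral>\<^sup>+x. ennreal ((f n x)\<^sup>2) \<partial>lebesgue_on S)"
    by (rule nn_integral_liminf) measurable
  also have "\<dots> \<le> ennreal c"
  proof -
    have "(\<integral>\<^sup>+x. ennreal ((f n x)\<^sup>2) \<partial>lebesgue_on S) \<le> ennreal c" for n
      using f[of n] le[of n] by (subst nn_integral_eq_integral) (auto simp: L2_def intro!: ennreal_leI)
    then show ?thesis by (intro Liminf_le) auto
  qed
  finally have le_c: "(\<integral>\<^sup>+x. ennreal ((g x)\<^sup>2) \<partial>lebesgue_on S) \<le> ennreal c" .
  have int: "integrable (lebesgue_on S) (\<lambda>x. (g x)\<^sup>2)"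
    using le_c by (intro integrableI_bounded) (auto simp: le_less_trans)
  then show "g \<in> L2 S" using g by (simp add: L2_def)
  show "(LINT x|lebesgue_on S. (g x)\<^sup>2) \<le> c"
    using le_c c by (subst (asm) nn_integral_eq_integral[OF int]) auto
qed

text \<open>Increments \<open>d n\<close> of the sequence are summable almost everywhere since
  \<open>\<bar>d n\<bar> \<le> (1/2)\<^sup>n + 2\<^sup>n (d n)\<^sup>2\<close>, whose last term has a summable integral.\<close>

lemma L2_complete_geometric:
  assumes v: "\<And>n. v n \<in> L2 S"
    and cauchy: "\<And>n m. n \<le> m \<Longrightarrow> (LINT x|lebesgue_on S. (v n x - v m x)\<^sup>2) \<le> (1 / 8) ^ n"
  obtains w where "w \<in> borel_measurable (lebesgue_on S)" "AE x in lebesgue_on S. (\<lambda>n. v n x) \<longlonglongrightarrow> w x"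
    "\<And>n. (\<lambda>x. v n x - w x) \<in> L2 S" "\<And>n. (LINT x|lebesgue_on S. (v n x - w x)\<^sup>2) \<le> (1 / 8) ^ n"
proof -
  have vm [measurable]: "v n \<in> borel_measurable (lebesgue_on S)" for n using v by (auto simp: L2_def)
  define d where "d = (\<lambda>n x. v (Suc n) x - v n x)"
  have d: "d n \<in> L2 S" for n unfolding d_def by (intro L2_diff v)
  have dm [measurable]: "d n \<in> borel_measurable (lebesgue_on S)" for n using d by (auto simp: L2_def)
  have d_le: "(LINT x|lebesgue_on S. (d n x)\<^sup>2) \<le> (1 / 8) ^ n" for n
    using cauchy[of n "Suc n"] by (simp add: d_def power2_commute)
  \<comment> \<open>The rate 1/8 leaves room for the weight 2^n: the weighted integrals are bounded
    by 4^-n, still summable.\<close>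
  have nn_le: "(\<integral>\<^sup>+x. ennreal (2 ^ n * (d n x)\<^sup>2) \<partial>lebesgue_on S) \<le> ennreal ((1 / 4) ^ n)" for n
  proof -
    have "(\<integral>\<^sup>+x. ennreal (2 ^ n * (d n x)\<^sup>2) \<partial>lebesgue_on S) = ennreal (2 ^ n * (LINT x|lebesgue_on S. (d n x)\<^sup>2))"
      using d[of n] by (subst nn_integral_eq_integral) (auto simp: L2_def)
    also have "\<dots> \<le> ennreal (2 ^ n * (1 / 8) ^ n)"
      using d_le[of n] by (intro ennreal_leI mult_left_mono) auto
    also have "(2::real) ^ n * (1 / 8) ^ n = (1 / 4) ^ n" by (simp flip: power_mult_distrib)
    finally show ?thesis .
  qed
  have "(\<integral>\<^sup>+x. (\<Sum>n. ennreal (2 ^ n * (d n x)\<^sup>2)) \<partial>lebesgue_on S) =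
      (\<Sum>n. \<integral>\<^sup>+x. ennreal (2 ^ n * (d n x)\<^sup>2) \<partial>lebesgue_on S)"
    by (rule nn_integral_suminf) measurable
  also have "\<dots> \<le> (\<Sum>n. ennreal ((1 / 4) ^ n))"
    by (intro suminf_le nn_le) auto
  also have "\<dots> = ennreal (\<Sum>n. (1 / 4) ^ n)"
    by (intro suminf_ennreal2) (auto intro: summable_geometric)
  also have "\<dots> < \<infinity>" by simp
  finally have "AE x in lebesgue_on S. (\<Sum>n. ennreal (2 ^ n * (d n x)\<^sup>2)) \<noteq> \<infinity>"
    by (intro nn_integral_PInf_AE) auto
  then have conv: "AE x in lebesgue_on S. (\<lambda>n. v n x) \<longlonglongrightarrow> lim (\<lambda>n. v n x)"
  proof eventually_elim
    case (elim x)
    then have "summable (\<lambda>n. 2 ^ n * (d n x)\<^sup>2)"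
      by (intro summable_suminf_not_top) auto
    then have sum: "summable (\<lambda>n. (1 / 2) ^ n + 2 ^ n * (d n x)\<^sup>2)"
      by (intro summable_add summable_geometric) auto
    have "summable (\<lambda>n. d n x)"
    proof (rule summable_comparison_test'[OF sum])
      fix n
      define p :: real where "p = 2 ^ n"
      have p: "p > 0" by (simp add: p_def)
      \<comment> \<open>Expanding this square with p = 2^n bounds twice |d| by 1/p + p d^2, more
        than is asked for.\<close>
      have "0 \<le> (1 - p * \<bar>d n x\<bar>)\<^sup>2 / p" using p by simp
      also have "\<dots> = 1 / p - 2 * \<bar>d n x\<bar> + p * (d n x)\<^sup>2"
        using p by (simp add: power2_eq_square field_simps)
      finally show "norm (d n x) \<le> (1 / 2) ^ n + 2 ^ n * (d n x)\<^sup>2"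
        by (simp add: p_def power_one_over)
    qed
    then have "(\<lambda>n. \<Sum>i<n. d i x) \<longlonglongrightarrow> (\<Sum>i. d i x)" by (rule summable_LIMSEQ)
    moreover have "(\<Sum>i<n. d i x) = v n x - v 0 x" for n
      unfolding d_def by (rule sum_lessThan_telescope)
    ultimately have "(\<lambda>n. (v n x - v 0 x) + v 0 x) \<longlonglongrightarrow> (\<Sum>i. d i x) + v 0 x"
      by (intro tendsto_add tendsto_const) simp
    then show ?case by (auto simp: convergent_LIMSEQ_iff[symmetric] convergent_def)
  qed
  define w where "w = (\<lambda>x. lim (\<lambda>n. v n x))"
  have w [measurable]: "w \<in> borel_measurable (lebesgue_on S)"
    unfolding w_def by (rule borel_measurable_lim_metric) simp
  have "(\<lambda>x. v n x - w x) \<in> L2 S \<and> (LINT x|lebesgue_on S. (v n x - w x)\<^sup>2) \<le> (1 / 8) ^ n" for n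
  proof -
    have "AE x in lebesgue_on S. (\<lambda>m. v n x - v (n + m) x) \<longlonglongrightarrow> v n x - w x"
      using conv
    proof eventually_elim
      case (elim x)
      then have "(\<lambda>m. v (m + n) x) \<longlonglongrightarrow> w x" unfolding w_def by (rule LIMSEQ_ignore_initial_segment)
      then show ?case by (intro tendsto_intros) (simp add: add.commute)
    qed
    from L2_Fatou[OF L2_diff[OF v v] cauchy[OF le_add1] _ this] show ?thesis by simp
  qed
  moreover have "AE x in lebesgue_on S. (\<lambda>n. v n x) \<longlonglongrightarrow> w x"
    using conv by (simp only: w_def)
  ultimately show ?thesis using w by (intro that[of w]) auto
qed

text \<open>Pointwise, the right side minus the left is (\<delta> f - g)^2 / \<delta>. The free
  \<delta> lets the factor of the main term tend to 1 while the perturbation stays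
  controlled.\<close>

lemma L2_add_square_le:
  assumes f: "f \<in> L2 S" and g: "g \<in> L2 S" and \<delta>: "\<delta> > 0"
  shows "(LINT x|lebesgue_on S. (f x + g x)\<^sup>2) \<le>
    (1 + \<delta>) * (LINT x|lebesgue_on S. (f x)\<^sup>2) + (1 + 1 / \<delta>) * (LINT x|lebesgue_on S. (g x)\<^sup>2)"
proof -
  have int: "integrable (lebesgue_on S) (\<lambda>x. (f x)\<^sup>2)" "integrable (lebesgue_on S) (\<lambda>x. (g x)\<^sup>2)"
    "integrable (lebesgue_on S) (\<lambda>x. (f x + g x)\<^sup>2)"
    using f g L2_add[OF f g] by (auto simp: L2_def)
  have "(LINT x|lebesgue_on S. (f x + g x)\<^sup>2) \<le>
      (LINT x|lebesgue_on S. (1 + \<delta>) * (f x)\<^sup>2 + (1 + 1 / \<delta>) * (g x)\<^sup>2)"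
  proof (rule integral_mono)
    fix x
    have "0 \<le> (\<delta> * f x - g x)\<^sup>2 / \<delta>" using \<delta> by simp
    also have "\<dots> = (1 + \<delta>) * (f x)\<^sup>2 + (1 + 1 / \<delta>) * (g x)\<^sup>2 - (f x + g x)\<^sup>2"
      using \<delta> by (simp add: power2_eq_square field_simps)
    finally show "(f x + g x)\<^sup>2 \<le> (1 + \<delta>) * (f x)\<^sup>2 + (1 + 1 / \<delta>) * (g x)\<^sup>2" by simp
  qed (use int in simp_all)
  also have "\<dots> = (1 + \<delta>) * (LINT x|lebesgue_on S. (f x)\<^sup>2) + (1 + 1 / \<delta>) * (LINT x|lebesgue_on S. (g x)\<^sup>2)"
    using int by simp
  finally show ?thesis .
qed

text \<open>The negative last term is the strong convexity of the squared norm; multiplied by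
  \<alpha> it forces minimising sequences to be Cauchy and minimisers to coincide.\<close>

lemma L2_parallelogram:
  assumes f: "f \<in> L2 S" and g: "g \<in> L2 S"
  shows "(LINT x|lebesgue_on S. ((f x + g x) / 2)\<^sup>2) =
    ((LINT x|lebesgue_on S. (f x)\<^sup>2) + (LINT x|lebesgue_on S. (g x)\<^sup>2)) / 2 -
    (LINT x|lebesgue_on S. (f x - g x)\<^sup>2) / 4"
proof -
  have int: "integrable (lebesgue_on S) (\<lambda>x. (f x)\<^sup>2)" "integrable (lebesgue_on S) (\<lambda>x. (g x)\<^sup>2)"
    "integrable (lebesgue_on S) (\<lambda>x. (f x - g x)\<^sup>2)"
    using f g L2_diff[OF f g] by (auto simp: L2_def)
  have "(LINT x|lebesgue_on S. ((f x + g x) / 2)\<^sup>2) =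
      (LINT x|lebesgue_on S. ((f x)\<^sup>2 + (g x)\<^sup>2) / 2 - (f x - g x)\<^sup>2 / 4)"
    by (intro Bochner_Integration.integral_cong refl) (simp add: power2_eq_square field_simps)
  also have "\<dots> = ((LINT x|lebesgue_on S. (f x)\<^sup>2) + (LINT x|lebesgue_on S. (g x)\<^sup>2)) / 2 -
      (LINT x|lebesgue_on S. (f x - g x)\<^sup>2) / 4"
    using int by simp
  finally show ?thesis .
qed

lemma L2_midpoint_le:
  assumes "f \<in> L2 S" "g \<in> L2 S"
  shows "(LINT x|lebesgue_on S. ((f x + g x) / 2)\<^sup>2) \<le>
    ((LINT x|lebesgue_on S. (f x)\<^sup>2) + (LINT x|lebesgue_on S. (g x)\<^sup>2)) / 2"
proof -
  have "0 \<le> (LINT x|lebesgue_on S. (f x - g x)\<^sup>2)"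
    by (intro Bochner_Integration.integral_nonneg zero_le_power2)
  then show ?thesis unfolding L2_parallelogram[OF assms] by linarith
qed

lemma V_ad_iff:
  assumes "v_c \<ge> 0"
  shows "v \<in> V_ad L v_c \<longleftrightarrow> v \<in> L2 {0<..<L} \<and> (LINT x|lebesgue_on {0<..<L}. (v x)\<^sup>2) \<le> v_c\<^sup>2"
  using assms by (auto simp: V_ad_def L2_norm_def real_sqrt_le_iff' intro: sqrt_le_D)

theorem theorem1:
  fixes L T \<alpha> v_c :: real
    and k w :: "real \<Rightarrow> real"
    and F y :: "real \<times> real \<Rightarrow> real"
    and u :: "(real \<Rightarrow> real) \<Rightarrow> real \<times> real \<Rightarrow> real"
  assumes "L > 0" and "T > 0" and "\<alpha> > 0" and "v_c \<ge> 0"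
    and "k \<in> Linfty {0<..<L}" and "AE x in lebesgue_on {0<..<L}. k x > 0"
    and "w \<in> H2 L"
    and "F \<in> L2 (\<Omega> L T)" and "y \<in> L2 (\<Omega> L T)"
    and "\<And>v. v \<in> V_ad L v_c \<Longrightarrow> weak_solution L T k w v F (u v)"
  shows "\<exists>v\<in>V_ad L v_c.
           J_cost L T \<alpha> y u v = (INF v'\<in>V_ad L v_c. J_cost L T \<alpha> y u v') \<and>
           (\<forall>v2\<in>V_ad L v_c.
              J_cost L T \<alpha> y u v2 = (INF v'\<in>V_ad L v_c. J_cost L T \<alpha> y u v') \<longrightarrow>
              (AE x in lebesgue_on {0<..<L}. v2 x = v x))"
proof -
  let ?S = "{0<..<L}" and ?Q = "\<Omega> L T" and ?V = "V_ad L v_c" and ?J = "J_cost L T \<alpha> y u"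
  let ?n = "\<lambda>v v'. LINT x|lebesgue_on ?S. (v x - v' x)\<^sup>2"
  define C where "C = 4 * T * exp T"
  have C: "C > 0" using assms(2) by (simp add: C_def)
  note V_iff = V_ad_iff[OF assms(4)]
  have VL2: "v \<in> L2 ?S" if "v \<in> ?V" for v using that by (simp add: V_iff)
  have uL2: "u v \<in> L2 ?Q" if "v \<in> ?V" for v
    using assms(10)[OF that] by (auto simp: weak_solution_def H21_hat_def H21_def)
  note uyL2 = L2_diff[OF uL2 assms(9)]
  have estimate: "(LINT p|lebesgue_on ?Q. (u v0 p - (a * u v1 p + b * u v2 p))\<^sup>2) \<le>
      C * (LINT x|lebesgue_on ?S. (v0 x - (a * v1 x + b * v2 x))\<^sup>2)"
    if "v0 \<in> ?V" "v1 \<in> ?V" "v2 \<in> ?V" "a + b = 1" for v0 v1 v2 a b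
    unfolding C_def
    by (rule weak_solution_affine_estimate[OF assms(1,2,5,6,8) that(4)])
      (auto intro: VL2 assms(10) that)
  have lipschitz: "(LINT p|lebesgue_on ?Q. (u v p - u v' p)\<^sup>2) \<le> C * ?n v v'"
    if "v \<in> ?V" "v' \<in> ?V" for v v'
    using estimate[OF that(1) that(2) that(2), of 1 0] by simp
  have J_nonneg: "0 \<le> ?J v" for v
    unfolding J_cost_def using assms(3) by (intro add_nonneg_nonneg mult_nonneg_nonneg Bochner_Integration.integral_nonneg) auto
  have bdd: "bdd_below (?J ` ?V)" by (intro bdd_belowI2[of _ 0] J_nonneg)
  \<comment> \<open>The zero control makes the infimum one over a nonempty set.\<close>
  have "(\<lambda>x. 0) \<in> ?V" by (simp add: V_iff L2_def)
  then have V_ne: "?V \<noteq> {}" by blast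
  define I where "I = (INF v\<in>?V. ?J v)"
  have I_le: "I \<le> ?J v" if "v \<in> ?V" for v
    unfolding I_def by (rule cINF_lower[OF bdd that])

  \<comment> \<open>Strong convexity at the midpoint \<open>m\<close>: the tracking term is convex
    because the state at \<open>m\<close> is almost everywhere the mean of the two states, and the
    control cost supplies the quadratic gain. Both existence and uniqueness rest on this
    inequality.\<close>
  have gap: "\<alpha> / 4 * ?n v v' \<le> (?J v + ?J v') / 2 - I" if v: "v \<in> ?V" and v': "v' \<in> ?V" for v v'
  proof -
    define m where "m = (\<lambda>x. (v x + v' x) / 2)"
    have m_sq: "(LINT x|lebesgue_on ?S. (m x)\<^sup>2) =
        ((LINT x|lebesgue_on ?S. (v x)\<^sup>2) + (LINT x|lebesgue_on ?S. (v' x)\<^sup>2)) / 2 - ?n v v' / 4"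
      unfolding m_def by (rule L2_parallelogram[OF VL2[OF v] VL2[OF v']])
    have "m \<in> L2 ?S"
      using L2_cmult[OF L2_add[OF VL2[OF v] VL2[OF v']], of "1 / 2"] by (simp add: m_def)
    moreover have "(LINT x|lebesgue_on ?S. (m x)\<^sup>2) \<le> v_c\<^sup>2"
      using L2_midpoint_le[OF VL2[OF v] VL2[OF v']] v v' by (simp add: m_def V_iff)
    ultimately have m: "m \<in> ?V" by (simp add: V_iff)
    have "(LINT p|lebesgue_on ?Q. (u m p - (1 / 2 * u v p + 1 / 2 * u v' p))\<^sup>2) \<le>
        C * (LINT x|lebesgue_on ?S. (m x - (1 / 2 * v x + 1 / 2 * v' x))\<^sup>2)"
      by (rule estimate[OF m v v']) simp
    \<comment> \<open>At the midpoint the velocity difference is zero, so the estimate forces the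
      states to agree almost everywhere.\<close>
    also have "(LINT x|lebesgue_on ?S. (m x - (1 / 2 * v x + 1 / 2 * v' x))\<^sup>2) = 0"
      by (simp add: m_def field_simps)
    finally have "(LINT p|lebesgue_on ?Q. (u m p - (1 / 2 * u v p + 1 / 2 * u v' p))\<^sup>2) = 0"
      by (intro antisym Bochner_Integration.integral_nonneg) auto
    moreover have "(\<lambda>p. u m p - (1 / 2 * u v p + 1 / 2 * u v' p)) \<in> L2 ?Q"
      by (intro L2_diff L2_add L2_cmult uL2 m v v')
    ultimately have ae: "AE p in lebesgue_on ?Q. (u m p - (1 / 2 * u v p + 1 / 2 * u v' p))\<^sup>2 = 0"
      by (subst (asm) integral_nonneg_eq_0_iff_AE) (auto simp: L2_def)
    have "(LINT p|lebesgue_on ?Q. (u m p - y p)\<^sup>2) =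
        (LINT p|lebesgue_on ?Q. (((u v p - y p) + (u v' p - y p)) / 2)\<^sup>2)"
    proof (rule integral_cong_AE)
      show "AE p in lebesgue_on ?Q. (u m p - y p)\<^sup>2 = (((u v p - y p) + (u v' p - y p)) / 2)\<^sup>2"
        using ae
      proof eventually_elim
        case (elim p)
        then have "u m p - y p = ((u v p - y p) + (u v' p - y p)) / 2" by (simp add: field_simps)
        then show ?case by (simp only:)
      qed
    qed (use uL2[OF m] uL2[OF v] uL2[OF v'] assms(9) in \<open>auto simp: L2_def\<close>)
    also have "\<dots> \<le> ((LINT p|lebesgue_on ?Q. (u v p - y p)\<^sup>2) + (LINT p|lebesgue_on ?Q. (u v' p - y p)\<^sup>2)) / 2"
      by (rule L2_midpoint_le[OF uyL2[OF v] uyL2[OF v']])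
    finally have "?J m \<le> (?J v + ?J v') / 2 - \<alpha> / 4 * ?n v v'"
      unfolding J_cost_def m_sq by (simp add: field_simps)
    with I_le[OF m] show ?thesis by linarith
  qed

  \<comment> \<open>The tolerance is chosen so that \<open>gap\<close> yields exactly the rate
    (1/8)^n of the completeness lemma.\<close>
  define \<epsilon> where "\<epsilon> = (\<lambda>n. \<alpha> / 4 * (1 / 8) ^ n :: real)"
  have "\<exists>v. v \<in> ?V \<and> ?J v \<le> I + \<epsilon> n" for n
  proof -
    have "I < I + \<epsilon> n" using assms(3) by (simp add: \<epsilon>_def)
    then show ?thesis
      unfolding I_def using cINF_less_iff[OF V_ne bdd] by (meson less_imp_le)
  qed
  then obtain v where v: "\<And>n. v n \<in> ?V" "\<And>n. ?J (v n) \<le> I + \<epsilon> n" by metis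
  have cauchy: "?n (v n) (v m) \<le> (1 / 8) ^ n" if "n \<le> m" for n m
  proof -
    have "\<epsilon> m \<le> \<epsilon> n"
      unfolding \<epsilon>_def using assms(3) that by (intro mult_left_mono power_decreasing) auto
    then have "\<alpha> / 4 * ?n (v n) (v m) \<le> \<epsilon> n"
      using gap[OF v(1) v(1), of n m, unfolded add_divide_distrib] v(2)[of n] v(2)[of m] by linarith
    then show ?thesis using assms(3) by (simp add: \<epsilon>_def)
  qed
  \<comment> \<open>From here on \<open>w\<close> is the limit control and hides the initial
    displacement of the same name.\<close>
  obtain w where w: "w \<in> borel_measurable (lebesgue_on ?S)" "AE x in lebesgue_on ?S. (\<lambda>n. v n x) \<longlonglongrightarrow> w x"
    "\<And>n. (\<lambda>x. v n x - w x) \<in> L2 ?S" "\<And>n. ?n (v n) w \<le> (1 / 8) ^ n"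
    using L2_complete_geometric[of v ?S] VL2[OF v(1)] cauchy by blast
  \<comment> \<open>Fatou's lemma makes the norm constraint survive the almost everywhere
    limit.\<close>
  have wV: "w \<in> ?V"
    using L2_Fatou[of v ?S "v_c\<^sup>2" w] v(1) w(1,2) by (auto simp: V_iff)
  have Jw: "?J w \<le> (1 + (1 / 2) ^ n) * (I + \<epsilon> n) + (C + \<alpha>) * ((1 / 8) ^ n + (1 / 4) ^ n)" for n
  proof -
    \<comment> \<open>\<delta> = 2^-n tends to 0, yet 1/\<delta> times the squared distance 8^-n is
      only 4^-n, so both errors vanish in the limit.\<close>
    define \<delta> :: real where "\<delta> = (1 / 2) ^ n"
    have \<delta>: "\<delta> > 0" by (simp add: \<delta>_def)
    have nw: "?n w (v n) \<le> (1 / 8) ^ n" using w(4)[of n] by (simp add: power2_commute)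
    have "(LINT p|lebesgue_on ?Q. (u w p - u (v n) p)\<^sup>2) \<le> C * (1 / 8) ^ n"
      using lipschitz[OF wV v(1), of n] nw C by (meson mult_left_mono less_imp_le order_trans)
    then have "(LINT p|lebesgue_on ?Q. ((u (v n) p - y p) + (u w p - u (v n) p))\<^sup>2) \<le>
        (1 + \<delta>) * (LINT p|lebesgue_on ?Q. (u (v n) p - y p)\<^sup>2) + (1 + 1 / \<delta>) * (C * (1 / 8) ^ n)"
      using \<delta> by (intro order_trans[OF L2_add_square_le[OF uyL2[OF v(1)] L2_diff[OF uL2[OF wV] uL2[OF v(1)]] \<delta>]]
          add_left_mono mult_left_mono) auto
    moreover have "(LINT x|lebesgue_on ?S. (v n x + (w x - v n x))\<^sup>2) \<le>
        (1 + \<delta>) * (LINT x|lebesgue_on ?S. (v n x)\<^sup>2) + (1 + 1 / \<delta>) * (1 / 8) ^ n"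
      using \<delta> nw by (intro order_trans[OF L2_add_square_le[OF VL2[OF v(1)] L2_diff[OF VL2[OF wV] VL2[OF v(1)]] \<delta>]]
          add_left_mono mult_left_mono) auto
    then have "\<alpha> * (LINT x|lebesgue_on ?S. (v n x + (w x - v n x))\<^sup>2) \<le>
        \<alpha> * ((1 + \<delta>) * (LINT x|lebesgue_on ?S. (v n x)\<^sup>2) + (1 + 1 / \<delta>) * (1 / 8) ^ n)"
      using assms(3) by (intro mult_left_mono) auto
    ultimately have "?J w \<le> (1 + \<delta>) * ?J (v n) + (C + \<alpha>) * ((1 + 1 / \<delta>) * (1 / 8) ^ n)"
      unfolding J_cost_def by (simp add: algebra_simps add_divide_distrib)
    also have "\<dots> \<le> (1 + \<delta>) * (I + \<epsilon> n) + (C + \<alpha>) * ((1 + 1 / \<delta>) * (1 / 8) ^ n)"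
      using \<delta> v(2)[of n] by (intro add_right_mono mult_left_mono) auto
    also have "(1 + 1 / \<delta>) * (1 / 8) ^ n = (1 / 8) ^ n + (1 / 4) ^ n"
    proof -
      have "1 / \<delta> * (1 / 8) ^ n = (2 * (1 / 8)) ^ n"
        unfolding power_mult_distrib by (simp add: \<delta>_def power_one_over)
      then show ?thesis by (simp add: distrib_right)
    qed
    finally show ?thesis by (simp add: \<delta>_def)
  qed
  have "(\<lambda>n. (1 + (1 / 2) ^ n) * (I + \<epsilon> n) + (C + \<alpha>) * ((1 / 8) ^ n + (1 / 4) ^ n))
      \<longlonglongrightarrow> (1 + 0) * (I + \<alpha> / 4 * 0) + (C + \<alpha>) * (0 + 0)"
    unfolding \<epsilon>_def by (intro tendsto_intros LIMSEQ_power_zero) auto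
  then have "?J w \<le> I" using Jw by (intro LIMSEQ_le_const) auto
  with I_le[OF wV] have wI: "?J w = I" by simp
  moreover have "AE x in lebesgue_on ?S. v2 x = w x" if v2: "v2 \<in> ?V" "?J v2 = I" for v2
  proof -
    \<comment> \<open>For two minimisers the right side of \<open>gap\<close> is 0, which leaves no
      room for a positive distance.\<close>
    have "\<alpha> / 4 * ?n v2 w \<le> 0" using gap[OF v2(1) wV] v2(2) wI by simp
    then have "?n v2 w \<le> 0" using assms(3) by (simp add: mult_le_0_iff)
    then have "?n v2 w = 0" by (intro antisym Bochner_Integration.integral_nonneg) auto
    then have "AE x in lebesgue_on ?S. (v2 x - w x)\<^sup>2 = 0"
      using L2_diff[OF VL2[OF v2(1)] VL2[OF wV]]
      by (subst (asm) integral_nonneg_eq_0_iff_AE) (auto simp: L2_def)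
    then show ?thesis by eventually_elim simp
  qed
  ultimately show ?thesis using wV unfolding I_def by blast
qed

end
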